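(* Let $X$ be a centered Gaussian random field on $\mathcal D$ whose covariance kernel is of the form $K(x,y)=L(x,y)+\log\frac{1}{|x-y|}$ with $L$ continuous and $L\in H^{s}_{\mathrm{loc}}(\mathcal D^2)$ for some $s>d$. Let $\gamma=\alpha+i\beta$ with $\alpha,\beta\in\mathbb R$, $|\alpha|<\sqrt{d/2}$, $\alpha^2+\beta^2\ge d$, and let $\rho\in C_c^\infty(\mathcal D)$. Then the family of random distributions $\big(v(\varepsilon,\theta,\gamma)M^{(\gamma)}_\varepsilon(\rho\,\cdot)\big)_{\varepsilon\in(0,1)}$ is tight in $H^{-u}(\mathbb R^d)$ for any $u>d/2$.
   Context: **Setting.** $d\ge1$, $\mathcal D\subset\mathbb R^d$ is open, and $K$ is a positive definite (symmetric) kernel on $\mathcal D$, meaning $\int_{\mathcal D^2}K(x,y)\rho(x)\rho(y)\,dx\,dy\ge0$ for every bounded continuous $\rho$ with compact support in $\mathcal D$. $\mathcal M_K^+$ is the set of positive Borel measures $\mu$ on $\mathcal D$ with $\int_{\mathcal D^2}|K(x,y)|\mu(dx)\mu(dy)<\infty$, and $\mathcal M_K=\{\mu_+-\mu_-:\mu_\pm\in\mathcal M_K^+\}$. The field with covariance kernel $K$ is the centered Gaussian process $X=(\langle X,\mu\rangle)_{\mu\in\mathcal M_K}$ with covariance $\mathbb E[\langle X,\mu\rangle\langle X,\mu'\rangle]=\int_{\mathcal D^2}K(x,y)\mu(dx)\mu'(dy)$. **Convolution approximation.** $\theta\ge0$ is $C^\infty$ with compact support included in the unit ball $B(0,1)$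 of $\mathbb R^d$, $\int\theta=1$, $\theta_\varepsilon=\varepsilon^{-d}\theta(\varepsilon^{-1}\cdot)$. $\mathcal D_\varepsilon=\{x\in\mathcal D:\min_{y\in\mathbb R^d\setminus\mathcal D}|x-y|\ge2\varepsilon\}$ ($=\mathbb R^d$ if $\mathcal D=\mathbb R^d$). For $x\in\mathcal D_\varepsilon$, $X_\varepsilon(x)=\langle X,\theta_\varepsilon(x-\cdot)\rangle$ (continuous version), where the function $\theta_\varepsilon(x-\cdot)$ is identified with the measure $\theta_\varepsilon(x-y)\,dy$; $K_\varepsilon(x,y)=\mathbb E[X_\varepsilon(x)X_\varepsilon(y)]$, $K_\varepsilon(x)=K_\varepsilon(x,x)$. $C_c^\infty(\mathcal D)$ denotes the real-valued smooth functions with compact support in $\mathcal D$. For $f\in C_c^\infty(\mathcal D)$, $$M^{(\gamma)}_\varepsilon(f)=\int_{\mathbb R^d}f(x)e^{\gamma X_\varepsilon(x)-\frac{\gamma^2}{2}K_\varepsilon(x)}\mathbf 1_{\mathcal D_\varepsilon}(x)\,dx ,$$ and $M^{(\gamma)}_\varepsilon(\rho\,\cdot)$ is the distribution $f\mapsto M^{(\gamma)}_\varepsilon(\rho f)$ on $\mathbb R^d$. **Normalization.** $\ell_\theta(z)=\int_{\mathbb R^d}\int_{\mathbb R^d}\log\frac{1}{|z+z_1-z_2|}\theta(z_1)\theta(z_2)\,dz_1dz_2$ and $$v(\varepsilon,\theta,\gamma)=\varepsilon^{\frac{|\gamma|^2-d}{2}}\Big(\tfrac12\int_{\mathbb R^d}e^{|\gamma|^2\ell_\theta(z)}dz\Big)^{-1/2}\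 \text{if }|\gamma|>\sqrt d,\qquad v(\varepsilon,\theta,\gamma)=\Big(\tfrac{\pi^{d/2}}{\Gamma(d/2)}\log\tfrac1\varepsilon\Big)^{-1/2}\ \text{if }|\gamma|=\sqrt d.$$ **Sobolev spaces.** For $s\in\mathbb R$, $H^s(\mathbb R^k)$ is the Hilbert space associated with the norm $\|\varphi\|_{H^s(\mathbb R^k)}^2=\int_{\mathbb R^k}(1+|\xi|^2)^s|\hat\varphi(\xi)|^2d\xi$, with $\hat\varphi(\xi)=\int_{\mathbb R^k} e^{i\xi x}\varphi(x)dx$ for $\varphi\in C_c^\infty(\mathbb R^k)$. For $U\subset\mathbb R^k$ open, $\varphi\in H^s_{\mathrm{loc}}(U)$ iff $\rho\varphi\in H^s(\mathbb R^k)$ (extension by zero) for every $\rho\in C_c^\infty(U)$.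
   Formalization: When |γ| = √d, tightness is proved for ε in (0, ε₀] for every ε₀ < 1, instead of ε in (0,1), because v(ε,θ,γ) tends to infinity as ε tends to 1 and the claim on all of (0,1) then fails; for |γ| > √d the full range (0,1) is covered. *)

theory Defs
  imports "HOL-Probability.Probability"
begin

section \<open>Smooth functions and test functions\<close>

primrec C_k :: "nat \<Rightarrow> ('b::euclidean_space \<Rightarrow> real) \<Rightarrow> bool" where
  "C_k 0 f \<longleftrightarrow> continuous_on UNIV f"
| "C_k (Suc k) f \<longleftrightarrow>
     (\<forall>x. f differentiable (at x)) \<and> (\<forall>v. C_k k (\<lambda>x. frechet_derivative f (at x) v))"

definition smooth :: "('b::euclidean_space \<Rightarrow> real) \<Rightarrow> bool" where
  "smooth f \<longleftrightarrow> (\<forall>k. C_k k f)"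

definition tsupport :: "('b::topological_space \<Rightarrow> real) \<Rightarrow> 'b set" where
  "tsupport f = closure {x. f x \<noteq> 0}"

text \<open>The elements of \<open>C\<^sub>c\<^sup>\<infinity>(U)\<close>, extended by \<open>0\<close> to the whole space.\<close>

definition test_functions :: "'b::euclidean_space set \<Rightarrow> ('b \<Rightarrow> real) set" where
  "test_functions U = {f. smooth f \<and> compact (tsupport f) \<and> tsupport f \<subseteq> U}"


section \<open>Sobolev spaces\<close>

text \<open>A complex distribution is given by its values on real test functions (it extends to complex
  ones by linearity); it is \<open>undefined\<close> on all other functions, so that two distributions are
  equal iff they agree on test functions.\<close>

type_synonym 'b distribution = "('b \<Rightarrow> real) \<Rightarrow> complex"

definition regular_distribution :: "('b::euclidean_space \<Rightarrow> complex) \<Rightarrow> 'b distribution" where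
  "regular_distribution \<phi> = (\<lambda>f\<in>test_functions UNIV. LINT x|lborel. \<phi> x * of_real (f x))"

definition fourier :: "('b::euclidean_space \<Rightarrow> complex) \<Rightarrow> 'b \<Rightarrow> complex" where
  "fourier \<phi> \<xi> = (LINT x|lborel. exp (\<i> * of_real (\<xi> \<bullet> x)) * \<phi> x)"

text \<open>The function \<open>g\<close> is the Fourier transform of the distribution \<open>T\<close>. The formula is Parseval's
  identity \<open>\<integral> \<phi>(x) f(x) dx = (2\<pi>)\<^sup>-\<^sup>k \<integral> \<phi>\<^sup>^(\<xi>) f\<^sup>^(-\<xi>) d\<xi>\<close>. The integrability requirement rules out
  functions \<open>g\<close> whose integrals take the default value \<open>0\<close>; with it \<open>g\<close> is unique up to null sets.\<close>

definition has_fourier_transform ::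
    "'b::euclidean_space distribution \<Rightarrow> ('b \<Rightarrow> complex) \<Rightarrow> bool" where
  "has_fourier_transform T g \<longleftrightarrow> g \<in> borel_measurable borel \<and>
     (\<forall>f\<in>test_functions UNIV.
        integrable lborel (\<lambda>\<xi>. g \<xi> * fourier (\<lambda>x. of_real (f x)) (- \<xi>)) \<and>
        T f = (LINT \<xi>|lborel. g \<xi> * fourier (\<lambda>x. of_real (f x)) (- \<xi>)) / of_real ((2 * pi) ^ DIM('b)))"

definition fourier_transform :: "'b::euclidean_space distribution \<Rightarrow> 'b \<Rightarrow> complex" where
  "fourier_transform T = (SOME g. has_fourier_transform T g)"

definition sobolev_density :: "real \<Rightarrow> ('b::euclidean_space \<Rightarrow> complex) \<Rightarrow> 'b \<Rightarrow> real" where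
  "sobolev_density s g \<xi> = (1 + (norm \<xi>)\<^sup>2) powr s * (cmod (g \<xi>))\<^sup>2"

definition sobolev_space :: "real \<Rightarrow> 'b::euclidean_space distribution set" where
  "sobolev_space s = {T. T \<in> extensional (test_functions UNIV) \<and>
     (\<exists>g. has_fourier_transform T g \<and> integrable lborel (sobolev_density s g))}"

definition sobolev_norm :: "real \<Rightarrow> 'b::euclidean_space distribution \<Rightarrow> real" where
  "sobolev_norm s T = sqrt (LINT \<xi>|lborel. sobolev_density s (fourier_transform T) \<xi>)"

definition sobolev_topology :: "real \<Rightarrow> 'b::euclidean_space distribution topology" where
  "sobolev_topology s =
     Metric_space.mtopology (sobolev_space s) (\<lambda>S T. sobolev_norm s (\<lambda>f. S f - T f))"

text \<open>Membership of a function in \<open>H\<^sup>s\<^sub>l\<^sub>o\<^sub>c(U)\<close>. Since \<open>\<rho>\<close> vanishes off \<open>U\<close>, the product below is the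
  extension by zero, whatever the values of \<open>\<phi>\<close> off \<open>U\<close>.\<close>

definition sobolev_local :: "real \<Rightarrow> 'b::euclidean_space set \<Rightarrow> ('b \<Rightarrow> complex) \<Rightarrow> bool" where
  "sobolev_local s U \<phi> \<longleftrightarrow>
     (\<forall>\<rho>\<in>test_functions U. regular_distribution (\<lambda>x. of_real (\<rho> x) * \<phi> x) \<in> sobolev_space s)"


section \<open>Tightness\<close>

definition borel_algebra_of :: "'b topology \<Rightarrow> 'b measure" where
  "borel_algebra_of T = sigma (topspace T) {U. openin T U}"

definition tight_family :: "'w measure \<Rightarrow> 'b topology \<Rightarrow> 'i set \<Rightarrow> ('i \<Rightarrow> 'w \<Rightarrow> 'b) \<Rightarrow> bool" where
  "tight_family P T I Z \<longleftrightarrow>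
     (\<forall>i\<in>I. Z i \<in> measurable P (borel_algebra_of T)) \<and>
     (\<forall>\<delta>>0. \<exists>C. compactin T C \<and> (\<forall>i\<in>I. measure P {\<omega>\<in>space P. Z i \<omega> \<in> C} \<ge> 1 - \<delta>))"


section \<open>Kernels and Gaussian fields\<close>

text \<open>Kernels are extended-real valued. The value \<open>\<infinity>\<close> of \<open>log (1 / |x - y|)\<close> on the diagonal matters:
  it excludes measures with atoms from \<open>\<M>\<^sub>K\<^sup>+\<close>. The diagonal is then a null set for products of such
  measures, so \<^const>\<open>real_of_ereal\<close> is harmless in the integrals.\<close>

definition log_kernel :: "'a::euclidean_space \<Rightarrow> 'a \<Rightarrow> ereal" where
  "log_kernel x y = (if x = y then \<infinity> else ereal (ln (1 / norm (x - y))))"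

definition positive_definite_kernel ::
    "'a::euclidean_space set \<Rightarrow> ('a \<Rightarrow> 'a \<Rightarrow> ereal) \<Rightarrow> bool" where
  "positive_definite_kernel D K \<longleftrightarrow>
     (\<forall>x\<in>D. \<forall>y\<in>D. K x y = K y x) \<and>
     (\<forall>\<rho>. continuous_on UNIV \<rho> \<and> bounded (range \<rho>) \<and> compact (tsupport \<rho>) \<and> tsupport \<rho> \<subseteq> D \<longrightarrow>
        0 \<le> (LINT p:D \<times> D|lborel. real_of_ereal (K (fst p) (snd p)) * \<rho> (fst p) * \<rho> (snd p)))"

definition M_plus :: "'a::euclidean_space set \<Rightarrow> ('a \<Rightarrow> 'a \<Rightarrow> ereal) \<Rightarrow> 'a measure set" where
  "M_plus D K = {\<mu>. sets \<mu> = sets (restrict_space borel D) \<and>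
     (\<integral>\<^sup>+x. (\<integral>\<^sup>+y. e2ennreal \<bar>K x y\<bar> \<partial>\<mu>) \<partial>\<mu>) < \<infinity>}"

text \<open>The difference of two positive measures on \<open>D\<close> that are finite on compact sets. As both may have
  infinite total mass, it is recorded as a set function on the relatively compact Borel subsets
  of \<open>D\<close>, which determine it. For a kernel that is locally bounded below by a positive constant
  near the diagonal, as in the logarithmic case, all measures in \<^const>\<open>M_plus\<close> are finite on
  compact sets.\<close>

definition measure_diff ::
    "'a::euclidean_space set \<Rightarrow> 'a measure \<Rightarrow> 'a measure \<Rightarrow> ('a set \<Rightarrow> real)" where
  "measure_diff D \<mu> \<nu> = (\<lambda>A. if A \<in> sets borel \<and> compact (closure A) \<and> closure A \<subseteq> D
     then measure \<mu> A - measure \<nu> A else 0)"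

definition M_signed :: "'a::euclidean_space set \<Rightarrow> ('a \<Rightarrow> 'a \<Rightarrow> ereal) \<Rightarrow> ('a set \<Rightarrow> real) set" where
  "M_signed D K = {measure_diff D \<mu> \<nu> |\<mu> \<nu>. \<mu> \<in> M_plus D K \<and> \<nu> \<in> M_plus D K}"

definition centered_normal :: "real \<Rightarrow> real measure" where
  "centered_normal \<sigma> =
     (if \<sigma> = 0 then return borel 0 else density lborel (\<lambda>x. ennreal (normal_density 0 \<sigma> x)))"

definition centered_gaussian_process ::
    "'w measure \<Rightarrow> 'i set \<Rightarrow> ('i \<Rightarrow> 'w \<Rightarrow> real) \<Rightarrow> bool" where
  "centered_gaussian_process P I X \<longleftrightarrow>
     (\<forall>i\<in>I. X i \<in> borel_measurable P) \<and>
     (\<forall>F c. finite F \<and> F \<subseteq> I \<longrightarrow>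
        (\<exists>\<sigma>\<ge>0. distr P borel (\<lambda>\<omega>. \<Sum>i\<in>F. c i * X i \<omega>) = centered_normal \<sigma>))"

definition kernel_integrable :: "('a \<Rightarrow> 'a \<Rightarrow> ereal) \<Rightarrow> 'a measure \<Rightarrow> 'a measure \<Rightarrow> bool" where
  "kernel_integrable K \<mu> \<nu> \<longleftrightarrow> integrable (\<mu> \<Otimes>\<^sub>M \<nu>) (\<lambda>(x, y). real_of_ereal (K x y))"

definition kernel_integral :: "('a \<Rightarrow> 'a \<Rightarrow> ereal) \<Rightarrow> 'a measure \<Rightarrow> 'a measure \<Rightarrow> real" where
  "kernel_integral K \<mu> \<nu> = (LINT (x, y)|(\<mu> \<Otimes>\<^sub>M \<nu>). real_of_ereal (K x y))"

text \<open>The covariance of \<open>\<langle>X, \<mu>\<rangle>\<close> and \<open>\<langle>X, \<mu>'\<rangle>\<close> is prescribed whenever the double integral of \<open>K\<close>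
  against \<open>\<mu> \<otimes> \<mu>'\<close> converges absolutely. For \<open>\<mu> = \<mu>'\<close> positive this is the definition of \<open>\<M>\<^sub>K\<^sup>+\<close>;
  for measures whose supports are not compact in \<open>D\<close>, the mixed integrals may diverge, and a Bochner
  integral would then silently be \<open>0\<close>.\<close>

definition gaussian_field ::
    "'w measure \<Rightarrow> 'a::euclidean_space set \<Rightarrow> ('a \<Rightarrow> 'a \<Rightarrow> ereal) \<Rightarrow> (('a set \<Rightarrow> real) \<Rightarrow> 'w \<Rightarrow> real) \<Rightarrow> bool"
  where
  "gaussian_field P D K X \<longleftrightarrow>
     centered_gaussian_process P (M_signed D K) X \<and>
     (\<forall>\<mu>\<^sub>1\<in>M_plus D K. \<forall>\<mu>\<^sub>2\<in>M_plus D K. \<forall>\<nu>\<^sub>1\<in>M_plus D K. \<forall>\<nu>\<^sub>2\<in>M_plus D K.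
        kernel_integrable K \<mu>\<^sub>1 \<nu>\<^sub>1 \<and> kernel_integrable K \<mu>\<^sub>1 \<nu>\<^sub>2 \<and>
        kernel_integrable K \<mu>\<^sub>2 \<nu>\<^sub>1 \<and> kernel_integrable K \<mu>\<^sub>2 \<nu>\<^sub>2 \<longrightarrow>
        (LINT \<omega>|P. X (measure_diff D \<mu>\<^sub>1 \<mu>\<^sub>2) \<omega> * X (measure_diff D \<nu>\<^sub>1 \<nu>\<^sub>2) \<omega>) =
          kernel_integral K \<mu>\<^sub>1 \<nu>\<^sub>1 - kernel_integral K \<mu>\<^sub>1 \<nu>\<^sub>2
          - kernel_integral K \<mu>\<^sub>2 \<nu>\<^sub>1 + kernel_integral K \<mu>\<^sub>2 \<nu>\<^sub>2)"


section \<open>Convolution approximation and complex multiplicative chaos\<close>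

definition mollifier :: "('a::euclidean_space \<Rightarrow> real) \<Rightarrow> bool" where
  "mollifier \<theta> \<longleftrightarrow> smooth \<theta> \<and> (\<forall>x. 0 \<le> \<theta> x) \<and> compact (tsupport \<theta>) \<and> tsupport \<theta> \<subseteq> cball 0 1 \<and>
     (LINT x|lborel. \<theta> x) = 1"

definition rescaled :: "('a::euclidean_space \<Rightarrow> real) \<Rightarrow> real \<Rightarrow> 'a \<Rightarrow> real" where
  "rescaled \<theta> \<epsilon> x = \<epsilon> powr (- real DIM('a)) * \<theta> (x /\<^sub>R \<epsilon>)"

definition inner_domain :: "'a::euclidean_space set \<Rightarrow> real \<Rightarrow> 'a set" where
  "inner_domain D \<epsilon> = {x\<in>D. \<forall>y. y \<notin> D \<longrightarrow> 2 * \<epsilon> \<le> norm (x - y)}"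

text \<open>The function \<open>\<theta>\<^sub>\<epsilon>(x - \<cdot>)\<close>, identified with a measure on \<open>D\<close>.\<close>

definition mollifier_measure ::
    "'a::euclidean_space set \<Rightarrow> ('a \<Rightarrow> real) \<Rightarrow> real \<Rightarrow> 'a \<Rightarrow> ('a set \<Rightarrow> real)" where
  "mollifier_measure D \<theta> \<epsilon> x =
     measure_diff D (density (restrict_space lborel D) (\<lambda>y. ennreal (rescaled \<theta> \<epsilon> (x - y))))
       (null_measure (restrict_space borel D))"

definition continuous_mollification ::
    "'w measure \<Rightarrow> 'a::euclidean_space set \<Rightarrow> ('a \<Rightarrow> real) \<Rightarrow> (('a set \<Rightarrow> real) \<Rightarrow> 'w \<Rightarrow> real) \<Rightarrow>
      real \<Rightarrow> ('a \<Rightarrow> 'w \<Rightarrow> real) \<Rightarrow> bool" where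
  "continuous_mollification P D \<theta> X \<epsilon> Y \<longleftrightarrow>
     (\<forall>x\<in>inner_domain D \<epsilon>. Y x \<in> borel_measurable P \<and>
        (AE \<omega> in P. Y x \<omega> = X (mollifier_measure D \<theta> \<epsilon> x) \<omega>)) \<and>
     (\<forall>\<omega>\<in>space P. continuous_on (inner_domain D \<epsilon>) (\<lambda>x. Y x \<omega>))"

text \<open>\<open>M\<^sub>\<epsilon>\<^sup>(\<^sup>\<gamma>\<^sup>)(f)\<close> evaluated at \<open>\<omega>\<close>, where \<open>Y = X\<^sub>\<epsilon>\<close> and the variance is \<open>K\<^sub>\<epsilon>(x) = \<E>[X\<^sub>\<epsilon>(x)\<^sup>2]\<close>.\<close>

definition chaos ::
    "'w measure \<Rightarrow> 'a::euclidean_space set \<Rightarrow> ('a \<Rightarrow> 'w \<Rightarrow> real) \<Rightarrow> complex \<Rightarrow> real \<Rightarrow> 'w \<Rightarrow>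
      ('a \<Rightarrow> real) \<Rightarrow> complex" where
  "chaos P D Y \<gamma> \<epsilon> \<omega> f =
     (LINT x|lborel. of_real (f x) *
        exp (\<gamma> * of_real (Y x \<omega>) - \<gamma>\<^sup>2 / 2 * of_real (LINT \<omega>'|P. Y x \<omega>' * Y x \<omega>')) *
        indicator (inner_domain D \<epsilon>) x)"

definition ell :: "('a::euclidean_space \<Rightarrow> real) \<Rightarrow> 'a \<Rightarrow> real" where
  "ell \<theta> z = (LINT z\<^sub>1|lborel. LINT z\<^sub>2|lborel. ln (1 / norm (z + z\<^sub>1 - z\<^sub>2)) * \<theta> z\<^sub>1 * \<theta> z\<^sub>2)"

text \<open>Only meant for \<open>|\<gamma>| \<ge> \<surd>d\<close>, so that the second branch is the critical case \<open>|\<gamma>| = \<surd>d\<close>. There the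
  normalization tends to infinity when \<open>\<epsilon>\<close> increases to \<open>1\<close>, so that tightness can then only hold for
  \<open>\<epsilon>\<close> bounded away from \<open>1\<close>.\<close>

definition normalization_const :: "real \<Rightarrow> ('a::euclidean_space \<Rightarrow> real) \<Rightarrow> complex \<Rightarrow> real" where
  "normalization_const \<epsilon> \<theta> \<gamma> =
     (if cmod \<gamma> > sqrt DIM('a)
      then \<epsilon> powr (((cmod \<gamma>)\<^sup>2 - real DIM('a)) / 2) *
           ((1 / 2) * (LINT z|lborel. exp ((cmod \<gamma>)\<^sup>2 * ell \<theta> z))) powr (- 1 / 2)
      else (pi powr (real DIM('a) / 2) / Gamma (real DIM('a) / 2) * ln (1 / \<epsilon>)) powr (- 1 / 2))"

text \<open>The random distribution \<open>v(\<epsilon>, \<theta>, \<gamma>) M\<^sub>\<epsilon>\<^sup>(\<^sup>\<gamma>\<^sup>)(\<rho> \<cdot>)\<close> evaluated at \<open>\<omega>\<close>.\<close>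

definition normalized_chaos ::
    "'w measure \<Rightarrow> 'a::euclidean_space set \<Rightarrow> ('a \<Rightarrow> real) \<Rightarrow> ('a \<Rightarrow> 'w \<Rightarrow> real) \<Rightarrow> complex \<Rightarrow>
      ('a \<Rightarrow> real) \<Rightarrow> real \<Rightarrow> 'w \<Rightarrow> 'a distribution" where
  "normalized_chaos P D \<theta> Y \<gamma> \<rho> \<epsilon> \<omega> =
     (\<lambda>f\<in>test_functions UNIV.
        of_real (normalization_const \<epsilon> \<theta> \<gamma>) * chaos P D Y \<gamma> \<epsilon> \<omega> (\<lambda>x. \<rho> x * f x))"

end

theory Submission
  imports Defs "HOL-Complex_Analysis.Complex_Analysis" "HOL-Real_Asymp.Real_Asymp"
begin

text \<open>Write \<open>X\<^sub>\<epsilon>\<close> for the mollified field and \<open>E\<^sub>\<epsilon>(x) = exp (\<gamma> X\<^sub>\<epsilon>(x) - \<gamma>\<^sup>2 K\<^sub>\<epsilon>(x) / 2)\<close> for the density of the chaos.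
  For jointly Gaussian variables the normalizing terms cancel the variances, and what remains is
  \<open>\<E> [E\<^sub>\<epsilon>(x) cnj (E\<^sub>\<epsilon>(y))] = exp (|\<gamma>|\<^sup>2 K\<^sub>\<epsilon>(x, y))\<close> (\<open>gaussian_pair_chaos_covariance\<close>). On compact sets
  \<open>K\<^sub>\<epsilon>(x, y) \<le> C - ln (max |x - y| \<epsilon>)\<close> uniformly in \<open>\<epsilon>\<close> (\<open>mollified_covariance_le\<close>), so for a function \<open>\<psi>\<close>
  with support in a fixed compact set the second moment of \<open>\<integral> \<psi> E\<^sub>\<epsilon>\<close> is at most a constant times
  \<open>sup |\<psi>|\<^sup>2\<close> times the integral of \<open>max |w| \<epsilon>\<close> to the power \<open>- |\<gamma>|\<^sup>2\<close> over a ball (\<open>chaos_second_moment\<close>). That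
  integral is of order \<open>\<epsilon>\<close> to the power \<open>d - |\<gamma>|\<^sup>2\<close>, or \<open>log (1 / \<epsilon>)\<close> when \<open>|\<gamma>|\<^sup>2 = d\<close>, which is exactly what
  the square of the normalization compensates (\<open>normalized_energy_bound\<close>).

  Take \<open>\<psi>(x) = v \<rho>(x) e\<^sup>i\<^sup>\<xi>\<^sup>x\<close> and the differences of two such functions. The Fourier transform
  \<open>g\<^sub>\<epsilon>(\<xi>)\<close> of \<open>v M\<^sub>\<epsilon>(\<rho> \<cdot>)\<close> is then bounded in mean square, and Lipschitz in mean square because \<open>\<rho>\<close> has
  compact support, both uniformly in \<open>\<epsilon>\<close>. For \<open>u > d / 2\<close> the norm of \<open>H\<^sup>-\<^sup>u\<close> is the \<open>L\<^sup>2\<close> norm of the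
  transform against the finite measure with density \<open>1 + |\<xi>|\<^sup>2\<close> to the power \<open>- u\<close>. Sampling \<open>g\<^sub>\<epsilon>\<close> on a fine
  grid in a large ball and rounding the samples therefore changes it little in this norm, and with high
  probability produces one of finitely many step functions. In a complete metric space such
  finite nets give tightness (\<open>tight_familyI\<close>, \<open>tight_family_sobolev\<close>). Measurability follows as well, because
  the step functions with rounded values are countably many and all samples lie in their closure.

  The rest is the analysis that makes these sentences precise: Fourier inversion for test functions
  and uniqueness of Fourier transforms of distributions, through Gaussian summation; the Sobolev space
  as a complete metric space; Gaussian exponential moments with complex exponents, by analytic
  continuation.\<close>

section \<open>Tightness in complete metric spaces\<close>

text \<open>Closed, as an intersection of finite unions of closed balls, and totally bounded, since the radii
  tend to \<open>0\<close>; completeness turns this into compactness.\<close>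

lemma (in Metric_space) compactin_Inter_finite_Union_mcball:
  assumes "mcomplete" and fin: "\<And>n. finite (F n)" and r: "r \<longlonglongrightarrow> 0"
  shows "compactin mtopology (\<Inter>n::nat. \<Union>q\<in>F n. mcball q (r n))"
proof -
  let ?S = "\<Inter>n. \<Union>q\<in>F n. mcball q (r n)"
  have S: "?S \<subseteq> M"
    by (force simp: mcball_def)
  have clo: "closedin mtopology ?S"
    using fin by (intro closedin_Inter) (auto intro!: closedin_Union closedin_mcball)
  have "\<exists>K. finite K \<and> K \<subseteq> ?S \<and> ?S \<subseteq> (\<Union>x\<in>K. mball x e)" if e: "e > 0" for e
  proof -
    obtain n where n: "r n < e / 2"
      using order_tendstoD(2)[OF r, of "e/2"] e by (auto simp: eventually_sequentially)
    \<comment> \<open>The centres of a net must lie in the set itself, so each ball that meets it is recentred at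
      one of its points, which doubles the radius.\<close>
    define c where "c q = (SOME x. x \<in> ?S \<and> x \<in> mcball q (r n))" for q
    let ?K = "c ` {q \<in> F n. \<exists>x. x \<in> ?S \<and> x \<in> mcball q (r n)}"
    have c: "c q \<in> ?S \<and> c q \<in> mcball q (r n)" if "\<exists>x. x \<in> ?S \<and> x \<in> mcball q (r n)" for q
      using someI_ex[OF that] unfolding c_def .
    have "?S \<subseteq> (\<Union>x\<in>?K. mball x e)"
    proof
      fix x assume x: "x \<in> ?S"
      then obtain q where q: "q \<in> F n" "x \<in> mcball q (r n)" by blast
      with x have cq: "c q \<in> mcball q (r n)" "c q \<in> ?K" using c[of q] by blast+
      have "d (c q) x \<le> d (c q) q + d q x"
        using q cq by (intro triangle) (auto simp: mcball_def)
      also have "\<dots> < e" using q cq n by (auto simp: mcball_def commute[of "c q" q])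
      finally have "x \<in> mball (c q) e" using q cq by (auto simp: mcball_def mball_def)
      with cq show "x \<in> (\<Union>x\<in>?K. mball x e)" by blast
    qed
    moreover have "?K \<subseteq> ?S" using c by blast
    ultimately show ?thesis using fin by (intro exI[of _ ?K]) auto
  qed
  then have "mtotally_bounded ?S"
    unfolding mtotally_bounded_def by blast
  then have "compactin mtopology (mtopology closure_of ?S)"
    using mtotally_bounded_eq_compact_closure_of[OF assms(1)] by blast
  then show ?thesis
    using clo by (simp add: closure_of_closedin)
qed

text \<open>The balls with centres in a countable set suffice to describe the traces of open sets on the
  closure of that set. Only the range of the random element has to lie in this closure; the whole
  space need not be separable.\<close>

lemma (in Metric_space) measurable_borel_algebra_of_mtopology:
  assumes Q: "countable Q" "Q \<subseteq> M"
    and Z: "\<And>\<omega>. \<omega> \<in> space P \<Longrightarrow> Z \<omega> \<in> M"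
    and meas: "\<And>q. q \<in> Q \<Longrightarrow> (\<lambda>\<omega>. d q (Z \<omega>)) \<in> borel_measurable P"
    and dense: "\<And>\<omega> r. \<omega> \<in> space P \<Longrightarrow> r > 0 \<Longrightarrow> \<exists>q\<in>Q. d q (Z \<omega>) < r"
  shows "Z \<in> measurable P (borel_algebra_of mtopology)"
  unfolding borel_algebra_of_def
proof (rule measurable_measure_of)
  show "{U. openin mtopology U} \<subseteq> Pow (topspace mtopology)"
    using openin_subset by blast
  show "Z \<in> space P \<rightarrow> topspace mtopology" using Z by auto
  fix U assume "U \<in> {U. openin mtopology U}"
  then have U: "U \<subseteq> M" "\<And>x. x \<in> U \<Longrightarrow> \<exists>r>0. mball x r \<subseteq> U"
    by (auto simp: openin_mtopology)
  define J where "J = {(q, k). q \<in> Q \<and> mball q (1 / real (Suc k)) \<subseteq> U}"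
  have "countable J"
    by (rule countable_subset[of _ "Q \<times> UNIV"]) (use Q in \<open>auto simp: J_def\<close>)
  have eq: "Z -` U \<inter> space P = (\<Union>(q, k)\<in>J. {\<omega> \<in> space P. d q (Z \<omega>) < 1 / real (Suc k)})"
  proof (intro set_eqI iffI)
    fix \<omega> assume "\<omega> \<in> Z -` U \<inter> space P"
    then have \<omega>: "\<omega> \<in> space P" "Z \<omega> \<in> U" by auto
    then obtain r where r: "r > 0" "mball (Z \<omega>) r \<subseteq> U" using U by blast
    obtain k where k: "1 / real (Suc k) < r / 2"
      using nat_approx_posE[of "r/2"] r by (metis half_gt_zero of_nat_Suc)
    obtain q where q: "q \<in> Q" "d q (Z \<omega>) < 1 / real (Suc k)"
      using dense[OF \<omega>(1), of "1 / real (Suc k)"] by auto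
    have "mball q (1 / real (Suc k)) \<subseteq> mball (Z \<omega>) r"
    proof
      fix y assume y: "y \<in> mball q (1 / real (Suc k))"
      have "d (Z \<omega>) y \<le> d (Z \<omega>) q + d q y"
        using y Z[OF \<omega>(1)] by (intro triangle) (auto simp: mball_def)
      also have "\<dots> < r" using y q k commute[of q "Z \<omega>"] by (auto simp: mball_def)
      finally show "y \<in> mball (Z \<omega>) r" using y Z[OF \<omega>(1)] by (auto simp: mball_def)
    qed
    with r q \<omega> have "(q, k) \<in> J" by (auto simp: J_def)
    then show "\<omega> \<in> (\<Union>(q, k)\<in>J. {\<omega> \<in> space P. d q (Z \<omega>) < 1 / real (Suc k)})"
      using q \<omega> by blast
  next
    fix \<omega> assume "\<omega> \<in> (\<Union>(q, k)\<in>J. {\<omega> \<in> space P. d q (Z \<omega>) < 1 / real (Suc k)})"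
    then obtain q k where "(q, k) \<in> J" "\<omega> \<in> space P" "d q (Z \<omega>) < 1 / real (Suc k)" by auto
    then show "\<omega> \<in> Z -` U \<inter> space P"
      using Z[of \<omega>] Q by (auto simp: J_def mball_def)
  qed
  show "Z -` U \<inter> space P \<in> sets P"
    unfolding eq
  proof (rule sets.countable_UN'[OF \<open>countable J\<close>], clarsimp)
    fix q k assume "(q, k) \<in> J"
    then have [measurable]: "(\<lambda>\<omega>. d q (Z \<omega>)) \<in> borel_measurable P" using meas by (auto simp: J_def)
    show "{\<omega> \<in> space P. d q (Z \<omega>) < 1 / (1 + real k)} \<in> sets P" by measurable
  qed
qed

text \<open>The compact set consists of the points that for every \<open>n\<close> are within \<open>1 / (n + 1)\<close> of the \<open>n\<close>-th finite
  net; the \<open>n\<close>-th net is chosen to fail with probability at most \<open>\<delta> / 2\<^sup>n\<^sup>+\<^sup>1\<close>.\<close>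

lemma (in Metric_space) tight_familyI:
  assumes P: "prob_space P" and "mcomplete"
    and Q: "countable Q" "Q \<subseteq> M"
    and Z: "\<And>i \<omega>. i \<in> I \<Longrightarrow> \<omega> \<in> space P \<Longrightarrow> Z i \<omega> \<in> M"
    and meas: "\<And>i q. i \<in> I \<Longrightarrow> q \<in> Q \<Longrightarrow> (\<lambda>\<omega>. d q (Z i \<omega>)) \<in> borel_measurable P"
    and dense: "\<And>i \<omega> r. i \<in> I \<Longrightarrow> \<omega> \<in> space P \<Longrightarrow> r > 0 \<Longrightarrow> \<exists>q\<in>Q. d q (Z i \<omega>) < r"
    and nets: "\<And>r \<eta>. r > 0 \<Longrightarrow> \<eta> > 0 \<Longrightarrow> \<exists>F\<subseteq>Q. finite F \<and>
      (\<forall>i\<in>I. measure P {\<omega>\<in>space P. \<forall>q\<in>F. r < d q (Z i \<omega>)} \<le> \<eta>)"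
  shows "tight_family P mtopology I Z"
  unfolding tight_family_def
proof (intro conjI ballI allI impI)
  interpret prob_space P by fact
  show "Z i \<in> measurable P (borel_algebra_of mtopology)" if "i \<in> I" for i
    using that by (intro measurable_borel_algebra_of_mtopology[OF Q] Z meas dense)
  fix \<delta> :: real assume \<delta>: "\<delta> > 0"
  define r where "r n = 1 / real (Suc n)" for n
  define \<eta> where "\<eta> n = \<delta> * (1/2) ^ Suc n" for n
  have "\<forall>n. \<exists>F\<subseteq>Q. finite F \<and> (\<forall>i\<in>I. measure P {\<omega>\<in>space P. \<forall>q\<in>F. r n < d q (Z i \<omega>)} \<le> \<eta> n)"
    using \<delta> by (intro allI nets) (auto simp: r_def \<eta>_def)
  from choice[OF this] obtain F where F: "\<And>n. F n \<subseteq> Q" "\<And>n. finite (F n)"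
    "\<And>n i. i \<in> I \<Longrightarrow> measure P {\<omega>\<in>space P. \<forall>q\<in>F n. r n < d q (Z i \<omega>)} \<le> \<eta> n"
    by blast
  define C where "C = (\<Inter>n::nat. \<Union>q\<in>F n. mcball q (r n))"
  have "r \<longlonglongrightarrow> 0" unfolding r_def using LIMSEQ_inverse_real_of_nat by (simp add: field_simps)
  then have "compactin mtopology C"
    unfolding C_def using F by (intro compactin_Inter_finite_Union_mcball assms)
  moreover have "1 - \<delta> \<le> measure P {\<omega> \<in> space P. Z i \<omega> \<in> C}" if i: "i \<in> I" for i
  proof -
    let ?B = "\<lambda>n. {\<omega>\<in>space P. \<forall>q\<in>F n. r n < d q (Z i \<omega>)}"
    have B[measurable]: "?B n \<in> sets P" for n
    proof -
      have "(\<lambda>\<omega>. d q (Z i \<omega>)) \<in> borel_measurable P" if "q \<in> F n" for q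
        using that F i meas by blast
      then show ?thesis
        by (intro sets.sets_Collect_finite_All F borel_measurable_less) auto
    qed
    have eq: "{\<omega> \<in> space P. Z i \<omega> \<in> C} = space P - (\<Union>n. ?B n)"
    proof (intro set_eqI iffI)
      fix \<omega> assume "\<omega> \<in> {\<omega> \<in> space P. Z i \<omega> \<in> C}"
      then have \<omega>: "\<omega> \<in> space P" "\<And>n. \<exists>q\<in>F n. Z i \<omega> \<in> mcball q (r n)" by (auto simp: C_def)
      then show "\<omega> \<in> space P - (\<Union>n. ?B n)"
        by (force simp: mcball_def)
    next
      fix \<omega> assume "\<omega> \<in> space P - (\<Union>n. ?B n)"
      then have \<omega>: "\<omega> \<in> space P" "\<And>n. \<exists>q\<in>F n. d q (Z i \<omega>) \<le> r n" by (auto simp: not_less)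
      then show "\<omega> \<in> {\<omega> \<in> space P. Z i \<omega> \<in> C}"
        using Z[OF i \<omega>(1)] F(1) Q(2) by (fastforce simp: C_def mcball_def)
    qed
    have sums: "\<eta> sums \<delta>"
      unfolding \<eta>_def using sums_mult[OF power_half_series, of \<delta>] by simp
    define m where "m n = measure P (?B n)" for n
    have m: "0 \<le> m n" "m n \<le> \<eta> n" for n
      using F(3)[OF i, of n] by (simp_all add: m_def)
    have "summable m"
      by (rule summable_comparison_test'[of \<eta> 0]) (use m sums in \<open>auto simp: sums_iff\<close>)
    have "measure P (\<Union>n. ?B n) \<le> (\<Sum>n. m n)"
      unfolding m_def
      by (rule finite_measure_subadditive_countably)
        (use B \<open>summable m\<close>[unfolded m_def] in auto)
    also have "\<dots> \<le> (\<Sum>n. \<eta> n)"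
      by (rule suminf_le) (use m \<open>summable m\<close> sums in \<open>auto simp: sums_iff\<close>)
    also have "\<dots> = \<delta>" using sums by (simp add: sums_iff)
    finally show ?thesis
      unfolding eq using B by (subst prob_compl) auto
  qed
  ultimately show "\<exists>C. compactin mtopology C \<and> (\<forall>i\<in>I. 1 - \<delta> \<le> measure P {\<omega> \<in> space P. Z i \<omega> \<in> C})"
    by blast
qed

section \<open>Test functions\<close>

lemma C_k_imp_continuous: "C_k k f \<Longrightarrow> continuous_on UNIV f"
  by (cases k) (auto intro!: differentiable_imp_continuous_on simp: differentiable_on_def
      intro: differentiable_at_withinI)

lemma C_k_affine:
  fixes f :: "'b::euclidean_space \<Rightarrow> real"
  shows "C_k k f \<Longrightarrow> C_k k (\<lambda>x. f (a + c *\<^sub>R x))"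
proof (induction k arbitrary: f)
  case 0
  then show ?case
    by (auto intro!: continuous_intros continuous_on_compose2[of UNIV f])
next
  case (Suc k)
  have der: "((\<lambda>x. f (a + c *\<^sub>R x)) has_derivative
      (\<lambda>v. frechet_derivative f (at (a + c *\<^sub>R x)) (c *\<^sub>R v))) (at x)" for x
  proof (rule has_derivative_compose[of "\<lambda>x. a + c *\<^sub>R x" "\<lambda>v. c *\<^sub>R v" x UNIV f, simplified])
    show "((\<lambda>x. a + c *\<^sub>R x) has_derivative (*\<^sub>R) c) (at x)"
      by (auto intro!: derivative_eq_intros)
    show "(f has_derivative frechet_derivative f (at (a + c *\<^sub>R x))) (at (a + c *\<^sub>R x))"
      using Suc.prems by (simp add: frechet_derivative_works)
  qed
  have "frechet_derivative (\<lambda>x. f (a + c *\<^sub>R x)) (at x) v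
      = frechet_derivative f (at (a + c *\<^sub>R x)) (c *\<^sub>R v)" for x v
    by (simp add: frechet_derivative_at[OF der, symmetric])
  moreover have "C_k k (\<lambda>x. frechet_derivative f (at (a + c *\<^sub>R x)) (c *\<^sub>R v))" for v
    using Suc.IH[of "\<lambda>y. frechet_derivative f (at y) (c *\<^sub>R v)"] Suc.prems by simp
  ultimately show ?case
    using differentiableI[OF der] by simp
qed

lemma C_k_add: "C_k k f \<Longrightarrow> C_k k g \<Longrightarrow> C_k k (\<lambda>x. f x + g x)"
proof (induction k arbitrary: f g)
  case (Suc k)
  have der: "((\<lambda>x. f x + g x) has_derivative
      (\<lambda>v. frechet_derivative f (at x) v + frechet_derivative g (at x) v)) (at x)" for x
    using Suc.prems by (intro has_derivative_add) (auto simp: frechet_derivative_works[symmetric])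
  have "frechet_derivative (\<lambda>x. f x + g x) (at x) v
      = frechet_derivative f (at x) v + frechet_derivative g (at x) v" for x v
    by (simp add: frechet_derivative_at[OF der, symmetric])
  then show ?case
    using Suc differentiableI[OF der] by simp
qed (auto intro!: continuous_intros)

lemma C_k_cmult: "C_k k f \<Longrightarrow> C_k k (\<lambda>x. c * f x)"
proof (induction k arbitrary: f)
  case (Suc k)
  have der: "((\<lambda>x. c * f x) has_derivative (\<lambda>v. c * frechet_derivative f (at x) v)) (at x)" for x
    using Suc.prems by (intro has_derivative_mult_right) (auto simp: frechet_derivative_works[symmetric])
  have "frechet_derivative (\<lambda>x. c * f x) (at x) v = c * frechet_derivative f (at x) v" for x v
    by (simp add: frechet_derivative_at[OF der, symmetric])
  then show ?case
    using Suc differentiableI[OF der] by simp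
qed (auto intro!: continuous_intros)

lemma C_k_const: "C_k k (\<lambda>_. c)"
  by (induction k arbitrary: c) auto

lemma continuous_compact_support_integrable:
  fixes f :: "'b::euclidean_space \<Rightarrow> real"
  assumes "continuous_on UNIV f" "compact (tsupport f)"
  shows "integrable lborel f" "bounded (range f)"
proof -
  have z: "f x = 0" if "x \<notin> tsupport f" for x
    using that closure_subset[of "{x. f x \<noteq> 0}"] by (auto simp: tsupport_def)
  have eq: "f = (\<lambda>x. indicator (tsupport f) x *\<^sub>R f x)"
    using z by (force simp: indicator_def)
  show "integrable lborel f"
    by (subst eq) (intro borel_integrable_compact assms continuous_on_subset[OF assms(1)], auto)
  have "range f \<subseteq> insert 0 (f ` tsupport f)" using z by auto
  moreover have "bounded (f ` tsupport f)"
    by (intro compact_imp_bounded compact_continuous_image assms continuous_on_subset[OF assms(1)]) auto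
  ultimately show "bounded (range f)" by (meson bounded_insert bounded_subset)
qed

lemma test_functionD:
  assumes "f \<in> test_functions U"
  shows "smooth f" "continuous_on UNIV f" "compact (tsupport f)" "integrable lborel f"
    "bounded (range f)" "f \<in> borel_measurable borel"
proof -
  show *: "smooth f" "compact (tsupport f)" using assms by (auto simp: test_functions_def)
  then show c: "continuous_on UNIV f" using C_k_imp_continuous by (auto simp: smooth_def)
  show "integrable lborel f" "bounded (range f)"
    using continuous_compact_support_integrable[OF c *(2)] .
  show "f \<in> borel_measurable borel" using c by (rule borel_measurable_continuous_onI)
qed

lemma test_functionI:
  assumes "smooth f" "{x. f x \<noteq> 0} \<subseteq> S" "compact S"
  shows "f \<in> test_functions UNIV"
proof -
  have "tsupport f \<subseteq> S"
    unfolding tsupport_def using assms by (intro closure_minimal compact_imp_closed)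
  then have "compact (tsupport f)"
    using assms(3) by (metis closed_closure compact_Int_closed inf.absorb_iff2 tsupport_def)
  with assms show ?thesis by (auto simp: test_functions_def)
qed

lemma zero_off_tsupport: "x \<notin> tsupport f \<Longrightarrow> f x = 0"
  using closure_subset[of "{x. f x \<noteq> 0}"] by (auto simp: tsupport_def)

lemma test_function_frechet_derivative:
  assumes f: "f \<in> test_functions UNIV"
  shows "(\<lambda>x. frechet_derivative f (at x) v) \<in> test_functions UNIV"
proof (rule test_functionI)
  show "smooth (\<lambda>x. frechet_derivative f (at x) v)"
    unfolding smooth_def
  proof
    fix k
    have "C_k (Suc k) f" using test_functionD(1)[OF f] by (simp only: smooth_def)
    then show "C_k k (\<lambda>x. frechet_derivative f (at x) v)" by simp
  qed
  show "compact (tsupport f)" using f by (rule test_functionD)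
  show "{x. frechet_derivative f (at x) v \<noteq> 0} \<subseteq> tsupport f"
  proof (rule ccontr)
    assume "\<not> ?thesis"
    then obtain x where x: "x \<notin> tsupport f" "frechet_derivative f (at x) v \<noteq> 0" by auto
    have "(f has_derivative (\<lambda>_. 0)) (at x)"
    proof (rule has_derivative_transform_within_open[of "\<lambda>_. 0"])
      show "open (- tsupport f)" unfolding tsupport_def by (intro open_Compl closed_closure)
    qed (use x zero_off_tsupport[of _ f] in auto)
    from frechet_derivative_at[OF this] have "frechet_derivative f (at x) v = 0" by metis
    with x show False by simp
  qed
qed

lemma test_function_add:
  assumes f: "f \<in> test_functions UNIV" and g: "g \<in> test_functions UNIV"
  shows "(\<lambda>x. f x + g x) \<in> test_functions UNIV"
proof (rule test_functionI)
  show "smooth (\<lambda>x. f x + g x)"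
    using test_functionD(1)[OF f] test_functionD(1)[OF g] by (simp add: smooth_def C_k_add)
  show "{x. f x + g x \<noteq> 0} \<subseteq> tsupport f \<union> tsupport g"
    using zero_off_tsupport[of _ f] zero_off_tsupport[of _ g] by force
  show "compact (tsupport f \<union> tsupport g)"
    using test_functionD(3)[OF f] test_functionD(3)[OF g] by (rule compact_Un)
qed

lemma test_function_cmult:
  assumes f: "f \<in> test_functions UNIV"
  shows "(\<lambda>x. c * f x) \<in> test_functions UNIV"
proof (rule test_functionI)
  show "smooth (\<lambda>x. c * f x)"
    using test_functionD(1)[OF f] by (simp add: smooth_def C_k_cmult)
  show "{x. c * f x \<noteq> 0} \<subseteq> tsupport f"
    using zero_off_tsupport[of _ f] by auto
  show "compact (tsupport f)" using f by (rule test_functionD)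
qed

lemma test_function_affine:
  fixes f :: "'b::euclidean_space \<Rightarrow> real"
  assumes f: "f \<in> test_functions UNIV" and c: "c \<noteq> 0"
  shows "(\<lambda>x. f (a + c *\<^sub>R x)) \<in> test_functions UNIV"
proof (rule test_functionI)
  show "smooth (\<lambda>x. f (a + c *\<^sub>R x))"
    using test_functionD(1)[OF f] by (simp add: smooth_def C_k_affine)
  show "{x. f (a + c *\<^sub>R x) \<noteq> 0} \<subseteq> (\<lambda>y. (1/c) *\<^sub>R (y - a)) ` tsupport f"
  proof
    fix x assume "x \<in> {x. f (a + c *\<^sub>R x) \<noteq> 0}"
    then have "a + c *\<^sub>R x \<in> tsupport f" using zero_off_tsupport by auto
    moreover have "x = (1/c) *\<^sub>R ((a + c *\<^sub>R x) - a)" using c by simp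
    ultimately show "x \<in> (\<lambda>y. (1/c) *\<^sub>R (y - a)) ` tsupport f" by blast
  qed
  show "compact ((\<lambda>y. (1/c) *\<^sub>R (y - a)) ` tsupport f)"
    using test_functionD(3)[OF f] by (intro compact_continuous_image continuous_intros)
qed

lemma test_function_zero: "(\<lambda>_. 0) \<in> test_functions UNIV"
  by (rule test_functionI[of _ "{}"]) (auto simp: smooth_def C_k_const)

lemma test_function_sum:
  "(\<And>i. i \<in> I \<Longrightarrow> f i \<in> test_functions UNIV) \<Longrightarrow> (\<lambda>x. \<Sum>i\<in>I. f i x) \<in> test_functions UNIV"
  by (induction I rule: infinite_finite_induct) (auto intro: test_function_add test_function_zero)

section \<open>Fourier transforms of integrable functions\<close>

lemma integrable_fourier_integrand:
  fixes \<phi> :: "'b::euclidean_space \<Rightarrow> complex"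
  assumes "integrable lborel \<phi>"
  shows "integrable lborel (\<lambda>x. exp (\<i> * of_real (\<xi> \<bullet> x)) * \<phi> x)"
proof (rule Bochner_Integration.integrable_bound[OF assms])
  have [measurable]: "\<phi> \<in> borel_measurable borel"
    using borel_measurable_integrable[OF assms] by simp
  show "(\<lambda>x. exp (\<i> * of_real (\<xi> \<bullet> x)) * \<phi> x) \<in> borel_measurable lborel" by simp
qed (simp add: norm_mult)

lemma norm_fourier_le:
  fixes \<phi> :: "'b::euclidean_space \<Rightarrow> complex"
  shows "norm (fourier \<phi> \<xi>) \<le> (LINT x|lborel. norm (\<phi> x))"
proof -
  have "norm (fourier \<phi> \<xi>) \<le> (LINT x|lborel. norm (exp (\<i> * of_real (\<xi> \<bullet> x)) * \<phi> x))"
    unfolding fourier_def by (rule integral_norm_bound)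
  then show ?thesis by (simp add: norm_mult)
qed

lemma measurable_fourier[measurable]:
  fixes \<phi> :: "'b::euclidean_space \<Rightarrow> complex"
  assumes [measurable]: "\<phi> \<in> borel_measurable borel"
  shows "fourier \<phi> \<in> borel_measurable borel"
  unfolding fourier_def[abs_def] by measurable

lemma fourier_translate:
  fixes \<phi> :: "'b::euclidean_space \<Rightarrow> complex"
  assumes [measurable]: "\<phi> \<in> borel_measurable borel"
  shows "fourier (\<lambda>x. \<phi> (a + x)) \<xi> = exp (- \<i> * of_real (\<xi> \<bullet> a)) * fourier \<phi> \<xi>"
proof -
  have "fourier \<phi> \<xi> = (LINT x|distr lborel borel ((+) a). exp (\<i> * of_real (\<xi> \<bullet> x)) * \<phi> x)"
    unfolding fourier_def lborel_distr_plus ..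
  also have "\<dots> = (LINT x|lborel. exp (\<i> * of_real (\<xi> \<bullet> (a + x))) * \<phi> (a + x))"
    by (subst integral_distr) auto
  also have "\<dots> = (LINT x|lborel. exp (\<i> * of_real (\<xi> \<bullet> a)) * (exp (\<i> * of_real (\<xi> \<bullet> x)) * \<phi> (a + x)))"
    by (simp add: inner_add_right exp_add algebra_simps)
  also have "\<dots> = exp (\<i> * of_real (\<xi> \<bullet> a)) * fourier (\<lambda>x. \<phi> (a + x)) \<xi>"
    by (simp add: fourier_def)
  finally show ?thesis by (simp add: exp_minus field_simps)
qed

abbreviation test_fourier :: "('b::euclidean_space \<Rightarrow> real) \<Rightarrow> 'b \<Rightarrow> complex" where
  "test_fourier f \<equiv> fourier (\<lambda>x. of_real (f x))"

lemma fourier_test_add: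
  fixes f g :: "'b::euclidean_space \<Rightarrow> real"
  assumes "integrable lborel f" "integrable lborel g"
  shows "fourier (\<lambda>x. of_real (f x + g x)) \<xi> = test_fourier f \<xi> + test_fourier g \<xi>"
  using assms unfolding fourier_def
  by (simp add: distrib_left integrable_fourier_integrand)

lemma fourier_test_cmult:
  "fourier (\<lambda>x. of_real (c * f x)) \<xi> = of_real c * test_fourier f \<xi>"
  unfolding fourier_def by (simp flip: integral_mult_right_zero) (simp add: algebra_simps)

lemma fourier_test_sum:
  fixes f :: "'i \<Rightarrow> 'b::euclidean_space \<Rightarrow> real"
  assumes "\<And>i. i \<in> I \<Longrightarrow> f i \<in> test_functions UNIV"
  shows "fourier (\<lambda>x. of_real (\<Sum>i\<in>I. f i x)) \<xi> = (\<Sum>i\<in>I. test_fourier (f i) \<xi>)"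
  using assms
proof (induction I rule: infinite_finite_induct)
  case (insert i I)
  then show ?case
    using fourier_test_add[of "f i" "\<lambda>x. \<Sum>i\<in>I. f i x" \<xi>]
      test_functionD(4)[of "f i" UNIV] test_functionD(4)[OF test_function_sum[of I f]]
    by (simp del: of_real_add of_real_sum)
qed (auto simp: fourier_def)

text \<open>Instead of integrating by parts, let \<open>h\<close> tend to \<open>0\<close> in the transform of the difference quotient
  \<open>(f (x + h v) - f x) / h\<close>, which is a multiple of the transform of \<open>f\<close>. The quotients are bounded by
  the supremum of the derivative and supported in a common ball, so dominated convergence applies.\<close>

lemma fourier_frechet_derivative:
  fixes f :: "'b::euclidean_space \<Rightarrow> real"
  assumes f: "f \<in> test_functions UNIV"
  shows "fourier (\<lambda>x. of_real (frechet_derivative f (at x) v)) \<xi>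
    = - \<i> * of_real (\<xi> \<bullet> v) * test_fourier f \<xi>"
proof -
  let ?D = "\<lambda>x. frechet_derivative f (at x) v"
  define h where "h n = 1 / real (Suc n)" for n
  have h: "h n > 0" "h n \<le> 1" "h \<longlonglongrightarrow> 0" for n
    unfolding h_def using LIMSEQ_inverse_real_of_nat by (simp_all add: field_simps)
  have h0: "filterlim h (at 0) sequentially"
    using h by (simp add: filterlim_at less_imp_neq[symmetric])
  note D = test_function_frechet_derivative[OF f, of v]
  obtain B where B: "\<And>x. \<bar>?D x\<bar> \<le> B"
    using test_functionD(5)[OF D] by (auto simp: bounded_iff)
  obtain R where R: "\<And>x. x \<in> tsupport f \<Longrightarrow> norm x \<le> R"
    using test_functionD(3)[OF f] compact_imp_bounded bounded_iff by metis
  have dif: "(f has_derivative frechet_derivative f (at x)) (at x)" for x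
  proof -
    have "C_k (Suc 0) f" using test_functionD(1)[OF f] by (simp only: smooth_def)
    then show ?thesis by (simp add: frechet_derivative_works)
  qed
  have line: "((\<lambda>s. f (x + s *\<^sub>R v)) has_real_derivative ?D (x + s *\<^sub>R v)) (at s)" for x s
  proof -
    have "((\<lambda>s. f (x + s *\<^sub>R v)) has_derivative
        (\<lambda>t. frechet_derivative f (at (x + s *\<^sub>R v)) (t *\<^sub>R v))) (at s)"
      by (rule has_derivative_compose[of "\<lambda>s. x + s *\<^sub>R v" "\<lambda>t. t *\<^sub>R v" s UNIV f "frechet_derivative f (at (x + s *\<^sub>R v))", simplified])
        (auto intro!: derivative_eq_intros dif)
    moreover have "frechet_derivative f (at (x + s *\<^sub>R v)) (t *\<^sub>R v) = t * ?D (x + s *\<^sub>R v)" for t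
      using linear_cmul[OF has_derivative_linear[OF dif]] by simp
    ultimately show ?thesis by (simp add: has_field_derivative_def mult_commute_abs)
  qed
  define q where "q n x = (f (x + h n *\<^sub>R v) - f x) / h n" for n x
  have qlim: "(\<lambda>n. q n x) \<longlonglongrightarrow> ?D x" for x
  proof -
    have "((\<lambda>t. (f (x + t *\<^sub>R v) - f x) / t) \<longlongrightarrow> ?D x) (at 0)"
      using line[of x 0] by (simp add: has_field_derivative_iff)
    from filterlim_compose[OF this h0] show ?thesis by (simp add: q_def)
  qed
  have qB: "\<bar>q n x\<bar> \<le> B * indicator (cball 0 (R + norm v)) x" for n x
  proof (cases "x \<in> cball 0 (R + norm v)")
    case True
    obtain s where s: "f (x + h n *\<^sub>R v) - f (x + 0 *\<^sub>R v) = (h n - 0) * ?D (x + s *\<^sub>R v)"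
      using MVT2[OF h(1)[of n], of "\<lambda>s. f (x + s *\<^sub>R v)" "\<lambda>s. ?D (x + s *\<^sub>R v)"] line by blast
    then have "q n x = ?D (x + s *\<^sub>R v)" using h(1)[of n] by (simp add: q_def)
    with B True show ?thesis by simp
  next
    case False
    have "x \<notin> tsupport f" using R[of x] False by (smt (verit) mem_cball_0 norm_ge_zero)
    moreover have "x + h n *\<^sub>R v \<notin> tsupport f"
    proof
      assume "x + h n *\<^sub>R v \<in> tsupport f"
      then have "norm (x + h n *\<^sub>R v) \<le> R" by (rule R)
      moreover have "norm x \<le> norm (x + h n *\<^sub>R v) + norm (h n *\<^sub>R v)"
        by (metis add_diff_cancel_right' norm_triangle_ineq4)
      moreover have "norm (h n *\<^sub>R v) \<le> 1 * norm v"
        using h(1)[of n] h(2)[of n] by (simp only: norm_scaleR) (intro mult_right_mono, auto)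
      ultimately show False using False by auto
    qed
    ultimately show ?thesis using False by (simp add: q_def zero_off_tsupport)
  qed
  have [measurable]: "f \<in> borel_measurable borel" "?D \<in> borel_measurable borel"
    using test_functionD(6)[OF f] test_functionD(6)[OF D] .
  have int: "integrable lborel (\<lambda>x. B * indicator (cball (0::'b) (R + norm v)) x :: real)" for R
    by (intro integrable_mult_right integrable_real_indicator)
      (use emeasure_lborel_cball_finite[of "0::'b"] in auto)
  have "(\<lambda>n. test_fourier (q n) \<xi>) \<longlonglongrightarrow> fourier (\<lambda>x. of_real (?D x)) \<xi>"
    unfolding fourier_def
  proof (rule integral_dominated_convergence[OF _ _ int[of R]])
    show "AE x in lborel. (\<lambda>n. exp (\<i> * of_real (\<xi> \<bullet> x)) * complex_of_real (q n x))
        \<longlonglongrightarrow> exp (\<i> * of_real (\<xi> \<bullet> x)) * of_real (?D x)"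
      by (intro AE_I2 tendsto_intros qlim)
    show "AE x in lborel. norm (exp (\<i> * of_real (\<xi> \<bullet> x)) * complex_of_real (q n x))
        \<le> B * indicator (cball 0 (R + norm v)) x" for n
      using qB by (intro AE_I2) (simp add: norm_mult)
  qed (auto simp: q_def)
  moreover have "test_fourier (q n) \<xi> =
      (exp (- \<i> * of_real (\<xi> \<bullet> v) * of_real (h n)) - 1) / of_real (h n) * test_fourier f \<xi>" for n
  proof -
    have f': "(\<lambda>x. f (x + h n *\<^sub>R v)) \<in> test_functions UNIV"
      using test_function_affine[OF f, of 1 "h n *\<^sub>R v"] by (simp add: add.commute)
    have "test_fourier (q n) \<xi> =
      fourier (\<lambda>x. of_real ((1 / h n) * f (x + h n *\<^sub>R v) + (- 1 / h n) * f x)) \<xi>"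
      by (simp add: q_def diff_divide_distrib)
    also have "\<dots> = of_real (1 / h n) * fourier (\<lambda>x. of_real (f (x + h n *\<^sub>R v))) \<xi>
        + of_real (- 1 / h n) * test_fourier f \<xi>"
      using test_functionD(4)[OF f] test_functionD(4)[OF f']
      by (subst fourier_test_add) (auto simp only: fourier_test_cmult integrable_mult_right)
    also have "fourier (\<lambda>x. complex_of_real (f (x + h n *\<^sub>R v))) \<xi>
        = exp (- \<i> * of_real (\<xi> \<bullet> (h n *\<^sub>R v))) * test_fourier f \<xi>"
      using fourier_translate[of "\<lambda>x. complex_of_real (f x)" "h n *\<^sub>R v" \<xi>] by (simp add: add.commute)
    finally show ?thesis using h(1)[of n] by (simp add: field_simps)
  qed
  moreover have "(\<lambda>n. (exp (- \<i> * of_real (\<xi> \<bullet> v) * of_real (h n)) - 1) / of_real (h n)) \<longlonglongrightarrow> - \<i> * of_real (\<xi> \<bullet> v)"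
  proof -
    have "((\<lambda>t. exp (- \<i> * of_real (\<xi> \<bullet> v) * t)) has_field_derivative - \<i> * of_real (\<xi> \<bullet> v)) (at 0)"
      by (auto intro!: derivative_eq_intros)
    then have "((\<lambda>t. (exp (- \<i> * of_real (\<xi> \<bullet> v) * t) - 1) / t) \<longlongrightarrow> - \<i> * of_real (\<xi> \<bullet> v)) (at (0::complex))"
      by (simp add: has_field_derivative_iff)
    moreover have "filterlim (\<lambda>n. complex_of_real (h n)) (at 0) sequentially"
      using h by (auto simp: filterlim_at less_imp_neq[symmetric] intro!: tendsto_eq_intros eventuallyI)
    ultimately show ?thesis by (rule filterlim_compose)
  qed
  ultimately have "(\<lambda>n. test_fourier (q n) \<xi>) \<longlonglongrightarrow> - \<i> * of_real (\<xi> \<bullet> v) * test_fourier f \<xi>"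
    by (simp only:) (intro tendsto_intros)
  then show ?thesis
    using LIMSEQ_unique \<open>(\<lambda>n. test_fourier (q n) \<xi>) \<longlonglongrightarrow> fourier (\<lambda>x. of_real (?D x)) \<xi>\<close> by blast
qed

text \<open>The function \<open>g\<close> is \<open>f\<close> minus its Laplacian.\<close>

lemma one_plus_norm_square_fourier:
  fixes f :: "'b::euclidean_space \<Rightarrow> real"
  assumes f: "f \<in> test_functions UNIV"
  shows "\<exists>g\<in>test_functions UNIV. \<forall>\<xi>. test_fourier g \<xi>
    = of_real (1 + (norm \<xi>)\<^sup>2) * test_fourier f \<xi>"
proof -
  define D2 where "D2 b = (\<lambda>x. frechet_derivative (\<lambda>y. frechet_derivative f (at y) b) (at x) b)" for b
  have D1: "(\<lambda>y. frechet_derivative f (at y) b) \<in> test_functions UNIV" for b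
    using f by (rule test_function_frechet_derivative)
  have D2: "D2 b \<in> test_functions UNIV" for b
    unfolding D2_def by (intro test_function_frechet_derivative f)
  have FD2: "test_fourier (D2 b) \<xi> = - of_real ((\<xi> \<bullet> b)\<^sup>2) * test_fourier f \<xi>" for b \<xi>
    unfolding D2_def fourier_frechet_derivative[OF D1] fourier_frechet_derivative[OF f]
    by (simp add: power2_eq_square algebra_simps)
  define S where "S = (\<lambda>x. \<Sum>b\<in>Basis. D2 b x)"
  have S: "S \<in> test_functions UNIV" unfolding S_def by (intro test_function_sum D2)
  have FS: "test_fourier S \<xi> = - of_real ((norm \<xi>)\<^sup>2) * test_fourier f \<xi>" for \<xi>
  proof -
    have "test_fourier S \<xi> = (\<Sum>b\<in>Basis. - of_real ((\<xi> \<bullet> b)\<^sup>2) * test_fourier f \<xi>)"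
      unfolding S_def by (subst fourier_test_sum) (auto simp: FD2 D2)
    also have "\<dots> = - of_real (\<Sum>b\<in>Basis. (\<xi> \<bullet> b)\<^sup>2) * test_fourier f \<xi>"
      by (simp add: sum_distrib_right sum_negf)
    also have "(\<Sum>b\<in>Basis. (\<xi> \<bullet> b)\<^sup>2) = (norm \<xi>)\<^sup>2"
      unfolding power2_norm_eq_inner euclidean_inner[of \<xi> \<xi>] by (simp add: power2_eq_square)
    finally show ?thesis .
  qed
  let ?g = "\<lambda>x. f x + (- 1) * S x"
  have S': "(\<lambda>x. (- 1) * S x) \<in> test_functions UNIV" using S by (rule test_function_cmult)
  have "fourier (\<lambda>x. of_real (?g x)) \<xi> = of_real (1 + (norm \<xi>)\<^sup>2) * test_fourier f \<xi>" for \<xi>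
    unfolding fourier_test_add[OF test_functionD(4)[OF f] test_functionD(4)[OF S']]
    by (simp only: fourier_test_cmult FS) (simp add: algebra_simps)
  then show ?thesis
    using test_function_add[OF f S'] by (intro bexI[of _ ?g]) auto
qed

text \<open>Iterating the preceding lemma makes the weighted transform the transform of an integrable
  function, which is bounded.\<close>

lemma fourier_test_function_decay:
  fixes f :: "'b::euclidean_space \<Rightarrow> real"
  assumes f: "f \<in> test_functions UNIV"
  shows "\<exists>C. \<forall>\<xi>. (1 + (norm \<xi>)\<^sup>2) ^ N * norm (test_fourier f \<xi>) \<le> C"
proof -
  have "\<exists>g\<in>test_functions UNIV. \<forall>\<xi>. test_fourier g \<xi>
    = of_real ((1 + (norm \<xi>)\<^sup>2) ^ N) * test_fourier f \<xi>"
  proof (induction N)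
    case 0 then show ?case using f by auto
  next
    case (Suc N)
    then obtain g where g: "g \<in> test_functions UNIV" "\<And>\<xi>. test_fourier g \<xi>
    = of_real ((1 + (norm \<xi>)\<^sup>2) ^ N) * test_fourier f \<xi>" by blast
    from one_plus_norm_square_fourier[OF g(1)] show ?case by (simp add: g mult.assoc)
  qed
  then obtain g where g: "g \<in> test_functions UNIV" "\<And>\<xi>. test_fourier g \<xi>
    = of_real ((1 + (norm \<xi>)\<^sup>2) ^ N) * test_fourier f \<xi>" by blast
  have "(1 + (norm \<xi>)\<^sup>2) ^ N * norm (test_fourier f \<xi>)
    \<le> (LINT x|lborel. norm (complex_of_real (g x)))" for \<xi> :: 'b
  proof -
    have "(1 + (norm \<xi>)\<^sup>2) ^ N * norm (test_fourier f \<xi>) = norm (test_fourier g \<xi>)"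
      unfolding g by (simp only: norm_mult norm_of_real) simp
    then show ?thesis using norm_fourier_le[of "\<lambda>x. complex_of_real (g x)" \<xi>] by simp
  qed
  then show ?thesis by blast
qed

section \<open>Fourier inversion and uniqueness\<close>

text \<open>The standard Gaussian density. As a product over an orthonormal basis it reduces to dimension one
  by Fubini's theorem.\<close>

definition gauss :: "'b::euclidean_space \<Rightarrow> real" where
  "gauss x = (\<Prod>b\<in>Basis. std_normal_density (x \<bullet> b))"

lemma gauss_nonneg: "0 \<le> gauss x"
  by (simp add: gauss_def prod_nonneg)

lemma gauss_eq:
  "gauss (x::'b::euclidean_space) = (2 * pi) powr (- real DIM('b) / 2) * exp (- (norm x)\<^sup>2 / 2)"
proof -
  have "gauss x = (\<Prod>b\<in>(Basis::'b set). 1 / sqrt (2 * pi)) * (\<Prod>b\<in>Basis. exp (- (x \<bullet> b)\<^sup>2 / 2))"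
    unfolding gauss_def std_normal_density_def by (rule prod.distrib)
  also have "(\<Prod>b\<in>Basis. exp (- (x \<bullet> b)\<^sup>2 / 2)) = exp (\<Sum>b\<in>Basis. - (x \<bullet> b)\<^sup>2 / 2)"
    by (simp add: exp_sum)
  also have "(\<Sum>b\<in>Basis. - (x \<bullet> b)\<^sup>2 / 2) = - (norm x)\<^sup>2 / 2"
    unfolding power2_norm_eq_inner euclidean_inner[of x x]
    by (simp add: power2_eq_square sum_negf flip: sum_divide_distrib)
  also have "(\<Prod>b\<in>(Basis::'b set). 1 / sqrt (2 * pi)) = (2 * pi) powr (- real DIM('b) / 2)"
  proof -
    have "1 / sqrt (2 * pi) = (2 * pi) powr (- 1 / 2)"
      by (simp add: powr_half_sqrt powr_minus_divide)
    then show ?thesis by (simp add: powr_powr flip: powr_realpow)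
  qed
  finally show ?thesis .
qed

lemma measurable_gauss[measurable]: "gauss \<in> borel_measurable borel"
  unfolding gauss_def[abs_def] by measurable

text \<open>Lebesgue measure is the image of a product measure under the expansion in the basis.\<close>

lemma integral_prod_Basis:
  fixes F :: "'b::euclidean_space \<Rightarrow> real \<Rightarrow> complex"
  assumes "\<And>b. b \<in> Basis \<Longrightarrow> integrable lborel (F b)"
  shows "integrable lborel (\<lambda>x::'b. \<Prod>b\<in>Basis. F b (x \<bullet> b))"
    "(LINT x|lborel. (\<Prod>b\<in>Basis. F b ((x::'b) \<bullet> b))) = (\<Prod>b\<in>Basis. (LINT t|lborel. F b t))"
proof -
  interpret product_sigma_finite "\<lambda>_::'b. lborel :: real measure" by standard
  have [measurable]: "F b \<in> borel_measurable borel" if "b \<in> Basis" for b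
    using borel_measurable_integrable[OF assms[OF that]] by simp
  have m: "(\<lambda>x::'b. \<Prod>b\<in>Basis. F b (x \<bullet> b)) \<in> borel_measurable borel"
    by (intro borel_measurable_prod) measurable
  have m2: "(\<lambda>f. \<Sum>b\<in>Basis. f b *\<^sub>R b) \<in> (\<Pi>\<^sub>M b\<in>Basis. lborel :: real measure) \<rightarrow>\<^sub>M (borel :: 'b measure)"
    by measurable
  have e: "(\<Prod>b\<in>Basis. F b ((\<Sum>c\<in>Basis. f c *\<^sub>R c) \<bullet> b)) = (\<Prod>b\<in>Basis. F b (f b))" for f
    by (intro prod.cong) auto
  show "integrable lborel (\<lambda>x::'b. \<Prod>b\<in>Basis. F b (x \<bullet> b))"
    by (subst lborel_eq, subst integrable_distr_eq[OF m2 m]) (simp only: e, intro product_integrable_prod assms, simp)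
  show "(LINT x|lborel. (\<Prod>b\<in>Basis. F b ((x::'b) \<bullet> b))) = (\<Prod>b\<in>Basis. (LINT t|lborel. F b t))"
    by (subst lborel_eq, subst integral_distr[OF m2 m]) (simp only: e, intro product_integral_prod assms, simp)
qed

lemma char_std_normal_density:
  "integrable lborel (\<lambda>t. exp (\<i> * of_real (s * t)) * complex_of_real (std_normal_density t))"
  "(LINT t|lborel. exp (\<i> * of_real (s * t)) * complex_of_real (std_normal_density t)) = of_real (exp (- s\<^sup>2 / 2))"
proof -
  show "integrable lborel (\<lambda>t. exp (\<i> * of_real (s * t)) * complex_of_real (std_normal_density t))"
    using integrable_fourier_integrand[of "\<lambda>t::real. complex_of_real (std_normal_density t)" s]
      integrable_normal_density[of 0 1] by simp
  have "of_real (exp (- s\<^sup>2 / 2)) = char std_normal_distribution s"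
    by (simp add: char_std_normal_distribution)
  also have "\<dots> = (LINT t|lborel. std_normal_density t *\<^sub>R exp (\<i> * of_real (s * t)))"
    unfolding char_def by (subst integral_density) (auto simp: normal_density_nonneg)
  finally show "(LINT t|lborel. exp (\<i> * of_real (s * t)) * complex_of_real (std_normal_density t)) = of_real (exp (- s\<^sup>2 / 2))"
    by (simp add: scaleR_conv_of_real mult.commute)
qed

lemma integrable_gauss: "integrable lborel (gauss :: 'b::euclidean_space \<Rightarrow> real)"
proof -
  have "integrable lborel (\<lambda>x::'b. \<Prod>b\<in>Basis. complex_of_real (std_normal_density (x \<bullet> b)))"
    using integral_prod_Basis(1)[of "\<lambda>b t. complex_of_real (std_normal_density t)"]
      integrable_normal_density[of 0 1] by simp
  then have "integrable lborel (\<lambda>x::'b. complex_of_real (gauss x))"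
    by (simp add: gauss_def)
  then show ?thesis by (rule complex_of_real_integrable_eq[THEN iffD1])
qed

lemma fourier_gauss:
  fixes x :: "'b::euclidean_space"
  shows "fourier (\<lambda>\<xi>. of_real (gauss \<xi>)) x = of_real (exp (- (norm x)\<^sup>2 / 2))"
proof -
  have "fourier (\<lambda>\<xi>. of_real (gauss \<xi>)) x = (LINT \<xi>|lborel. (\<Prod>b\<in>Basis. exp (\<i> * of_real ((x \<bullet> b) * (\<xi> \<bullet> b))) * complex_of_real (std_normal_density (\<xi> \<bullet> b))))"
  proof -
    have "exp (\<i> * of_real (x \<bullet> \<xi>)) = (\<Prod>b\<in>Basis. exp (\<i> * complex_of_real ((x \<bullet> b) * (\<xi> \<bullet> b))))" for \<xi>
      unfolding euclidean_inner[of x \<xi>] of_real_sum sum_distrib_left by (rule exp_sum) simp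
    then show ?thesis unfolding fourier_def gauss_def by (simp only: of_real_prod prod.distrib)
  qed
  also have "\<dots> = (\<Prod>b\<in>(Basis::'b set). of_real (exp (- (x \<bullet> b)\<^sup>2 / 2)))"
    by (subst integral_prod_Basis(2)[of "\<lambda>b t. exp (\<i> * of_real ((x \<bullet> b) * t)) * complex_of_real (std_normal_density t)"])
      (simp_all only: char_std_normal_density)
  also have "\<dots> = of_real (exp (\<Sum>b\<in>Basis. - (x \<bullet> b)\<^sup>2 / 2))"
    by (simp add: exp_sum)
  also have "(\<Sum>b\<in>Basis. - (x \<bullet> b)\<^sup>2 / 2) = - (norm x)\<^sup>2 / 2"
    unfolding power2_norm_eq_inner euclidean_inner[of x x]
    by (simp add: power2_eq_square sum_negf flip: sum_divide_distrib)
  finally show ?thesis .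
qed

lemma integral_gauss: "(LINT x|lborel. gauss (x::'b::euclidean_space)) = 1"
proof -
  have "complex_of_real (LINT x|lborel. gauss (x::'b)) = of_real 1"
    using fourier_gauss[of "0::'b"] by (simp add: fourier_def)
  then show ?thesis by (simp only: of_real_eq_iff)
qed

lemma lborel_integral_scale:
  fixes f :: "'b::euclidean_space \<Rightarrow> 'c::{banach, second_countable_topology}"
  assumes [measurable]: "f \<in> borel_measurable borel" and c: "c \<noteq> 0"
  shows "(LINT x|lborel. f (a + c *\<^sub>R x)) = (1 / \<bar>c\<bar> ^ DIM('b)) *\<^sub>R (LINT x|lborel. f x)"
proof -
  have "(LINT x|lborel. f x) = \<bar>c\<bar> ^ DIM('b) *\<^sub>R (LINT x|lborel. f (a + c *\<^sub>R x))"
    by (subst lborel_affine[OF c, of a], subst integral_density) (auto simp: integral_distr)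
  then show ?thesis using c by simp
qed

lemma lborel_integrable_scale:
  fixes f :: "'b::euclidean_space \<Rightarrow> 'c::{banach, second_countable_topology}"
  assumes f: "integrable lborel f" and c: "c \<noteq> 0"
  shows "integrable lborel (\<lambda>x. f (a + c *\<^sub>R x))"
proof -
  have [measurable]: "f \<in> borel_measurable borel" using borel_measurable_integrable[OF f] by simp
  have "integrable (density (distr lborel borel (\<lambda>x. a + c *\<^sub>R x)) (\<lambda>_. ennreal (\<bar>c\<bar> ^ DIM('b)))) f"
    using f lborel_affine[OF c, of a] by (simp add: ennreal_power)
  then have "integrable lborel (\<lambda>x. \<bar>c\<bar> ^ DIM('b) *\<^sub>R f (a + c *\<^sub>R x))"
    by (subst (asm) integrable_density) (auto simp: integrable_distr_eq)
  from integrable_scaleR_right[OF this, of "1 / \<bar>c\<bar> ^ DIM('b)"] show ?thesis using c by simp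
qed

text \<open>Fubini's theorem for \<open>e\<^sup>i\<^sup>\<xi>\<^sup>x \<phi>(x) g(\<xi>)\<close>, in which \<open>\<phi>\<close> and \<open>g\<close> play symmetric roles.\<close>

lemma integral_fourier_mult:
  fixes \<phi> g :: "'b::euclidean_space \<Rightarrow> complex"
  assumes \<phi>: "integrable lborel \<phi>" and g: "integrable lborel g"
  shows "(LINT \<xi>|lborel. fourier \<phi> \<xi> * g \<xi>) = (LINT x|lborel. \<phi> x * fourier g x)"
proof -
  have [measurable]: "\<phi> \<in> borel_measurable borel" "g \<in> borel_measurable borel"
    using borel_measurable_integrable[OF \<phi>] borel_measurable_integrable[OF g] by simp_all
  have int: "integrable (lborel \<Otimes>\<^sub>M lborel) (\<lambda>(\<xi>, x). exp (\<i> * of_real (\<xi> \<bullet> x)) * \<phi> x * g \<xi>)"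
  proof (rule lborel_pair.Fubini_integrable)
    show "(\<lambda>(\<xi>, x). exp (\<i> * of_real (\<xi> \<bullet> x)) * \<phi> x * g \<xi>) \<in> borel_measurable (lborel \<Otimes>\<^sub>M lborel)"
      by measurable
    show "integrable lborel (\<lambda>x. LINT y|lborel. norm (case (x, y) of (\<xi>, x) \<Rightarrow> exp (\<i> * of_real (\<xi> \<bullet> x)) * \<phi> x * g \<xi>))"
      using \<phi> g by (simp add: norm_mult)
    show "AE x in lborel. integrable lborel (\<lambda>y. case (x, y) of (\<xi>, x) \<Rightarrow> exp (\<i> * of_real (\<xi> \<bullet> x)) * \<phi> x * g \<xi>)"
      using integrable_fourier_integrand[OF \<phi>] by simp
  qed
  have "(LINT \<xi>|lborel. fourier \<phi> \<xi> * g \<xi>) = (LINT \<xi>|lborel. LINT x|lborel. exp (\<i> * of_real (\<xi> \<bullet> x)) * \<phi> x * g \<xi>)"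
    by (simp add: fourier_def)
  also have "\<dots> = (LINT x|lborel. LINT \<xi>|lborel. exp (\<i> * of_real (\<xi> \<bullet> x)) * \<phi> x * g \<xi>)"
    using lborel_pair.Fubini_integral[OF int] by simp
  also have "\<dots> = (LINT x|lborel. \<phi> x * fourier g x)"
    unfolding fourier_def
    by (intro Bochner_Integration.integral_cong refl, subst integral_mult_right_zero[symmetric],
      intro Bochner_Integration.integral_cong refl) (simp add: inner_commute mult_ac)
  finally show ?thesis .
qed

lemma fourier_reflect:
  fixes \<phi> :: "'b::euclidean_space \<Rightarrow> complex"
  assumes [measurable]: "\<phi> \<in> borel_measurable borel"
  shows "fourier (\<lambda>x. \<phi> (- x)) \<xi> = fourier \<phi> (- \<xi>)"
  using lborel_integral_scale[of "\<lambda>x. exp (\<i> * of_real (- \<xi> \<bullet> x)) * \<phi> x" "-1" 0]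
  by (simp add: fourier_def)

text \<open>Up to normalization the standard Gaussian is its own transform: a wide Gaussian modulated by
  \<open>x\<close> has as transform a narrow one centred at \<open>x\<close>.\<close>

lemma fourier_gauss_modulated:
  fixes x y :: "'b::euclidean_space"
  assumes t: "t > 0"
  shows "fourier (\<lambda>\<xi>. exp (\<i> * of_real (x \<bullet> \<xi>)) * of_real (exp (- (norm (t *\<^sub>R \<xi>))\<^sup>2 / 2))) (- y)
    = of_real ((2 * pi) ^ DIM('b) / t ^ DIM('b) * gauss ((1 / t) *\<^sub>R (x - y)))"
proof -
  let ?c = "(2 * pi) powr (real DIM('b) / 2)"
  have e: "exp (- (norm (\<xi>::'b))\<^sup>2 / 2) = ?c * gauss \<xi>" for \<xi>
    by (simp add: gauss_eq powr_minus field_simps flip: powr_add)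
  let ?z = "(1 / t) *\<^sub>R (x - y)"
  have "fourier (\<lambda>\<xi>. exp (\<i> * of_real (x \<bullet> \<xi>)) * of_real (exp (- (norm (t *\<^sub>R \<xi>))\<^sup>2 / 2))) (- y)
    = (LINT \<xi>|lborel. (\<lambda>\<eta>. exp (\<i> * of_real (?z \<bullet> \<eta>)) * of_real (?c * gauss \<eta>)) (0 + t *\<^sub>R \<xi>))"
    unfolding fourier_def e
  proof (intro Bochner_Integration.integral_cong refl)
    fix \<xi> :: 'b
    have "?z \<bullet> (0 + t *\<^sub>R \<xi>) = - y \<bullet> \<xi> + x \<bullet> \<xi>" using t by (simp add: inner_diff_left)
    then have "exp (\<i> * of_real (?z \<bullet> (0 + t *\<^sub>R \<xi>))) = exp (\<i> * complex_of_real (- y \<bullet> \<xi>)) * exp (\<i> * of_real (x \<bullet> \<xi>))"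
      by (simp only: of_real_add distrib_left exp_add)
    then show "exp (\<i> * complex_of_real (- y \<bullet> \<xi>)) * (exp (\<i> * of_real (x \<bullet> \<xi>)) * complex_of_real (?c * gauss (t *\<^sub>R \<xi>)))
      = exp (\<i> * of_real (?z \<bullet> (0 + t *\<^sub>R \<xi>))) * complex_of_real (?c * gauss (0 + t *\<^sub>R \<xi>))"
      by simp
  qed
  also have "\<dots> = (1 / t ^ DIM('b)) *\<^sub>R (LINT \<eta>|lborel. exp (\<i> * of_real (?z \<bullet> \<eta>)) * of_real (?c * gauss \<eta>))"
    using t by (subst lborel_integral_scale) auto
  also have "(LINT \<eta>|lborel. exp (\<i> * of_real (?z \<bullet> \<eta>)) * complex_of_real (?c * gauss \<eta>))
      = of_real ?c * fourier (\<lambda>\<eta>. of_real (gauss \<eta>)) ?z"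
    unfolding fourier_def by (simp flip: integral_mult_right_zero) (simp add: mult_ac)
  also have "\<dots> = of_real (?c * (?c * gauss ?z))"
    by (simp only: fourier_gauss e of_real_mult)
  also have "?c * (?c * gauss ?z) = (2 * pi) ^ DIM('b) * gauss ?z"
    by (simp add: powr_realpow flip: mult.assoc powr_add)
  finally show ?thesis by (simp add: scaleR_conv_of_real)
qed

text \<open>Damping the pairing \<open>\<integral> \<phi>\<^sup>^(\<xi>) f\<^sup>^(-\<xi>) d\<xi>\<close> by a wide Gaussian amounts to convolving \<open>f\<close> with a narrow
  one. No integrability of the pairing itself is involved, so the formula serves both for Parseval's
  identity, where the damping is removed, and for uniqueness, where \<open>\<phi>\<^sup>^ = 0\<close>.\<close>

lemma gauss_summation:
  fixes \<phi> :: "'b::euclidean_space \<Rightarrow> complex" and f :: "'b \<Rightarrow> real"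
  assumes \<phi>: "integrable lborel \<phi>" and f: "integrable lborel f" "continuous_on UNIV f" "bounded (range f)"
  shows "(\<lambda>n. LINT \<xi>|lborel. fourier \<phi> \<xi> * test_fourier f (- \<xi>) *
      of_real (exp (- (norm ((1 / real (Suc n)) *\<^sub>R \<xi>))\<^sup>2 / 2)))
    \<longlonglongrightarrow> of_real ((2 * pi) ^ DIM('b)) * (LINT x|lborel. \<phi> x * of_real (f x))"
proof -
  have [measurable]: "\<phi> \<in> borel_measurable borel" "f \<in> borel_measurable borel"
    using borel_measurable_integrable[OF \<phi>] borel_measurable_integrable[OF f(1)] by simp_all
  obtain B where B: "\<And>x. \<bar>f x\<bar> \<le> B" using f(3) by (auto simp: bounded_iff)
  have B0: "B \<ge> 0" using B[of 0] by linarith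
  define F where "F = test_fourier f"
  have [measurable]: "F \<in> borel_measurable borel" unfolding F_def by measurable
  have FB: "norm (F \<xi>) \<le> (LINT x|lborel. \<bar>f x\<bar>)" for \<xi>
    unfolding F_def using norm_fourier_le[of "\<lambda>x. complex_of_real (f x)" \<xi>] by simp
  define h where "h t \<xi> = exp (- (norm (t *\<^sub>R (\<xi>::'b)))\<^sup>2 / 2)" for t \<xi>
  have h_int: "integrable lborel (h t)" if "t > 0" for t
  proof -
    have "h t = (\<lambda>\<xi>. (2 * pi) powr (real DIM('b) / 2) * gauss (0 + t *\<^sub>R \<xi>))"
      by (rule ext) (simp add: h_def gauss_eq powr_minus field_simps flip: powr_add)
    then show ?thesis
      using lborel_integrable_scale[OF integrable_gauss, of t 0] that by simp
  qed
  have [measurable]: "h t \<in> borel_measurable borel" for t unfolding h_def by measurable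
  have conv: "(LINT \<xi>|lborel. fourier \<phi> \<xi> * F (- \<xi>) * of_real (h t \<xi>))
      = of_real ((2 * pi) ^ DIM('b)) * (LINT x|lborel. \<phi> x * of_real (LINT z|lborel. f (x - t *\<^sub>R z) * gauss z))"
    if t: "t > 0" for t
  proof -
    let ?g = "\<lambda>\<xi>. F (- \<xi>) * of_real (h t \<xi>)"
    have g: "integrable lborel ?g"
    proof (rule Bochner_Integration.integrable_bound)
      show "integrable lborel (\<lambda>\<xi>. (LINT x|lborel. \<bar>f x\<bar>) * h t \<xi>)"
        using h_int[OF t] by simp
      show "AE \<xi> in lborel. norm (?g \<xi>) \<le> norm ((LINT x|lborel. \<bar>f x\<bar>) * h t \<xi>)"
        using FB by (intro AE_I2) (auto simp: norm_mult h_def intro!: mult_right_mono)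
    qed simp
    have "fourier ?g x = of_real ((2 * pi) ^ DIM('b) * (LINT z|lborel. f (x - t *\<^sub>R z) * gauss z))" for x
    proof -
      let ?k = "\<lambda>\<xi>. exp (\<i> * of_real (x \<bullet> \<xi>)) * complex_of_real (h t \<xi>)"
      have k: "integrable lborel ?k"
        using integrable_fourier_integrand[of "\<lambda>\<xi>. complex_of_real (h t \<xi>)" x] h_int[OF t] by simp
      have k': "integrable lborel (\<lambda>\<xi>. ?k (- \<xi>))"
        using lborel_integrable_scale[OF k, of "-1" 0] by simp
      have "fourier ?g x = (LINT \<xi>|lborel. F (- \<xi>) * ?k \<xi>)"
        unfolding fourier_def by (simp add: mult_ac)
      also have "\<dots> = (LINT \<xi>|lborel. F \<xi> * ?k (- \<xi>))"
        using lborel_integral_scale[of "\<lambda>\<xi>. F \<xi> * ?k (- \<xi>)" "-1" 0] by simp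
      also have "\<dots> = (LINT y|lborel. of_real (f y) * fourier (\<lambda>\<xi>. ?k (- \<xi>)) y)"
        unfolding F_def using f(1) k' by (intro integral_fourier_mult) auto
      also have "\<dots> = (LINT y|lborel. of_real (f y) * fourier ?k (- y))"
        by (subst fourier_reflect) auto
      also have "\<dots> = (LINT y|lborel. complex_of_real (f y * ((2 * pi) ^ DIM('b) / t ^ DIM('b) * gauss ((1 / t) *\<^sub>R (x - y)))))"
        unfolding h_def fourier_gauss_modulated[OF t] by simp
      also have "\<dots> = of_real (LINT y|lborel. f y * ((2 * pi) ^ DIM('b) / t ^ DIM('b) * gauss ((1 / t) *\<^sub>R (x - y))))"
        by (rule integral_complex_of_real)
      also have "(LINT y|lborel. f y * ((2 * pi) ^ DIM('b) / t ^ DIM('b) * gauss ((1 / t) *\<^sub>R (x - y))))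
        = t ^ DIM('b) * (LINT z|lborel. f (x - t *\<^sub>R z) * ((2 * pi) ^ DIM('b) / t ^ DIM('b) * gauss z))"
        using lborel_integral_scale[of "\<lambda>y. f y * ((2 * pi) ^ DIM('b) / t ^ DIM('b) * gauss ((1 / t) *\<^sub>R (x - y)))" "- t" x] t
        by simp
      also have "\<dots> = (2 * pi) ^ DIM('b) * (LINT z|lborel. f (x - t *\<^sub>R z) * gauss z)"
      proof -
        have "f (x - t *\<^sub>R z) * ((2 * pi) ^ DIM('b) / t ^ DIM('b) * gauss z)
          = (2 * pi) ^ DIM('b) / t ^ DIM('b) * (f (x - t *\<^sub>R z) * gauss z)" for z by simp
        then show ?thesis using t by (simp only: integral_mult_right_zero) simp
      qed
      finally show ?thesis .
    qed
    then have "(LINT \<xi>|lborel. fourier \<phi> \<xi> * ?g \<xi>)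
      = (LINT x|lborel. \<phi> x * of_real ((2 * pi) ^ DIM('b) * (LINT z|lborel. f (x - t *\<^sub>R z) * gauss z)))"
      using integral_fourier_mult[OF \<phi> g] by simp
    also have "\<dots> = of_real ((2 * pi) ^ DIM('b)) * (LINT x|lborel. \<phi> x * of_real (LINT z|lborel. f (x - t *\<^sub>R z) * gauss z))"
    proof -
      have "\<phi> x * of_real ((2 * pi) ^ DIM('b) * (LINT z|lborel. f (x - t *\<^sub>R z) * gauss z))
        = of_real ((2 * pi) ^ DIM('b)) * (\<phi> x * of_real (LINT z|lborel. f (x - t *\<^sub>R z) * gauss z))" for x
        by (simp only: of_real_mult mult_ac)
      then show ?thesis by (simp only: integral_mult_right_zero)
    qed
    finally show ?thesis by (simp add: mult_ac)
  qed
  define t where "t n = 1 / real (Suc n)" for n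
  have t: "t n > 0" "t \<longlonglongrightarrow> 0" for n
    unfolding t_def using LIMSEQ_inverse_real_of_nat by (simp_all add: field_simps)
  have inner: "(\<lambda>n. LINT z|lborel. f (x - t n *\<^sub>R z) * gauss z) \<longlonglongrightarrow> f x" for x
  proof -
    have "(\<lambda>n. LINT z|lborel. f (x - t n *\<^sub>R z) * gauss z) \<longlonglongrightarrow> (LINT z|lborel. f x * gauss (z::'b))"
    proof (rule integral_dominated_convergence[where w="\<lambda>z. B * gauss z"])
      show "AE z in lborel. (\<lambda>n. f (x - t n *\<^sub>R z) * gauss z) \<longlonglongrightarrow> f x * gauss z"
      proof (intro AE_I2 tendsto_intros)
        fix z :: 'b
        have "(\<lambda>n. x - t n *\<^sub>R z) \<longlonglongrightarrow> x - 0 *\<^sub>R z" by (intro tendsto_intros t)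
        then show "(\<lambda>n. f (x - t n *\<^sub>R z)) \<longlonglongrightarrow> f x"
          using continuous_on_tendsto_compose[OF f(2), of "\<lambda>n. x - t n *\<^sub>R z" x sequentially] by simp
      qed
      show "AE z in lborel. norm (f (x - t n *\<^sub>R z) * gauss z) \<le> B * gauss z" for n
        using B by (intro AE_I2) (auto simp: abs_mult gauss_nonneg intro!: mult_right_mono)
    qed (use integrable_gauss in auto)
    then show ?thesis by (simp add: integral_gauss)
  qed
  have innerB: "\<bar>LINT z|lborel. f (x - t n *\<^sub>R z) * gauss z\<bar> \<le> B" for x n
  proof -
    have le: "\<bar>f (x - t n *\<^sub>R z) * gauss z\<bar> \<le> B * gauss z" for z
      using B by (simp add: abs_mult gauss_nonneg mult_right_mono)
    have "integrable lborel (\<lambda>z. f (x - t n *\<^sub>R z) * gauss z)"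
      using le by (intro Bochner_Integration.integrable_bound[OF integrable_mult_right[OF integrable_gauss, of B]])
        (auto intro!: AE_I2 order_trans[OF le])
    then have "(LINT z|lborel. \<bar>f (x - t n *\<^sub>R z) * gauss z\<bar>) \<le> (LINT z|lborel. B * gauss (z::'b))"
      using le integrable_gauss by (intro integral_mono) auto
    moreover have "(LINT z|lborel. B * gauss (z::'b)) = B" by (simp add: integral_gauss)
    ultimately show ?thesis
      using integral_abs_bound[of lborel "\<lambda>z. f (x - t n *\<^sub>R z) * gauss z"] by linarith
  qed
  have "(\<lambda>n. LINT x|lborel. \<phi> x * of_real (LINT z|lborel. f (x - t n *\<^sub>R z) * gauss z)) \<longlonglongrightarrow> (LINT x|lborel. \<phi> x * of_real (f x))"
  proof (rule integral_dominated_convergence[where w="\<lambda>x. B * norm (\<phi> x)"])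
    show "AE x in lborel. (\<lambda>n. \<phi> x * complex_of_real (LINT z|lborel. f (x - t n *\<^sub>R z) * gauss z)) \<longlonglongrightarrow> \<phi> x * of_real (f x)"
      by (intro AE_I2 tendsto_intros inner)
    show "AE x in lborel. norm (\<phi> x * complex_of_real (LINT z|lborel. f (x - t n *\<^sub>R z) * gauss z)) \<le> B * norm (\<phi> x)" for n
      by (intro AE_I2, simp only: norm_mult norm_of_real, subst mult.commute) (intro mult_right_mono innerB norm_ge_zero)
  qed (use \<phi> in auto)
  then have "(\<lambda>n. of_real ((2 * pi) ^ DIM('b)) * (LINT x|lborel. \<phi> x * of_real (LINT z|lborel. f (x - t n *\<^sub>R z) * gauss z)))
    \<longlonglongrightarrow> of_real ((2 * pi) ^ DIM('b)) * (LINT x|lborel. \<phi> x * of_real (f x))"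
    by (intro tendsto_intros)
  then show ?thesis
    using conv[OF t(1)] by (simp add: F_def h_def t_def)
qed

text \<open>The transform of \<open>\<phi>\<close> need not be integrable, only its product with that of \<open>f\<close>; this suffices to remove
  the damping by dominated convergence.\<close>

lemma parseval_pairing:
  fixes \<phi> :: "'b::euclidean_space \<Rightarrow> complex" and f :: "'b \<Rightarrow> real"
  assumes \<phi>: "integrable lborel \<phi>" and f: "integrable lborel f" "continuous_on UNIV f" "bounded (range f)"
    and int: "integrable lborel (\<lambda>\<xi>. fourier \<phi> \<xi> * test_fourier f (- \<xi>))"
  shows "(LINT \<xi>|lborel. fourier \<phi> \<xi> * test_fourier f (- \<xi>))
    = of_real ((2 * pi) ^ DIM('b)) * (LINT x|lborel. \<phi> x * of_real (f x))"
proof -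
  have [measurable]: "\<phi> \<in> borel_measurable borel" "f \<in> borel_measurable borel"
    using borel_measurable_integrable[OF \<phi>] borel_measurable_integrable[OF f(1)] by simp_all
  let ?k = "\<lambda>\<xi>. fourier \<phi> \<xi> * test_fourier f (- \<xi>)"
  have "(\<lambda>n. LINT \<xi>|lborel. ?k \<xi> * of_real (exp (- (norm ((1 / real (Suc n)) *\<^sub>R \<xi>))\<^sup>2 / 2)))
    \<longlonglongrightarrow> (LINT \<xi>|lborel. ?k \<xi>)"
  proof (rule integral_dominated_convergence[where w="\<lambda>\<xi>. norm (?k \<xi>)"])
    show "AE \<xi> in lborel. (\<lambda>n. ?k \<xi> * complex_of_real (exp (- (norm ((1 / real (Suc n)) *\<^sub>R \<xi>))\<^sup>2 / 2))) \<longlonglongrightarrow> ?k \<xi>"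
    proof (intro AE_I2)
      fix \<xi> :: 'b
      have "(\<lambda>n. 1 / real (Suc n)) \<longlonglongrightarrow> 0"
        using LIMSEQ_inverse_real_of_nat by (simp add: field_simps)
      then have "(\<lambda>n. ?k \<xi> * complex_of_real (exp (- (norm ((1 / real (Suc n)) *\<^sub>R \<xi>))\<^sup>2 / 2)))
         \<longlonglongrightarrow> ?k \<xi> * complex_of_real (exp (- (norm (0 *\<^sub>R \<xi>))\<^sup>2 / 2))"
        by (intro tendsto_intros) auto
      then show "(\<lambda>n. ?k \<xi> * complex_of_real (exp (- (norm ((1 / real (Suc n)) *\<^sub>R \<xi>))\<^sup>2 / 2))) \<longlonglongrightarrow> ?k \<xi>" by simp
    qed
    show "AE \<xi> in lborel. norm (?k \<xi> * complex_of_real (exp (- (norm ((1 / real (Suc n)) *\<^sub>R \<xi>))\<^sup>2 / 2))) \<le> norm (?k \<xi>)" for n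
      by (intro AE_I2) (simp only: norm_mult norm_of_real, intro mult_right_le_one_le, auto)
  qed (use int in auto)
  then show ?thesis
    using gauss_summation[OF \<phi> f] LIMSEQ_unique by blast
qed

text \<open>An integrable function with vanishing Fourier transform is orthogonal to every continuous
  function of compact support, hence has integral \<open>0\<close> over every compact set.\<close>

lemma AE_zero_if_fourier_zero:
  fixes \<phi> :: "'b::euclidean_space \<Rightarrow> complex"
  assumes \<phi>: "integrable lborel \<phi>" and z: "\<And>\<xi>. fourier \<phi> \<xi> = 0"
  shows "AE x in lborel. \<phi> x = 0"
proof (rule sigma_finite_measure.density_zero[OF lborel.sigma_finite_measure_axioms \<phi>])
  have [measurable]: "\<phi> \<in> borel_measurable borel"
    using borel_measurable_integrable[OF \<phi>] by simp
  have cont: "(LINT x|lborel. \<phi> x * of_real (f x)) = 0" if "continuous_on UNIV f" "compact (tsupport f)" for f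
  proof -
    have "(\<lambda>n. 0) \<longlonglongrightarrow> of_real ((2 * pi) ^ DIM('b)) * (LINT x|lborel. \<phi> x * of_real (f x))"
      using gauss_summation[OF \<phi> continuous_compact_support_integrable(1)[OF that] that(1)
          continuous_compact_support_integrable(2)[OF that]] by (simp add: z)
    from LIMSEQ_unique[OF this tendsto_const] show ?thesis by simp
  qed
  have cpt: "(LINT x|lborel. indicator S x *\<^sub>R \<phi> x) = 0" if S: "compact S" "S \<noteq> {}" for S
  proof -
    have [measurable]: "S \<in> sets borel" using S by (simp add: borel_compact)
    define f where "f n x = max 0 (1 - real n * infdist x S)" for n :: nat and x
    have c: "continuous_on UNIV (f n)" for n
      unfolding f_def by (intro continuous_intros)
    have "(LINT x|lborel. \<phi> x * of_real (f (Suc n) x)) = 0" for n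
    proof (rule cont[OF c])
      obtain R where R: "\<And>x. x \<in> S \<Longrightarrow> norm x \<le> R" using S compact_imp_bounded bounded_iff by metis
      have "tsupport (f (Suc n)) \<subseteq> cball 0 (R + 1)"
        unfolding tsupport_def
      proof (rule closure_minimal)
        show "{x. f (Suc n) x \<noteq> 0} \<subseteq> cball 0 (R + 1)"
        proof
          fix x assume "x \<in> {x. f (Suc n) x \<noteq> 0}"
          then have "real (Suc n) * infdist x S < 1" by (auto simp: f_def max_def split: if_splits)
          moreover have "infdist x S \<le> real (Suc n) * infdist x S"
            using infdist_nonneg[of x S] mult_right_mono[of 1 "real (Suc n)" "infdist x S"] by auto
          ultimately have "infdist x S < 1" by linarith
          moreover obtain y where "y \<in> S" "infdist x S = dist x y"
            using infdist_attains_inf[OF compact_imp_closed[OF S(1)] S(2), of x] by blast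
          ultimately show "x \<in> cball 0 (R + 1)"
            using R[of y] norm_triangle_ineq2[of x y] by (simp add: dist_norm)
        qed
      qed auto
      then show "compact (tsupport (f (Suc n)))"
        by (metis closed_closure compact_Int_closed compact_cball inf.absorb_iff2 tsupport_def)
    qed
    moreover have "(\<lambda>n. LINT x|lborel. \<phi> x * of_real (f (Suc n) x)) \<longlonglongrightarrow> (LINT x|lborel. indicator S x *\<^sub>R \<phi> x)"
    proof (rule integral_dominated_convergence[where w="\<lambda>x. norm (\<phi> x)"])
      show "(\<lambda>x. \<phi> x * complex_of_real (f (Suc n) x)) \<in> borel_measurable lborel" for n
        using borel_measurable_continuous_onI[OF c[of "Suc n"]] by simp
      show "AE x in lborel. norm (\<phi> x * complex_of_real (f (Suc n) x)) \<le> norm (\<phi> x)" for n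
      proof (intro AE_I2)
        fix x
        have "\<bar>f (Suc n) x\<bar> \<le> 1" using infdist_nonneg[of x S] by (auto simp: f_def max_def)
        then show "norm (\<phi> x * complex_of_real (f (Suc n) x)) \<le> norm (\<phi> x)"
          by (simp only: norm_mult norm_of_real) (intro mult_right_le_one_le, auto)
      qed
      show "AE x in lborel. (\<lambda>n. \<phi> x * complex_of_real (f (Suc n) x)) \<longlonglongrightarrow> indicator S x *\<^sub>R \<phi> x"
      proof (intro AE_I2)
        fix x
        show "(\<lambda>n. \<phi> x * complex_of_real (f (Suc n) x)) \<longlonglongrightarrow> indicator S x *\<^sub>R \<phi> x"
        proof (cases "x \<in> S")
          case True
          then have "f n x = 1" for n by (simp add: f_def)
          then show ?thesis using True by simp
        next
          case False
          then have pos: "infdist x S > 0"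
            using S by (simp add: compact_imp_closed infdist_pos_not_in_closed)
          obtain N where N: "1 / infdist x S < real N" using reals_Archimedean2 by blast
          have "f (Suc n) x = 0" if "n \<ge> N" for n
          proof -
            have "1 \<le> real N * infdist x S" using N pos by (simp add: field_simps)
            also have "\<dots> \<le> real (Suc n) * infdist x S" using that pos by (intro mult_right_mono) auto
            finally show ?thesis by (simp add: f_def)
          qed
          then have "\<forall>\<^sub>F n in sequentially. \<phi> x * complex_of_real (f (Suc n) x) = indicator S x *\<^sub>R \<phi> x"
            using False by (auto simp: eventually_sequentially)
          then show ?thesis by (rule tendsto_eventually)
        qed
      qed
    qed (use \<phi> in auto)
    ultimately show ?thesis by (simp add: LIMSEQ_const_iff)
  qed
  fix A :: "'b set" assume "A \<in> sets lborel"
  then have A: "A \<in> sigma_sets UNIV {S. closed S}" by (simp add: borel_eq_closed)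
  have "Int_stable {S::'b set. closed S}" "{S::'b set. closed S} \<subseteq> Pow UNIV" by (auto simp: Int_stable_def)
  from this A have "(LINT x|lborel. indicator A x *\<^sub>R \<phi> x) = 0"
  proof (induction rule: sigma_sets_induct_disjoint)
    case (basic S)
    then have S: "closed S" by simp
    then have [measurable]: "S \<in> sets borel" by simp
    have "(LINT x|lborel. indicator (S \<inter> cball 0 (real n)) x *\<^sub>R \<phi> x) = 0" for n
      using cpt[of "S \<inter> cball 0 (real n)"] S closed_Int_compact[of S "cball 0 (real n)"]
      by (cases "S \<inter> cball 0 (real n) = {}") auto
    moreover have "(\<lambda>n. LINT x|lborel. indicator (S \<inter> cball 0 (real n)) x *\<^sub>R \<phi> x)
      \<longlonglongrightarrow> (LINT x|lborel. indicator S x *\<^sub>R \<phi> x)"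
    proof (rule integral_dominated_convergence[where w="\<lambda>x. norm (\<phi> x)"])
      show "AE x in lborel. (\<lambda>n. indicator (S \<inter> cball 0 (real n)) x *\<^sub>R \<phi> x) \<longlonglongrightarrow> indicator S x *\<^sub>R \<phi> x"
      proof (intro AE_I2 tendsto_eventually)
        fix x :: 'b
        obtain N where "norm x \<le> real N" using real_arch_simple by blast
        then show "\<forall>\<^sub>F n in sequentially. indicator (S \<inter> cball 0 (real n)) x *\<^sub>R \<phi> x = indicator S x *\<^sub>R \<phi> x"
          by (intro eventually_sequentiallyI[of N]) (auto simp: indicator_def)
      qed
    qed (use \<phi> in \<open>auto simp: indicator_def\<close>)
    ultimately show ?case by (simp add: LIMSEQ_const_iff)
  next
    case empty show ?case by simp
  next
    case (compl A)
    then have [measurable]: "A \<in> sets borel" by (simp add: borel_eq_closed)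
    have "(LINT x|lborel. indicator (UNIV - A) x *\<^sub>R \<phi> x) = (LINT x|lborel. \<phi> x - indicator A x *\<^sub>R \<phi> x)"
      by (intro Bochner_Integration.integral_cong) (auto simp: indicator_def)
    also have "\<dots> = (LINT x|lborel. \<phi> x) - (LINT x|lborel. indicator A x *\<^sub>R \<phi> x)"
      using \<phi> by (intro Bochner_Integration.integral_diff integrable_mult_indicator) auto
    also have "\<dots> = 0" using z[of 0] compl by (simp add: fourier_def)
    finally show ?case .
  next
    case (union A)
    then have m: "A i \<in> sets lborel" for i by (auto simp: borel_eq_closed image_subset_iff)
    have "(LINT x:(\<Union>i. A i)|lborel. \<phi> x) = (\<Sum>i. LINT x:A i|lborel. \<phi> x)"
      using union m \<phi> by (intro lebesgue_integral_countable_add)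
        (auto simp: disjoint_family_on_def set_integrable_def intro!: integrable_mult_indicator)
    then show ?case using union by (simp add: set_lebesgue_integral_def)
  qed
  then show "set_lebesgue_integral lborel A \<phi> = 0" by (simp add: set_lebesgue_integral_def)
qed

section \<open>Truncated powers of the distance\<close>

text \<open>Dyadic shells around the ball of radius \<open>\<epsilon>\<close>: the least \<open>k\<close> with \<open>|x| < 2\<^sup>k\<^sup>+\<^sup>1 \<epsilon>\<close> has
  \<open>2\<^sup>k \<epsilon> \<le> max |x| \<epsilon>\<close>.\<close>

lemma truncated_power_le_shells:
  fixes x :: "'b::euclidean_space" and g \<epsilon> :: real
  assumes \<epsilon>: "\<epsilon> > 0" and g: "g \<ge> 0" and x: "norm x < 2 ^ n * \<epsilon>"
  shows "\<exists>k<Suc n. norm x < 2 ^ Suc k * \<epsilon> \<and> max (norm x) \<epsilon> powr (- g) \<le> (2 ^ k * \<epsilon>) powr (- g)"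
proof -
  define k where "k = (LEAST k. norm x < 2 ^ Suc k * \<epsilon>)"
  have ex: "norm x < 2 ^ Suc n * \<epsilon>"
    using x \<epsilon> by (auto intro: less_le_trans mult_right_mono)
  have k: "norm x < 2 ^ Suc k * \<epsilon>" unfolding k_def by (rule LeastI[of _ n]) (rule ex)
  have "k \<le> n" unfolding k_def by (rule Least_le) (rule ex)
  have "2 ^ k * \<epsilon> \<le> max (norm x) \<epsilon>"
  proof (cases k)
    case (Suc j)
    have "\<not> norm x < 2 ^ Suc j * \<epsilon>" using not_less_Least[of j "\<lambda>k. norm x < 2 ^ Suc k * \<epsilon>"] Suc k_def by auto
    then show ?thesis using Suc by simp
  qed simp
  then have "max (norm x) \<epsilon> powr (- g) \<le> (2 ^ k * \<epsilon>) powr (- g)"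
    using \<epsilon> g by (intro powr_mono2') auto
  with k \<open>k \<le> n\<close> show ?thesis by (intro exI[of _ k]) auto
qed

lemma nn_integral_shell:
  fixes g \<epsilon> :: real
  assumes \<epsilon>: "\<epsilon> > 0"
  shows "(\<integral>\<^sup>+x. ennreal ((2 ^ k * \<epsilon>) powr (- g)) * indicator (ball (0::'b::euclidean_space) (2 ^ Suc k * \<epsilon>)) x \<partial>lborel)
    = ennreal (unit_ball_vol DIM('b) * 2 ^ DIM('b) * \<epsilon> powr (DIM('b) - g) * (2 powr (DIM('b) - g)) ^ k)"
proof -
  have "(\<integral>\<^sup>+x. ennreal ((2 ^ k * \<epsilon>) powr (- g)) * indicator (ball (0::'b) (2 ^ Suc k * \<epsilon>)) x \<partial>lborel)
    = ennreal ((2 ^ k * \<epsilon>) powr (- g)) * ennreal (unit_ball_vol DIM('b) * (2 ^ Suc k * \<epsilon>) ^ DIM('b))"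
    using \<epsilon> by (simp add: nn_integral_cmult_indicator emeasure_ball)
  also have "\<dots> = ennreal ((2 ^ k * \<epsilon>) powr (- g) * (unit_ball_vol DIM('b) * (2 ^ Suc k * \<epsilon>) ^ DIM('b)))"
    using \<epsilon> by (simp add: ennreal_mult)
  also have "(2 ^ k * \<epsilon>) powr (- g) * (unit_ball_vol DIM('b) * (2 ^ Suc k * \<epsilon>) ^ DIM('b))
    = unit_ball_vol DIM('b) * 2 ^ DIM('b) * ((2 ^ k * \<epsilon>) powr (- g) * (2 ^ k * \<epsilon>) powr DIM('b))"
    using \<epsilon> by (simp add: powr_realpow power_mult_distrib mult_ac)
  also have "(2 ^ k * \<epsilon>) powr (- g) * (2 ^ k * \<epsilon>) powr DIM('b) = (2 ^ k * \<epsilon>) powr (DIM('b) - g)"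
    by (simp flip: powr_add)
  also have "\<dots> = \<epsilon> powr (DIM('b) - g) * (2 powr (DIM('b) - g)) ^ k"
  proof -
    have "(2 ^ k) powr (DIM('b) - g) = (2 powr (DIM('b) - g)) ^ k"
      by (simp add: powr_powr mult.commute flip: powr_realpow)
    then show ?thesis using \<epsilon> by (simp add: powr_mult)
  qed
  finally show ?thesis by (simp add: mult_ac)
qed

text \<open>The shells contribute the terms of a geometric series. Its ratio is \<open>1\<close> when \<open>g\<close> is the dimension,
  and the bound then grows like the number of shells, that is, like the logarithm of the radius
  divided by \<open>\<epsilon>\<close>.\<close>

lemma nn_integral_truncated_power_ball:
  fixes g \<epsilon> :: real
  assumes \<epsilon>: "\<epsilon> > 0" and g: "g \<ge> 0"
  shows "(\<integral>\<^sup>+x. ennreal (max (norm (x::'b::euclidean_space)) \<epsilon> powr (- g)) * indicator (ball 0 (2 ^ n * \<epsilon>)) x \<partial>lborel)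
    \<le> ennreal (unit_ball_vol DIM('b) * 2 ^ DIM('b) * \<epsilon> powr (DIM('b) - g) * (\<Sum>k<Suc n. (2 powr (DIM('b) - g)) ^ k))"
proof -
  let ?s = "\<lambda>k x::'b. ennreal ((2 ^ k * \<epsilon>) powr (- g)) * indicator (ball 0 (2 ^ Suc k * \<epsilon>)) x"
  have "ennreal (max (norm x) \<epsilon> powr (- g)) * indicator (ball 0 (2 ^ n * \<epsilon>)) x \<le> (\<Sum>k<Suc n. ?s k x)" for x :: 'b
  proof (cases "x \<in> ball 0 (2 ^ n * \<epsilon>)")
    case True
    then obtain k where k: "k < Suc n" "norm x < 2 ^ Suc k * \<epsilon>"
      "max (norm x) \<epsilon> powr (- g) \<le> (2 ^ k * \<epsilon>) powr (- g)"
      using truncated_power_le_shells[OF \<epsilon> g] by auto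
    have "ennreal (max (norm x) \<epsilon> powr (- g)) * indicator (ball 0 (2 ^ n * \<epsilon>)) x \<le> ?s k x"
      using k True by (simp add: ennreal_leI)
    also have "\<dots> \<le> (\<Sum>k<Suc n. ?s k x)"
      using k by (intro member_le_sum) auto
    finally show ?thesis .
  qed simp
  then have "(\<integral>\<^sup>+x. ennreal (max (norm x) \<epsilon> powr (- g)) * indicator (ball (0::'b) (2 ^ n * \<epsilon>)) x \<partial>lborel)
    \<le> (\<integral>\<^sup>+x. (\<Sum>k<Suc n. ?s k x) \<partial>lborel)"
    by (intro nn_integral_mono)
  also have "\<dots> = (\<Sum>k<Suc n. \<integral>\<^sup>+x. ?s k x \<partial>lborel)"
    by (rule nn_integral_sum) (intro borel_measurable_times_ennreal borel_measurable_indicator; simp)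
  also have "\<dots> = (\<Sum>k<Suc n. ennreal (unit_ball_vol DIM('b) * 2 ^ DIM('b) * \<epsilon> powr (DIM('b) - g) * (2 powr (DIM('b) - g)) ^ k))"
    by (simp only: nn_integral_shell[OF \<epsilon>])
  also have "\<dots> = ennreal (\<Sum>k<Suc n. unit_ball_vol DIM('b) * 2 ^ DIM('b) * \<epsilon> powr (DIM('b) - g) * (2 powr (DIM('b) - g)) ^ k)"
    by (intro sum_ennreal) auto
  finally show ?thesis by (simp only: sum_distrib_left)
qed

lemma nn_integral_truncated_power:
  fixes g \<epsilon> :: real
  assumes \<epsilon>: "\<epsilon> > 0" and g: "g > DIM('b)"
  shows "(\<integral>\<^sup>+x. ennreal (max (norm (x::'b::euclidean_space)) \<epsilon> powr (- g)) \<partial>lborel)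
    \<le> ennreal (unit_ball_vol DIM('b) * 2 ^ DIM('b) * \<epsilon> powr (DIM('b) - g) / (1 - 2 powr (DIM('b) - g)))"
proof -
  let ?f = "\<lambda>n x::'b. ennreal (max (norm x) \<epsilon> powr (- g)) * indicator (ball 0 (2 ^ n * \<epsilon>)) x"
  let ?c = "unit_ball_vol DIM('b) * 2 ^ DIM('b) * \<epsilon> powr (DIM('b) - g)"
  have q: "0 < 2 powr (DIM('b) - g)" "2 powr (DIM('b) - g) < 1"
    using g powr_less_mono[of "DIM('b) - g" 0 2] by auto
  have lim: "(\<lambda>n. ?f n x) \<longlonglongrightarrow> ennreal (max (norm x) \<epsilon> powr (- g))" for x :: 'b
  proof (rule tendsto_eventually)
    obtain N where N: "norm x / \<epsilon> < 2 ^ N" using real_arch_pow[of 2] by auto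
    have "norm x < 2 ^ n * \<epsilon>" if "n \<ge> N" for n
    proof -
      have "norm x < 2 ^ N * \<epsilon>" using N \<epsilon> by (simp add: field_simps)
      also have "\<dots> \<le> 2 ^ n * \<epsilon>" using that \<epsilon> by (intro mult_right_mono power_increasing) auto
      finally show ?thesis .
    qed
    then show "\<forall>\<^sub>F n in sequentially. ?f n x = ennreal (max (norm x) \<epsilon> powr (- g))"
      by (intro eventually_sequentiallyI[of N]) auto
  qed
  have "(\<integral>\<^sup>+x. ennreal (max (norm (x::'b)) \<epsilon> powr (- g)) \<partial>lborel) = (\<integral>\<^sup>+x. liminf (\<lambda>n. ?f n x) \<partial>lborel)"
    using lim by (intro nn_integral_cong) (metis lim_imp_Liminf trivial_limit_sequentially)
  also have "\<dots> \<le> liminf (\<lambda>n. \<integral>\<^sup>+x. ?f n x \<partial>lborel)"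
    by (rule nn_integral_liminf) (intro borel_measurable_times_ennreal borel_measurable_indicator; simp)
  also have "\<dots> \<le> limsup (\<lambda>n. \<integral>\<^sup>+x. ?f n x \<partial>lborel)"
    by (rule Liminf_le_Limsup) simp
  also have "\<dots> \<le> ennreal (?c / (1 - 2 powr (DIM('b) - g)))"
  proof (rule Limsup_bounded, rule always_eventually, rule allI)
    fix n
    have "(\<Sum>k<Suc n. (2 powr (DIM('b) - g)) ^ k) \<le> 1 / (1 - 2 powr (DIM('b) - g))"
      using sum_le_suminf[of "\<lambda>k. (2 powr (DIM('b) - g)) ^ k" "{..<Suc n}"] q
      by (simp add: suminf_geometric summable_geometric)
    then have "?c * (\<Sum>k<Suc n. (2 powr (DIM('b) - g)) ^ k) \<le> ?c * (1 / (1 - 2 powr (DIM('b) - g)))"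
      by (intro mult_left_mono) auto
    moreover have "(\<integral>\<^sup>+x. ?f n x \<partial>lborel) \<le> ennreal (?c * (\<Sum>k<Suc n. (2 powr (DIM('b) - g)) ^ k))"
      using g by (intro nn_integral_truncated_power_ball \<epsilon>) linarith
    ultimately show "(\<integral>\<^sup>+x. ?f n x \<partial>lborel) \<le> ennreal (?c / (1 - 2 powr (DIM('b) - g)))"
      by (auto intro: order_trans ennreal_leI)
  qed
  finally show ?thesis .
qed

text \<open>The weight is dominated by the truncated power with \<open>\<epsilon> = 1\<close> and exponent \<open>2 u\<close>.\<close>

lemma integrable_bracket_powr:
  assumes u: "u > real DIM('b) / 2"
  shows "integrable lborel (\<lambda>\<xi>::'b::euclidean_space. (1 + (norm \<xi>)\<^sup>2) powr (- u))"
proof (rule integrableI_bounded)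
  show "(\<lambda>\<xi>::'b. (1 + (norm \<xi>)\<^sup>2) powr (- u)) \<in> borel_measurable lborel" by measurable
  have "(1 + (norm \<xi>)\<^sup>2) powr (- u) \<le> max (norm \<xi>) 1 powr (- (2 * u))" for \<xi> :: 'b
  proof -
    have "(max (norm \<xi>) 1)\<^sup>2 \<le> 1 + (norm \<xi>)\<^sup>2" by (auto simp: max_def power2_eq_square)
    moreover have "u \<ge> 0" using u by (smt (verit) divide_nonneg_nonneg of_nat_0_le_iff)
    ultimately have "(1 + (norm \<xi>)\<^sup>2) powr (- u) \<le> ((max (norm \<xi>) 1)\<^sup>2) powr (- u)"
      by (intro powr_mono2') auto
    also have "((max (norm \<xi>) 1)\<^sup>2) powr (- u) = max (norm \<xi>) 1 powr (- (2 * u))"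
      by (simp add: powr_powr flip: powr_numeral)
    finally show ?thesis .
  qed
  then have "(\<integral>\<^sup>+\<xi>. ennreal (norm ((1 + (norm (\<xi>::'b))\<^sup>2) powr (- u))) \<partial>lborel)
    \<le> (\<integral>\<^sup>+\<xi>. ennreal (max (norm (\<xi>::'b)) 1 powr (- (2 * u))) \<partial>lborel)"
    by (intro nn_integral_mono) (simp add: ennreal_leI)
  also have "\<dots> < \<infinity>"
    using nn_integral_truncated_power[of 1 "2 * u", where 'b='b] u by (auto simp: le_less_trans)
  finally show "(\<integral>\<^sup>+\<xi>. ennreal (norm ((1 + (norm (\<xi>::'b))\<^sup>2) powr (- u))) \<partial>lborel) < \<infinity>" .
qed

section \<open>Sobolev spaces as weighted \<open>L\<^sup>2\<close> spaces\<close>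

definition weighted_L2 :: "real \<Rightarrow> ('b::euclidean_space \<Rightarrow> complex) set" where
  "weighted_L2 s = {g \<in> borel_measurable borel. integrable lborel (sobolev_density s g)}"

definition weighted_norm :: "real \<Rightarrow> ('b::euclidean_space \<Rightarrow> complex) \<Rightarrow> real" where
  "weighted_norm s g = sqrt (LINT \<xi>|lborel. sobolev_density s g \<xi>)"

lemma sobolev_density_nonneg: "0 \<le> sobolev_density s g \<xi>"
  by (simp add: sobolev_density_def)

lemma measurable_sobolev_density[measurable]:
  "g \<in> borel_measurable borel \<Longrightarrow> sobolev_density s g \<in> borel_measurable borel"
  unfolding sobolev_density_def[abs_def] by measurable

lemma weighted_norm_nonneg: "0 \<le> weighted_norm s g"
  by (simp add: weighted_norm_def sobolev_density_nonneg)

lemma weighted_norm_square: "(weighted_norm s g)\<^sup>2 = (LINT \<xi>|lborel. sobolev_density s g \<xi>)"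
  by (simp add: weighted_norm_def sobolev_density_nonneg)

lemma sobolev_density_add_le:
  assumes "t > 0"
  shows "sobolev_density s (\<lambda>\<xi>. g \<xi> + h \<xi>) \<xi>
    \<le> (1 + t) * sobolev_density s g \<xi> + (1 + 1 / t) * sobolev_density s h \<xi>"
proof -
  let ?a = "cmod (g \<xi>)" and ?b = "cmod (h \<xi>)"
  have "(cmod (g \<xi> + h \<xi>))\<^sup>2 \<le> (?a + ?b)\<^sup>2"
    by (intro power_mono norm_triangle_ineq) auto
  also have "\<dots> \<le> (1 + t) * ?a\<^sup>2 + (1 + 1 / t) * ?b\<^sup>2"
  proof -
    have "0 \<le> (t * ?a - ?b)\<^sup>2 / t" using assms by simp
    also have "(t * ?a - ?b)\<^sup>2 / t = t * ?a\<^sup>2 - 2 * ?a * ?b + ?b\<^sup>2 / t"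
      using assms by (simp add: power2_eq_square field_simps)
    finally show ?thesis by (simp add: power2_sum algebra_simps)
  qed
  finally have "(1 + (norm \<xi>)\<^sup>2) powr s * (cmod (g \<xi> + h \<xi>))\<^sup>2
    \<le> (1 + (norm \<xi>)\<^sup>2) powr s * ((1 + t) * ?a\<^sup>2 + (1 + 1 / t) * ?b\<^sup>2)"
    by (intro mult_left_mono) auto
  then show ?thesis by (simp add: sobolev_density_def algebra_simps)
qed

lemma weighted_L2_add:
  assumes g: "g \<in> weighted_L2 s" and h: "h \<in> weighted_L2 s"
  shows "(\<lambda>\<xi>. g \<xi> + h \<xi>) \<in> weighted_L2 s"
proof -
  have [measurable]: "g \<in> borel_measurable borel" "h \<in> borel_measurable borel"
    using g h by (auto simp: weighted_L2_def)
  have "integrable lborel (sobolev_density s (\<lambda>\<xi>. g \<xi> + h \<xi>))"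
  proof (rule Bochner_Integration.integrable_bound)
    show "integrable lborel (\<lambda>\<xi>. 2 * sobolev_density s g \<xi> + 2 * sobolev_density s h \<xi>)"
      using g h by (auto simp: weighted_L2_def)
    show "AE \<xi> in lborel. norm (sobolev_density s (\<lambda>\<xi>. g \<xi> + h \<xi>) \<xi>)
        \<le> norm (2 * sobolev_density s g \<xi> + 2 * sobolev_density s h \<xi>)"
      using sobolev_density_add_le[of 1 s g h] by (simp add: sobolev_density_nonneg)
  qed simp
  then show ?thesis by (simp add: weighted_L2_def)
qed

lemma sobolev_density_uminus: "sobolev_density s (\<lambda>\<xi>. - g \<xi>) = sobolev_density s g"
  by (rule ext) (simp add: sobolev_density_def)

lemma weighted_L2_diff:
  assumes g: "g \<in> weighted_L2 s" and h: "h \<in> weighted_L2 s"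
  shows "(\<lambda>\<xi>. g \<xi> - h \<xi>) \<in> weighted_L2 s"
  using weighted_L2_add[OF g, of "\<lambda>\<xi>. - h \<xi>"] h
  by (simp add: weighted_L2_def sobolev_density_uminus)

text \<open>Minkowski's inequality, from \<open>2 a b \<le> t a\<^sup>2 + b\<^sup>2 / t\<close> with an optimal choice of \<open>t\<close>.\<close>

lemma weighted_norm_add_le:
  assumes g: "g \<in> weighted_L2 s" and h: "h \<in> weighted_L2 s"
  shows "weighted_norm s (\<lambda>\<xi>. g \<xi> + h \<xi>) \<le> weighted_norm s g + weighted_norm s h"
proof -
  let ?a = "weighted_norm s g" and ?b = "weighted_norm s h"
  have ig: "integrable lborel (sobolev_density s g)" "integrable lborel (sobolev_density s h)"
    "integrable lborel (sobolev_density s (\<lambda>\<xi>. g \<xi> + h \<xi>))"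
    using g h weighted_L2_add[OF g h] by (auto simp: weighted_L2_def)
  have *: "(weighted_norm s (\<lambda>\<xi>. g \<xi> + h \<xi>))\<^sup>2 \<le> (1 + t) * ?a\<^sup>2 + (1 + 1 / t) * ?b\<^sup>2" if t: "t > 0" for t
  proof -
    have "(weighted_norm s (\<lambda>\<xi>. g \<xi> + h \<xi>))\<^sup>2
      \<le> (LINT \<xi>|lborel. (1 + t) * sobolev_density s g \<xi> + (1 + 1 / t) * sobolev_density s h \<xi>)"
      unfolding weighted_norm_square using ig t
      by (intro integral_mono sobolev_density_add_le) auto
    also have "\<dots> = (1 + t) * ?a\<^sup>2 + (1 + 1 / t) * ?b\<^sup>2"
      using ig by (simp add: weighted_norm_square)
    finally show ?thesis .
  qed
  have nn: "?a \<ge> 0" "?b \<ge> 0" by (simp_all add: weighted_norm_nonneg)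
  have "(weighted_norm s (\<lambda>\<xi>. g \<xi> + h \<xi>))\<^sup>2 \<le> (?a + ?b + e)\<^sup>2" if e: "e > 0" for e
  proof -
    \<comment> \<open>The optimal \<open>t\<close> is \<open>b / a\<close>; adding \<open>e / 2\<close> keeps both norms away from \<open>0\<close>.\<close>
    define a where "a = ?a + e / 2"
    define b where "b = ?b + e / 2"
    have ab: "a > 0" "b > 0" "?a \<le> a" "?b \<le> b" using nn e by (auto simp: a_def b_def)
    have "(weighted_norm s (\<lambda>\<xi>. g \<xi> + h \<xi>))\<^sup>2 \<le> (1 + b / a) * ?a\<^sup>2 + (1 + 1 / (b / a)) * ?b\<^sup>2"
      using ab by (intro *) simp
    also have "\<dots> \<le> (1 + b / a) * a\<^sup>2 + (1 + 1 / (b / a)) * b\<^sup>2"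
      using ab nn by (intro add_mono mult_left_mono power_mono) auto
    also have "\<dots> = (a + b)\<^sup>2" using ab by (simp add: field_simps power2_eq_square)
    finally show ?thesis by (simp add: a_def b_def algebra_simps)
  qed
  then have "weighted_norm s (\<lambda>\<xi>. g \<xi> + h \<xi>) \<le> ?a + ?b + e" if "e > 0" for e
    by (rule power2_le_imp_le) (use nn that in linarith)+
  then show ?thesis by (rule field_le_epsilon)
qed

lemma weighted_norm_uminus: "weighted_norm s (\<lambda>\<xi>. - g \<xi>) = weighted_norm s g"
  by (simp add: weighted_norm_def sobolev_density_uminus)

lemma weighted_norm_cong_AE:
  assumes "g \<in> borel_measurable borel" "h \<in> borel_measurable borel" "AE \<xi> in lborel. g \<xi> = h \<xi>"
  shows "weighted_norm s g = weighted_norm s h"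
  unfolding weighted_norm_def using assms
  by (intro arg_cong[where f=sqrt] integral_cong_AE) (auto simp: sobolev_density_def)

lemma AE_zero_if_weighted_norm_zero:
  assumes g: "g \<in> weighted_L2 s" and z: "weighted_norm s g = 0"
  shows "AE \<xi> in lborel. g \<xi> = 0"
proof -
  have "(LINT \<xi>|lborel. sobolev_density s g \<xi>) = 0"
    using z weighted_norm_square[of s g] by simp
  moreover have "integrable lborel (sobolev_density s g)" using g by (simp add: weighted_L2_def)
  ultimately have "AE \<xi> in lborel. sobolev_density s g \<xi> = 0"
    using integral_nonneg_eq_0_iff_AE[of lborel "sobolev_density s g"] by (simp add: sobolev_density_nonneg)
  moreover have "(1 + (norm \<xi>)\<^sup>2) powr s \<noteq> 0" for \<xi> :: 'a
    using add_pos_nonneg[of 1 "(norm \<xi>)\<^sup>2"] by simp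
  ultimately show ?thesis by (simp add: sobolev_density_def)
qed

text \<open>For any \<open>s\<close>, positive or negative, the weight is compensated by the rapid decay of the transform of \<open>f\<close>.\<close>

lemma weighted_L2_pairing_integrable:
  fixes g :: "'b::euclidean_space \<Rightarrow> complex"
  assumes g: "g \<in> weighted_L2 s" and f: "f \<in> test_functions UNIV"
  shows "integrable lborel (\<lambda>\<xi>. g \<xi> * test_fourier f (- \<xi>))"
proof -
  let ?F = "\<lambda>\<xi>. test_fourier f (- \<xi>)"
  have [measurable]: "g \<in> borel_measurable borel" using g by (simp add: weighted_L2_def)
  have [measurable]: "f \<in> borel_measurable borel" using f by (rule test_functionD)
  obtain N :: nat where N: "real DIM('b) / 2 - s < real N" using reals_Archimedean2 by blast
  obtain C where C: "\<And>\<xi>. (1 + (norm \<xi>)\<^sup>2) ^ N * norm (?F \<xi>) \<le> C"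
  proof -
    obtain C where "\<forall>\<xi>::'b. (1 + (norm \<xi>)\<^sup>2) ^ N * norm (test_fourier f \<xi>) \<le> C"
      using fourier_test_function_decay[OF f] by blast
    from this[rule_format, of "- _"] show ?thesis by (intro that[of C]) simp
  qed
  have pos: "1 + (norm \<xi>)\<^sup>2 > 0" "1 + (norm \<xi>)\<^sup>2 \<ge> 1" for \<xi> :: 'b
    using add_pos_nonneg[of 1 "(norm \<xi>)\<^sup>2"] by auto
  have ab: "x * y \<le> x\<^sup>2 + y\<^sup>2" if "x \<ge> 0" "y \<ge> 0" for x y :: real
    using sum_squares_bound[of x y] mult_nonneg_nonneg[OF that] by linarith
  have bound: "norm (g \<xi> * ?F \<xi>) \<le> sobolev_density s g \<xi> + C\<^sup>2 * (1 + (norm \<xi>)\<^sup>2) powr (- (s + 2 * real N))" for \<xi>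
  proof -
    let ?w = "1 + (norm \<xi>)\<^sup>2"
    let ?a = "?w powr (s / 2) * cmod (g \<xi>)" and ?b = "?w powr (- (s / 2)) * cmod (?F \<xi>)"
    have "norm (g \<xi> * ?F \<xi>) = ?a * ?b"
    proof -
      have "?w \<noteq> 0" using pos(1)[of \<xi>] by linarith
      then have "?w powr (s / 2) * ?w powr (- (s / 2)) = 1" by (simp flip: powr_add)
      moreover have "?a * ?b = (?w powr (s / 2) * ?w powr (- (s / 2))) * norm (g \<xi> * ?F \<xi>)"
        by (simp only: norm_mult mult_ac)
      ultimately show ?thesis by simp
    qed
    also have "\<dots> \<le> ?a\<^sup>2 + ?b\<^sup>2"
      by (rule ab) auto
    also have "?a\<^sup>2 = sobolev_density s g \<xi>"
      by (simp add: sobolev_density_def power_mult_distrib flip: powr_numeral) (simp add: powr_powr)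
    also have "?b\<^sup>2 \<le> C\<^sup>2 * ?w powr (- (s + 2 * real N))"
    proof -
      have "cmod (?F \<xi>) \<le> C * ?w powr (- real N)"
        using C[of \<xi>] pos(1)[of \<xi>] by (simp add: powr_minus powr_realpow[OF pos(1)] field_simps)
      then have "(cmod (?F \<xi>))\<^sup>2 \<le> (C * ?w powr (- real N))\<^sup>2" by (intro power_mono) auto
      then have "(?w powr (- (s / 2)))\<^sup>2 * (cmod (?F \<xi>))\<^sup>2 \<le> (?w powr (- (s / 2)))\<^sup>2 * (C * ?w powr (- real N))\<^sup>2"
        by (intro mult_left_mono) auto
      also have "\<dots> = C\<^sup>2 * ((?w powr (- (s / 2)))\<^sup>2 * (?w powr (- real N))\<^sup>2)" by (simp add: power_mult_distrib)
      also have "(?w powr (- (s / 2)))\<^sup>2 * (?w powr (- real N))\<^sup>2 = ?w powr (- (s + 2 * real N))"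
        by (simp add: power2_eq_square flip: powr_add)
      finally show ?thesis by (simp add: power_mult_distrib)
    qed
    finally show ?thesis by simp
  qed
  show ?thesis
  proof (rule Bochner_Integration.integrable_bound)
    show "integrable lborel (\<lambda>\<xi>. sobolev_density s g \<xi> + C\<^sup>2 * (1 + (norm \<xi>)\<^sup>2) powr (- (s + 2 * real N)))"
      using g N by (intro Bochner_Integration.integrable_add integrable_mult_right integrable_bracket_powr)
        (auto simp: weighted_L2_def)
    show "AE \<xi> in lborel. norm (g \<xi> * ?F \<xi>) \<le> norm (sobolev_density s g \<xi> + C\<^sup>2 * (1 + (norm \<xi>)\<^sup>2) powr (- (s + 2 * real N)))"
      using bound by (intro AE_I2) (auto simp: sobolev_density_nonneg)
  qed simp
qed

text \<open>The definition is extensional, so that the elements of the Sobolev space are exactly the values of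
  this map on the weighted \<open>L\<^sup>2\<close> space, and the Sobolev distance becomes the weighted distance.\<close>

definition inverse_fourier :: "('b::euclidean_space \<Rightarrow> complex) \<Rightarrow> 'b distribution" where
  "inverse_fourier g = (\<lambda>f\<in>test_functions UNIV.
     (LINT \<xi>|lborel. g \<xi> * test_fourier f (- \<xi>)) / of_real ((2 * pi) ^ DIM('b)))"

lemma has_fourier_transform_inverse:
  "g \<in> weighted_L2 s \<Longrightarrow> has_fourier_transform (inverse_fourier g) g"
  unfolding has_fourier_transform_def inverse_fourier_def
  using weighted_L2_pairing_integrable by (auto simp: weighted_L2_def)

lemma inverse_fourier_in_sobolev_space:
  "g \<in> weighted_L2 s \<Longrightarrow> inverse_fourier g \<in> sobolev_space s"
  using has_fourier_transform_inverse[of g s]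
  by (auto simp: sobolev_space_def weighted_L2_def inverse_fourier_def)

lemma eq_inverse_fourier:
  "T \<in> extensional (test_functions UNIV) \<Longrightarrow> has_fourier_transform T g \<Longrightarrow> T = inverse_fourier g"
  unfolding has_fourier_transform_def inverse_fourier_def
  by (intro ext) (auto simp: extensional_def)

lemma sobolev_spaceE:
  assumes "T \<in> sobolev_space s"
  obtains g where "g \<in> weighted_L2 s" "T = inverse_fourier g"
  using assms eq_inverse_fourier
  by (auto simp: sobolev_space_def weighted_L2_def has_fourier_transform_def)

lemma has_fourier_transform_diff:
  assumes "has_fourier_transform S g" "has_fourier_transform T h"
  shows "has_fourier_transform (\<lambda>f. S f - T f) (\<lambda>\<xi>. g \<xi> - h \<xi>)"
  using assms unfolding has_fourier_transform_def
  by (auto simp: left_diff_distrib diff_divide_distrib)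

lemma has_fourier_transform_swap:
  assumes "has_fourier_transform (\<lambda>f. S f - T f) g"
  shows "has_fourier_transform (\<lambda>f. T f - S f) (\<lambda>\<xi>. - g \<xi>)"
  unfolding has_fourier_transform_def
proof (intro conjI ballI)
  show "(\<lambda>\<xi>. - g \<xi>) \<in> borel_measurable borel" using assms by (simp add: has_fourier_transform_def)
  fix f :: "'a \<Rightarrow> real" assume f: "f \<in> test_functions UNIV"
  then show "integrable lborel (\<lambda>\<xi>. - g \<xi> * test_fourier f (- \<xi>))"
    using assms by (simp add: has_fourier_transform_def)
  have "S f - T f = (LINT \<xi>|lborel. g \<xi> * test_fourier f (- \<xi>)) / of_real ((2 * pi) ^ DIM('a))"
    using assms f unfolding has_fourier_transform_def by blast
  then have "T f - S f = - ((LINT \<xi>|lborel. g \<xi> * test_fourier f (- \<xi>)) / of_real ((2 * pi) ^ DIM('a)))"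
    by (metis minus_diff_eq)
  then show "T f - S f = (LINT \<xi>|lborel. - g \<xi> * test_fourier f (- \<xi>)) / of_real ((2 * pi) ^ DIM('a))"
    by simp
qed

text \<open>Multiplied by the transform of a test function, the difference of two transforms becomes
  integrable, and the transform of the product vanishes because translates of test functions are test
  functions. The transform of a narrow bump has no zeros on a large ball. The mollifier provides
  such a bump, here and in the lemmas on Sobolev spaces below.\<close>

lemma has_fourier_transform_unique:
  fixes T :: "'b::euclidean_space distribution" and \<theta> :: "'b \<Rightarrow> real"
  assumes \<theta>: "mollifier \<theta>" and g: "has_fourier_transform T g" and h: "has_fourier_transform T h"
  shows "AE \<xi> in lborel. g \<xi> = h \<xi>"
proof -
  have \<theta>': "\<theta> \<in> test_functions UNIV" "\<And>x. \<theta> x \<ge> 0" "(LINT x|lborel. \<theta> x) = 1" "\<And>x. norm x > 1 \<Longrightarrow> \<theta> x = 0"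
    using \<theta> by (auto simp: mollifier_def test_functions_def intro!: zero_off_tsupport[of _ \<theta>])
  have [measurable]: "g \<in> borel_measurable borel" "h \<in> borel_measurable borel"
    using g h by (auto simp: has_fourier_transform_def)
  have "AE \<xi> in lborel. norm \<xi> < real (Suc n) \<longrightarrow> g \<xi> = h \<xi>" for n
  proof -
    define c where "c = real (Suc n)"
    have c: "c > 0" by (simp add: c_def)
    define f where "f x = \<theta> (c *\<^sub>R x)" for x
    have f: "f \<in> test_functions UNIV"
      using test_function_affine[OF \<theta>'(1), of c 0] c by (simp add: f_def[abs_def])
    note [measurable] = test_functionD(6)[OF f]
    let ?F = "test_fourier f"
    have mass: "(LINT x|lborel. f x) = 1 / c ^ DIM('b)"
      using lborel_integral_scale[OF test_functionD(6)[OF \<theta>'(1)], of c 0] c \<theta>' by (simp add: f_def)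
    have nz: "?F \<xi> \<noteq> 0" if \<xi>: "norm \<xi> < c" for \<xi>
    proof -
      have sm: "norm (exp (\<i> * of_real (\<xi> \<bullet> x)) * complex_of_real (f x) - of_real (f x)) \<le> norm \<xi> / c * f x" for x
      proof (cases "norm x \<le> 1 / c")
        case True
        have "norm (exp (\<i> * of_real (\<xi> \<bullet> x)) - 1) \<le> \<bar>\<xi> \<bullet> x\<bar>"
          using iexp_approx1[of "\<xi> \<bullet> x" 0] by simp
        also have "\<dots> \<le> norm \<xi> * norm x" by (rule Cauchy_Schwarz_ineq2)
        also have "\<dots> \<le> norm \<xi> * (1 / c)" using True by (intro mult_left_mono) auto
        finally have "norm (exp (\<i> * of_real (\<xi> \<bullet> x)) - 1) * f x \<le> norm \<xi> / c * f x"
          using \<theta>'(2) by (intro mult_right_mono) (auto simp: f_def)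
        moreover have "norm (exp (\<i> * of_real (\<xi> \<bullet> x)) * complex_of_real (f x) - of_real (f x))
          = norm (exp (\<i> * of_real (\<xi> \<bullet> x)) - 1) * f x"
        proof -
          have "exp (\<i> * of_real (\<xi> \<bullet> x)) * complex_of_real (f x) - of_real (f x)
            = (exp (\<i> * of_real (\<xi> \<bullet> x)) - 1) * complex_of_real (f x)" by (simp add: algebra_simps)
          then show ?thesis using \<theta>'(2) by (simp add: norm_mult f_def)
        qed
        ultimately show ?thesis by simp
      next
        case False
        then have "f x = 0" using \<theta>'(4)[of "c *\<^sub>R x"] c by (simp add: f_def field_simps)
        then show ?thesis by simp
      qed
      have fi: "integrable lborel (\<lambda>x. complex_of_real (f x))" using test_functionD(4)[OF f] by simp
      have "norm (?F \<xi> - of_real (1 / c ^ DIM('b))) =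
        norm (LINT x|lborel. exp (\<i> * of_real (\<xi> \<bullet> x)) * complex_of_real (f x) - of_real (f x))"
        using fi integrable_fourier_integrand[OF fi] mass by (simp add: fourier_def)
      also have "\<dots> \<le> (LINT x|lborel. norm \<xi> / c * f x)"
        using sm test_functionD(4)[OF f] fi integrable_fourier_integrand[OF fi, of \<xi>]
        by (intro Bochner_Integration.integral_norm_bound_integral) auto
      also have "\<dots> = norm \<xi> / c * (1 / c ^ DIM('b))" by (simp add: mass)
      also have "\<dots> < 1 * (1 / c ^ DIM('b))" using \<xi> c by (intro mult_strict_right_mono) auto
      finally have "norm (?F \<xi> - of_real (1 / c ^ DIM('b))) < 1 / c ^ DIM('b)" by simp
      then show ?thesis using c by (auto simp: norm_divide norm_power)
    qed
    let ?k = "\<lambda>\<xi>. (g \<xi> - h \<xi>) * ?F (- \<xi>)"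
    have "AE \<xi> in lborel. ?k \<xi> = 0"
    proof (rule AE_zero_if_fourier_zero)
      show "integrable lborel ?k"
        using g h f by (auto simp: has_fourier_transform_def left_diff_distrib)
      fix a :: 'b
      have fa: "(\<lambda>x. f (a + x)) \<in> test_functions UNIV"
        using test_function_affine[OF f, of 1 a] by simp
      have Fa: "fourier (\<lambda>x. complex_of_real (f (a + x))) (- \<xi>) = exp (\<i> * of_real (a \<bullet> \<xi>)) * ?F (- \<xi>)" for \<xi>
        using fourier_translate[of "\<lambda>x. complex_of_real (f x)" a "- \<xi>"] by (simp add: inner_commute)
      have "fourier ?k a = (LINT \<xi>|lborel. g \<xi> * fourier (\<lambda>x. complex_of_real (f (a + x))) (- \<xi>)
          - h \<xi> * fourier (\<lambda>x. complex_of_real (f (a + x))) (- \<xi>))"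
        unfolding fourier_def[of ?k] Fa by (simp add: algebra_simps)
      also have "\<dots> = (LINT \<xi>|lborel. g \<xi> * fourier (\<lambda>x. complex_of_real (f (a + x))) (- \<xi>))
          - (LINT \<xi>|lborel. h \<xi> * fourier (\<lambda>x. complex_of_real (f (a + x))) (- \<xi>))"
        using g h fa by (intro Bochner_Integration.integral_diff) (auto simp: has_fourier_transform_def)
      also have "\<dots> = 0"
        using g h fa by (auto simp: has_fourier_transform_def)
      finally show "fourier ?k a = 0" .
    qed
    then show ?thesis
      by eventually_elim (use nz in \<open>auto simp: c_def\<close>)
  qed
  then have "AE \<xi> in lborel. \<forall>n. norm \<xi> < real (Suc n) \<longrightarrow> g \<xi> = h \<xi>"
    unfolding AE_all_countable by blast
  then show ?thesis
  proof eventually_elim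
    case (elim \<xi>)
    obtain n where "norm \<xi> < real n" using reals_Archimedean2 by blast
    then show ?case using elim[rule_format, of n] by simp
  qed
qed

text \<open>By uniqueness, every Fourier transform of \<open>T\<close> computes the norm, not just the one selected by the
  choice operator.\<close>

lemma sobolev_norm_eq_weighted_norm:
  assumes \<theta>: "mollifier (\<theta> :: 'b::euclidean_space \<Rightarrow> real)" and T: "has_fourier_transform T (g :: 'b \<Rightarrow> complex)"
  shows "sobolev_norm s T = weighted_norm s g"
proof -
  have ft: "has_fourier_transform T (fourier_transform T)"
    unfolding fourier_transform_def by (rule someI[of _ g]) (rule T)
  have "AE \<xi> in lborel. fourier_transform T \<xi> = g \<xi>"
    by (rule has_fourier_transform_unique[OF \<theta> ft T])
  then have "weighted_norm s (fourier_transform T) = weighted_norm s g"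
    using ft T by (intro weighted_norm_cong_AE) (auto simp: has_fourier_transform_def)
  then show ?thesis by (simp add: sobolev_norm_def weighted_norm_def)
qed

lemma sobolev_distance_eq:
  assumes \<theta>: "mollifier (\<theta> :: 'b::euclidean_space \<Rightarrow> real)"
    and g: "(g :: 'b \<Rightarrow> complex) \<in> weighted_L2 s" and h: "h \<in> weighted_L2 s"
  shows "sobolev_norm s (\<lambda>f. inverse_fourier g f - inverse_fourier h f)
    = weighted_norm s (\<lambda>\<xi>. g \<xi> - h \<xi>)"
  by (intro sobolev_norm_eq_weighted_norm[OF \<theta>] has_fourier_transform_diff
      has_fourier_transform_inverse[OF g] has_fourier_transform_inverse[OF h])

lemma inverse_fourier_cong_AE:
  fixes g h :: "'b::euclidean_space \<Rightarrow> complex"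
  assumes "g \<in> borel_measurable borel" "h \<in> borel_measurable borel" "AE \<xi> in lborel. g \<xi> = h \<xi>"
  shows "inverse_fourier g = inverse_fourier h"
  unfolding inverse_fourier_def
proof (intro restrict_ext)
  fix f :: "'b \<Rightarrow> real" assume f: "f \<in> test_functions UNIV"
  note [measurable] = test_functionD(6)[OF f] assms(1,2)
  have "(LINT \<xi>|lborel. g \<xi> * test_fourier f (- \<xi>))
      = (LINT \<xi>|lborel. h \<xi> * test_fourier f (- \<xi>))"
    using assms(3) by (intro integral_cong_AE) auto
  then show "(LINT \<xi>|lborel. g \<xi> * test_fourier f (- \<xi>)) / of_real ((2 * pi) ^ DIM('b))
    = (LINT \<xi>|lborel. h \<xi> * test_fourier f (- \<xi>)) / of_real ((2 * pi) ^ DIM('b))"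
    by simp
qed

lemma Metric_space_sobolev:
  assumes \<theta>: "mollifier (\<theta> :: 'b::euclidean_space \<Rightarrow> real)"
  shows "Metric_space (sobolev_space s :: 'b distribution set) (\<lambda>S T. sobolev_norm s (\<lambda>f. S f - T f))"
proof
  show "0 \<le> sobolev_norm s (\<lambda>f. S f - T f)" for S T :: "'b distribution"
    by (simp add: sobolev_norm_def sobolev_density_nonneg)
  show "sobolev_norm s (\<lambda>f. S f - T f) = sobolev_norm s (\<lambda>f. T f - S f)" for S T :: "'b distribution"
  proof (cases "\<exists>g. has_fourier_transform (\<lambda>f. S f - T f) g")
    case True
    then obtain g where g: "has_fourier_transform (\<lambda>f. S f - T f) g" by blast
    then have "has_fourier_transform (\<lambda>f. T f - S f) (\<lambda>\<xi>. - g \<xi>)" by (rule has_fourier_transform_swap)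
    then show ?thesis
      using g by (simp add: sobolev_norm_eq_weighted_norm[OF \<theta>] weighted_norm_uminus)
  next
    case False
    \<comment> \<open>Without a transform on either side, both norms are the same default value.\<close>
    then have "has_fourier_transform (\<lambda>f. S f - T f) = has_fourier_transform (\<lambda>f. T f - S f)"
      using has_fourier_transform_swap[of T S] by blast
    then show ?thesis by (simp add: sobolev_norm_def fourier_transform_def)
  qed
  fix S T U :: "'b distribution"
  assume S: "S \<in> sobolev_space s" and T: "T \<in> sobolev_space s"
  obtain g where g: "g \<in> weighted_L2 s" "S = inverse_fourier g" using S by (rule sobolev_spaceE)
  obtain h where h: "h \<in> weighted_L2 s" "T = inverse_fourier h" using T by (rule sobolev_spaceE)
  show "sobolev_norm s (\<lambda>f. S f - T f) = 0 \<longleftrightarrow> S = T"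
  proof
    assume "sobolev_norm s (\<lambda>f. S f - T f) = 0"
    then have "AE \<xi> in lborel. g \<xi> - h \<xi> = 0"
      using sobolev_distance_eq[OF \<theta> g(1) h(1)] g h
      by (intro AE_zero_if_weighted_norm_zero[OF weighted_L2_diff[OF g(1) h(1)]]) simp
    then have "AE \<xi> in lborel. g \<xi> = h \<xi>" by simp
    then show "S = T"
      unfolding g(2) h(2) using g(1) h(1)
      by (intro inverse_fourier_cong_AE) (auto simp: weighted_L2_def)
  next
    assume "S = T"
    then show "sobolev_norm s (\<lambda>f. S f - T f) = 0"
      using sobolev_distance_eq[OF \<theta> g(1) g(1)] g
      by (simp add: weighted_norm_def sobolev_density_def)
  qed
  assume U: "U \<in> sobolev_space s"
  obtain k where k: "k \<in> weighted_L2 s" "U = inverse_fourier k" using U by (rule sobolev_spaceE)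
  show "sobolev_norm s (\<lambda>f. S f - U f) \<le> sobolev_norm s (\<lambda>f. S f - T f) + sobolev_norm s (\<lambda>f. T f - U f)"
    using weighted_norm_add_le[OF weighted_L2_diff[OF g(1) h(1)] weighted_L2_diff[OF h(1) k(1)]]
    unfolding g(2) h(2) k(2)
    by (simp add: sobolev_distance_eq[OF \<theta>] g(1) h(1) k(1))
qed

text \<open>As in the Riesz-Fischer theorem, a sequence with \<open>\<parallel>g\<^sub>n\<^sub>+\<^sub>1 - g\<^sub>n\<parallel>\<^sup>2 \<le> 8\<^sup>-\<^sup>n\<close> converges almost everywhere, since
  \<open>\<Sum>\<^sub>n 4\<^sup>n |g\<^sub>n\<^sub>+\<^sub>1 - g\<^sub>n|\<^sup>2\<close> has a finite integral, and Fatou's lemma gives convergence in norm.\<close>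

lemma weighted_L2_limit:
  fixes g :: "nat \<Rightarrow> 'b::euclidean_space \<Rightarrow> complex"
  assumes g: "\<And>n. g n \<in> weighted_L2 s"
    and small: "\<And>n. (weighted_norm s (\<lambda>\<xi>. g (Suc n) \<xi> - g n \<xi>))\<^sup>2 \<le> (1 / 8) ^ n"
    and cauchy: "\<And>e. e > 0 \<Longrightarrow> \<exists>N. \<forall>m\<ge>N. \<forall>n\<ge>N. weighted_norm s (\<lambda>\<xi>. g m \<xi> - g n \<xi>) < e"
  shows "\<exists>h\<in>weighted_L2 s. (\<lambda>n. weighted_norm s (\<lambda>\<xi>. g n \<xi> - h \<xi>)) \<longlonglongrightarrow> 0"
proof -
  have [measurable]: "g n \<in> borel_measurable borel" for n
    using g by (simp add: weighted_L2_def)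
  have nn: "(\<integral>\<^sup>+\<xi>. ennreal (sobolev_density s (\<lambda>\<xi>. g m \<xi> - g n \<xi>) \<xi>) \<partial>lborel)
      = ennreal ((weighted_norm s (\<lambda>\<xi>. g m \<xi> - g n \<xi>))\<^sup>2)" for m n
    using weighted_L2_diff[OF g g, of m n] unfolding weighted_norm_square
    by (intro nn_integral_eq_integral) (auto simp: weighted_L2_def sobolev_density_nonneg)
  let ?d = "\<lambda>n \<xi>. sobolev_density s (\<lambda>\<xi>. g (Suc n) \<xi> - g n \<xi>) \<xi>"
  have "(\<integral>\<^sup>+\<xi>. (\<Sum>n. ennreal (4 ^ n * ?d n \<xi>)) \<partial>lborel) = (\<Sum>n. \<integral>\<^sup>+\<xi>. ennreal (4 ^ n * ?d n \<xi>) \<partial>lborel)"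
    by (rule nn_integral_suminf) measurable
  also have "\<dots> = (\<Sum>n. ennreal (4 ^ n * (weighted_norm s (\<lambda>\<xi>. g (Suc n) \<xi> - g n \<xi>))\<^sup>2))"
    by (intro suminf_cong) (simp add: ennreal_mult sobolev_density_nonneg nn_integral_cmult nn)
  also have "\<dots> \<le> (\<Sum>n. ennreal ((1 / 2) ^ n))"
  proof (intro suminf_le ennreal_leI summableI)
    fix n
    have "4 ^ n * (weighted_norm s (\<lambda>\<xi>. g (Suc n) \<xi> - g n \<xi>))\<^sup>2 \<le> 4 ^ n * (1 / 8) ^ n"
      using small by (intro mult_left_mono) auto
    also have "\<dots> = (1 / 2) ^ n" by (simp flip: power_mult_distrib)
    finally show "4 ^ n * (weighted_norm s (\<lambda>\<xi>. g (Suc n) \<xi> - g n \<xi>))\<^sup>2 \<le> (1 / 2) ^ n" .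
  qed
  also have "\<dots> < \<infinity>"
    by (subst suminf_ennreal2) (auto simp: summable_geometric)
  finally have "AE \<xi> in lborel. (\<Sum>n. ennreal (4 ^ n * ?d n \<xi>)) \<noteq> \<infinity>"
    by (intro nn_integral_PInf_AE) auto
  then have conv: "AE \<xi> in lborel. convergent (\<lambda>n. g n \<xi>)"
  proof eventually_elim
    case (elim \<xi>)
    have "summable (\<lambda>n. 4 ^ n * ?d n \<xi>)"
      using elim by (intro summable_suminf_not_top) (auto simp: sobolev_density_nonneg)
    then have "(\<lambda>n. 4 ^ n * ?d n \<xi>) \<longlonglongrightarrow> 0" by (rule summable_LIMSEQ_zero)
    then have "Bseq (\<lambda>n. 4 ^ n * ?d n \<xi>)" by (intro convergent_imp_Bseq convergentI)
    then obtain B where B: "B > 0" "\<And>n. 4 ^ n * ?d n \<xi> \<le> B"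
      unfolding Bseq_def by (auto simp: sobolev_density_nonneg abs_mult)
    let ?w = "(1 + (norm \<xi>)\<^sup>2) powr s"
    have w: "?w > 0" using add_pos_nonneg[of 1 "(norm \<xi>)\<^sup>2"] by simp
    have le: "norm (g (Suc n) \<xi> - g n \<xi>) \<le> sqrt (B / ?w) * (1 / 2) ^ n" for n
    proof (rule power2_le_imp_le)
      have "(2 ^ n * norm (g (Suc n) \<xi> - g n \<xi>))\<^sup>2 = 4 ^ n * (norm (g (Suc n) \<xi> - g n \<xi>))\<^sup>2"
        by (simp add: power_mult_distrib power2_eq_square[of "2 ^ n"] flip: power_mult_distrib[of 2 2])
      then have "?w * (2 ^ n * norm (g (Suc n) \<xi> - g n \<xi>))\<^sup>2 \<le> B"
        using B(2)[of n] by (simp add: sobolev_density_def mult_ac)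
      then have "(2 ^ n * norm (g (Suc n) \<xi> - g n \<xi>))\<^sup>2 \<le> B / ?w"
        using w by (simp add: field_simps)
      then show "(norm (g (Suc n) \<xi> - g n \<xi>))\<^sup>2 \<le> (sqrt (B / ?w) * (1 / 2) ^ n)\<^sup>2"
        using B w by (simp add: power_mult_distrib field_simps)
      show "0 \<le> sqrt (B / ?w) * (1 / 2) ^ n" using B w by simp
    qed
    have "summable (\<lambda>n. g (Suc n) \<xi> - g n \<xi>)"
      by (rule summable_comparison_test'[of "\<lambda>n. sqrt (B / ?w) * (1 / 2) ^ n" 0])
        (use le in \<open>auto intro!: summable_mult summable_geometric\<close>)
    then have "convergent (\<lambda>n. \<Sum>i<n. g (Suc i) \<xi> - g i \<xi>)"
      by (simp add: summable_iff_convergent)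
    then have "convergent (\<lambda>n. (\<Sum>i<n. g (Suc i) \<xi> - g i \<xi>) + g 0 \<xi>)"
      by (intro convergent_add convergent_const)
    then show ?case by (simp add: sum_lessThan_telescope[of "\<lambda>i. g i \<xi>"])
  qed
  define h where "h \<xi> = lim (\<lambda>n. g n \<xi>)" for \<xi>
  have [measurable]: "h \<in> borel_measurable borel" unfolding h_def[abs_def] by measurable
  have lim: "AE \<xi> in lborel. (\<lambda>n. g n \<xi>) \<longlonglongrightarrow> h \<xi>"
    using conv by eventually_elim (simp add: h_def convergent_LIMSEQ_iff)
  have fatou: "(\<integral>\<^sup>+\<xi>. ennreal (sobolev_density s (\<lambda>\<xi>. g n \<xi> - h \<xi>) \<xi>) \<partial>lborel) \<le> ennreal (e\<^sup>2)"
    if N: "\<forall>m\<ge>N. weighted_norm s (\<lambda>\<xi>. g n \<xi> - g m \<xi>) < e" for n N e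
  proof -
    have "(\<integral>\<^sup>+\<xi>. ennreal (sobolev_density s (\<lambda>\<xi>. g n \<xi> - h \<xi>) \<xi>) \<partial>lborel)
      = (\<integral>\<^sup>+\<xi>. liminf (\<lambda>m. ennreal (sobolev_density s (\<lambda>\<xi>. g n \<xi> - g m \<xi>) \<xi>)) \<partial>lborel)"
    proof (rule nn_integral_cong_AE)
      show "AE \<xi> in lborel. ennreal (sobolev_density s (\<lambda>\<xi>. g n \<xi> - h \<xi>) \<xi>)
        = liminf (\<lambda>m. ennreal (sobolev_density s (\<lambda>\<xi>. g n \<xi> - g m \<xi>) \<xi>))"
        using lim
      proof eventually_elim
        case (elim \<xi>)
        then have "(\<lambda>m. ennreal (sobolev_density s (\<lambda>\<xi>. g n \<xi> - g m \<xi>) \<xi>))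
          \<longlonglongrightarrow> ennreal (sobolev_density s (\<lambda>\<xi>. g n \<xi> - h \<xi>) \<xi>)"
          unfolding sobolev_density_def by (intro tendsto_intros)
        then show ?case by (intro lim_imp_Liminf[symmetric]) auto
      qed
    qed
    also have "\<dots> \<le> liminf (\<lambda>m. \<integral>\<^sup>+\<xi>. ennreal (sobolev_density s (\<lambda>\<xi>. g n \<xi> - g m \<xi>) \<xi>) \<partial>lborel)"
      by (rule nn_integral_liminf) measurable
    also have "\<dots> \<le> limsup (\<lambda>m. \<integral>\<^sup>+\<xi>. ennreal (sobolev_density s (\<lambda>\<xi>. g n \<xi> - g m \<xi>) \<xi>) \<partial>lborel)"
      by (rule Liminf_le_Limsup) simp
    also have "\<dots> \<le> ennreal (e\<^sup>2)"
      unfolding nn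
    proof (rule Limsup_bounded, rule eventually_sequentiallyI[of N])
      fix m assume "m \<ge> N"
      then have "weighted_norm s (\<lambda>\<xi>. g n \<xi> - g m \<xi>) \<le> e" using N by (simp add: less_imp_le)
      then show "ennreal ((weighted_norm s (\<lambda>\<xi>. g n \<xi> - g m \<xi>))\<^sup>2) \<le> ennreal (e\<^sup>2)"
        by (intro ennreal_leI power_mono weighted_norm_nonneg)
    qed
    finally show ?thesis .
  qed
  have diff: "(\<lambda>\<xi>. g n \<xi> - h \<xi>) \<in> weighted_L2 s"
    if "\<forall>m\<ge>N. weighted_norm s (\<lambda>\<xi>. g n \<xi> - g m \<xi>) < e" for n N e
  proof -
    have "integrable lborel (sobolev_density s (\<lambda>\<xi>. g n \<xi> - h \<xi>))"
      using fatou[OF that] by (intro integrableI_bounded)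
        (auto simp: sobolev_density_nonneg intro: le_less_trans)
    then show ?thesis by (simp add: weighted_L2_def)
  qed
  obtain N where N: "\<forall>m\<ge>N. \<forall>n\<ge>N. weighted_norm s (\<lambda>\<xi>. g m \<xi> - g n \<xi>) < 1"
    using cauchy[of 1] by auto
  have "(\<lambda>\<xi>. g N \<xi> - h \<xi>) \<in> weighted_L2 s"
    using N by (intro diff[of N N 1]) auto
  from weighted_L2_diff[OF g[of N] this] have h: "h \<in> weighted_L2 s" by simp
  have "(\<lambda>n. weighted_norm s (\<lambda>\<xi>. g n \<xi> - h \<xi>)) \<longlonglongrightarrow> 0"
  proof (rule LIMSEQ_I)
    fix e :: real assume e: "e > 0"
    obtain N where N: "\<forall>m\<ge>N. \<forall>n\<ge>N. weighted_norm s (\<lambda>\<xi>. g m \<xi> - g n \<xi>) < e / 2"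
      using cauchy[of "e / 2"] e by auto
    have "norm (weighted_norm s (\<lambda>\<xi>. g n \<xi> - h \<xi>) - 0) < e" if n: "n \<ge> N" for n
    proof -
      have *: "\<forall>m\<ge>N. weighted_norm s (\<lambda>\<xi>. g n \<xi> - g m \<xi>) < e / 2" using N n by auto
      have "ennreal ((weighted_norm s (\<lambda>\<xi>. g n \<xi> - h \<xi>))\<^sup>2)
        = (\<integral>\<^sup>+\<xi>. ennreal (sobolev_density s (\<lambda>\<xi>. g n \<xi> - h \<xi>) \<xi>) \<partial>lborel)"
        using diff[OF *] unfolding weighted_norm_square
        by (intro nn_integral_eq_integral[symmetric]) (auto simp: weighted_L2_def sobolev_density_nonneg)
      also have "\<dots> \<le> ennreal ((e / 2)\<^sup>2)" by (rule fatou[OF *])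
      finally have "(weighted_norm s (\<lambda>\<xi>. g n \<xi> - h \<xi>))\<^sup>2 \<le> (e / 2)\<^sup>2" by simp
      then have "weighted_norm s (\<lambda>\<xi>. g n \<xi> - h \<xi>) \<le> e / 2" by (rule power2_le_imp_le) (use e in simp)
      then show ?thesis using e weighted_norm_nonneg[of s "\<lambda>\<xi>. g n \<xi> - h \<xi>"] by simp
    qed
    then show "\<exists>N. \<forall>n\<ge>N. norm (weighted_norm s (\<lambda>\<xi>. g n \<xi> - h \<xi>) - 0) < e" by blast
  qed
  with h show ?thesis by blast
qed

lemma mcomplete_sobolev:
  assumes \<theta>: "mollifier (\<theta> :: 'b::euclidean_space \<Rightarrow> real)"
  shows "Metric_space.mcomplete (sobolev_space s :: 'b distribution set) (\<lambda>S T. sobolev_norm s (\<lambda>f. S f - T f))"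
proof -
  let ?d = "\<lambda>S T :: 'b distribution. sobolev_norm s (\<lambda>f. S f - T f)"
  interpret Metric_space "sobolev_space s :: 'b distribution set" ?d
    by (rule Metric_space_sobolev[OF \<theta>])
  show ?thesis
    unfolding mcomplete_def
  proof (intro allI impI)
    fix T :: "nat \<Rightarrow> 'b distribution" assume T: "MCauchy T"
    have "\<forall>n. \<exists>g. g \<in> weighted_L2 s \<and> T n = inverse_fourier g"
    proof
      fix n
      have "T n \<in> sobolev_space s" using T by (auto simp: MCauchy_def)
      then show "\<exists>g. g \<in> weighted_L2 s \<and> T n = inverse_fourier g" by (rule sobolev_spaceE) blast
    qed
    from choice[OF this] obtain g where g: "\<And>n. g n \<in> weighted_L2 s" "\<And>n. T n = inverse_fourier (g n)"
      by blast
    have dist: "?d (T m) (T n) = weighted_norm s (\<lambda>\<xi>. g m \<xi> - g n \<xi>)" for m n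
      unfolding g(2) by (rule sobolev_distance_eq[OF \<theta> g(1) g(1)])
    have cauchy: "\<exists>N. \<forall>m\<ge>N. \<forall>n\<ge>N. weighted_norm s (\<lambda>\<xi>. g m \<xi> - g n \<xi>) < e" if "e > 0" for e
    proof -
      have "\<forall>e>0. \<exists>N. \<forall>m n. N \<le> m \<longrightarrow> N \<le> n \<longrightarrow> weighted_norm s (\<lambda>\<xi>. g m \<xi> - g n \<xi>) < e"
        using T unfolding MCauchy_def dist by (rule conjunct2)
      with that show ?thesis by meson
    qed
    have "\<forall>n. \<exists>N. \<forall>m\<ge>N. \<forall>n'\<ge>N. weighted_norm s (\<lambda>\<xi>. g m \<xi> - g n' \<xi>) < sqrt ((1 / 8) ^ n)"
      by (intro allI cauchy) simp
    from choice[OF this] obtain N where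
      N: "\<And>n m n'. m \<ge> N n \<Longrightarrow> n' \<ge> N n \<Longrightarrow> weighted_norm s (\<lambda>\<xi>. g m \<xi> - g n' \<xi>) < sqrt ((1 / 8) ^ n)"
      by blast
    define r where "r = rec_nat (N 0) (\<lambda>n k. Suc (max k (N (Suc n))))"
    have rS: "r (Suc n) = Suc (max (r n) (N (Suc n)))" for n by (simp add: r_def)
    have r: "strict_mono r" by (rule strict_monoI_Suc) (simp add: rS)
    have rN: "r n \<ge> N n" for n by (cases n) (auto simp: r_def)
    have "\<exists>h\<in>weighted_L2 s. (\<lambda>n. weighted_norm s (\<lambda>\<xi>. g (r n) \<xi> - h \<xi>)) \<longlonglongrightarrow> 0"
    proof (rule weighted_L2_limit)
      show "g (r n) \<in> weighted_L2 s" for n by (rule g)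
      show "(weighted_norm s (\<lambda>\<xi>. g (r (Suc n)) \<xi> - g (r n) \<xi>))\<^sup>2 \<le> (1 / 8) ^ n" for n
      proof -
        have "r (Suc n) \<ge> N n" using rN[of n] by (simp add: rS)
        then have "weighted_norm s (\<lambda>\<xi>. g (r (Suc n)) \<xi> - g (r n) \<xi>) \<le> sqrt ((1 / 8) ^ n)"
          using N rN by (intro less_imp_le) auto
        then have "(weighted_norm s (\<lambda>\<xi>. g (r (Suc n)) \<xi> - g (r n) \<xi>))\<^sup>2 \<le> (sqrt ((1 / 8) ^ n))\<^sup>2"
          by (intro power_mono weighted_norm_nonneg)
        then show ?thesis by simp
      qed
      show "\<exists>N. \<forall>m\<ge>N. \<forall>n\<ge>N. weighted_norm s (\<lambda>\<xi>. g (r m) \<xi> - g (r n) \<xi>) < e" if e: "e > 0" for e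
      proof -
        obtain N where "\<forall>m\<ge>N. \<forall>n\<ge>N. weighted_norm s (\<lambda>\<xi>. g m \<xi> - g n \<xi>) < e" using cauchy[OF e] by blast
        moreover have "r n \<ge> n" for n using r by (rule strict_mono_imp_increasing)
        ultimately show ?thesis by (meson order_trans)
      qed
    qed
    then obtain h where h: "h \<in> weighted_L2 s" "(\<lambda>n. weighted_norm s (\<lambda>\<xi>. g (r n) \<xi> - h \<xi>)) \<longlonglongrightarrow> 0" by blast
    have "limitin mtopology (T \<circ> r) (inverse_fourier h) sequentially"
      unfolding limit_metric_sequentially
    proof (intro conjI allI impI)
      show "inverse_fourier h \<in> sobolev_space s"
        by (rule inverse_fourier_in_sobolev_space[OF h(1)])
      fix e :: real assume "e > 0"
      then obtain N where "\<forall>n\<ge>N. weighted_norm s (\<lambda>\<xi>. g (r n) \<xi> - h \<xi>) < e"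
        using order_tendstoD(2)[OF h(2)] by (auto simp: eventually_sequentially)
      then show "\<exists>N. \<forall>n\<ge>N. (T \<circ> r) n \<in> sobolev_space s \<and> ?d ((T \<circ> r) n) (inverse_fourier h) < e"
        by (auto simp: g sobolev_distance_eq[OF \<theta> g(1) h(1)] intro!: inverse_fourier_in_sobolev_space)
    qed
    then show "\<exists>x. limitin mtopology T x sequentially"
      using MCauchy_convergent_subsequence[OF T r] by blast
  qed
qed

section \<open>Tightness from second moments of the Fourier transform\<close>

definition grid :: "nat \<Rightarrow> 'b::euclidean_space \<Rightarrow> 'b" where
  "grid n \<xi> = (\<Sum>b\<in>Basis. (of_int \<lfloor>real n * (\<xi> \<bullet> b)\<rfloor> / real n) *\<^sub>R b)"

definition grid_points :: "nat \<Rightarrow> 'b::euclidean_space set" where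
  "grid_points n = grid n ` cball 0 (real n)"

text \<open>The function \<open>\<xi> \<mapsto> c (grid n \<xi>)\<close> on the ball of radius \<open>n\<close>, and \<open>0\<close> outside. It is written as a finite
  sum over cells so that it is measurable for arbitrary \<open>c\<close>.\<close>

definition step :: "nat \<Rightarrow> ('b::euclidean_space \<Rightarrow> complex) \<Rightarrow> 'b \<Rightarrow> complex" where
  "step n c \<xi> = (\<Sum>p\<in>grid_points n. c p * indicator {\<xi>. norm \<xi> \<le> real n \<and> grid n \<xi> = p} \<xi>)"

definition rnd :: "nat \<Rightarrow> complex \<Rightarrow> complex" where
  "rnd n z = Complex (of_int \<lfloor>real n * Re z\<rfloor> / real n) (of_int \<lfloor>real n * Im z\<rfloor> / real n)"


abbreviation sample :: "nat \<Rightarrow> ('b::euclidean_space \<Rightarrow> complex) \<Rightarrow> 'b \<Rightarrow> complex" where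
  "sample n g \<equiv> step n (\<lambda>p. rnd n (g p))"

lemma floor_div_le: "n > 0 \<Longrightarrow> \<bar>t - of_int \<lfloor>real n * t\<rfloor> / real n\<bar> \<le> 1 / real n"
proof -
  assume n: "n > 0"
  have "\<bar>t - of_int \<lfloor>real n * t\<rfloor> / real n\<bar> = \<bar>real n * t - of_int \<lfloor>real n * t\<rfloor>\<bar> / real n"
    using n by (simp add: field_simps abs_if)
  also have "\<dots> \<le> 1 / real n"
    using n by (intro divide_right_mono) linarith+
  finally show ?thesis .
qed

lemma norm_minus_grid_le:
  fixes \<xi> :: "'b::euclidean_space"
  assumes "n > 0"
  shows "norm (\<xi> - grid n \<xi>) \<le> real DIM('b) / real n"
proof -
  have "norm (\<xi> - grid n \<xi>) \<le> (\<Sum>b\<in>Basis. \<bar>(\<xi> - grid n \<xi>) \<bullet> b\<bar>)" by (rule norm_le_l1)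
  also have "\<dots> \<le> (\<Sum>b\<in>(Basis::'b set). 1 / real n)"
    using floor_div_le[OF assms] by (intro sum_mono) (simp add: grid_def inner_diff_left)
  finally show ?thesis by simp
qed

lemma norm_minus_rnd_le:
  assumes "n > 0"
  shows "norm (z - rnd n z) \<le> 2 / real n"
proof -
  have "norm (z - rnd n z) \<le> \<bar>Re (z - rnd n z)\<bar> + \<bar>Im (z - rnd n z)\<bar>" by (rule cmod_le)
  also have "\<dots> \<le> 1 / real n + 1 / real n"
    using floor_div_le[OF assms, of "Re z"] floor_div_le[OF assms, of "Im z"] by (intro add_mono) (simp_all add: rnd_def)
  finally show ?thesis by simp
qed

lemma measurable_grid[measurable]: "grid n \<in> borel_measurable borel"
  unfolding grid_def[abs_def] by measurable

lemma measurable_rnd[measurable]: "rnd n \<in> borel_measurable borel"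
proof -
  have "rnd n = (\<lambda>z. of_real (of_int \<lfloor>real n * Re z\<rfloor> / real n) + \<i> * of_real (of_int \<lfloor>real n * Im z\<rfloor> / real n))"
    by (rule ext) (simp add: rnd_def complex_eq_iff)
  then show ?thesis by simp
qed

lemma floor_in_range: "\<bar>t\<bar> \<le> of_int m \<Longrightarrow> \<lfloor>t\<rfloor> \<in> {- m .. m}"
  by (auto simp: le_floor_iff abs_le_iff floor_le_iff)

lemma finite_grid_points: "finite (grid_points n :: 'b::euclidean_space set)"
proof -
  let ?m = "int (n * n)"
  have "(grid_points n :: 'b set) \<subseteq> (\<lambda>f. \<Sum>b\<in>Basis. (of_int (f b) / real n) *\<^sub>R b) ` (PiE Basis (\<lambda>_. {- ?m .. ?m}))"
  proof
    fix p :: 'b assume "p \<in> grid_points n"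
    then obtain \<xi> where \<xi>: "norm \<xi> \<le> real n" "p = grid n \<xi>" by (auto simp: grid_points_def)
    have "\<lfloor>real n * (\<xi> \<bullet> b)\<rfloor> \<in> {- ?m .. ?m}" if "b \<in> Basis" for b
    proof (rule floor_in_range)
      have "\<bar>\<xi> \<bullet> b\<bar> \<le> real n" using Basis_le_norm[OF that, of \<xi>] \<xi> by linarith
      then show "\<bar>real n * (\<xi> \<bullet> b)\<bar> \<le> of_int ?m" by (simp add: abs_mult mult_left_mono)
    qed
    then have "restrict (\<lambda>b. \<lfloor>real n * (\<xi> \<bullet> b)\<rfloor>) Basis \<in> PiE Basis (\<lambda>_. {- ?m .. ?m})" by auto
    moreover have "p = (\<Sum>b\<in>Basis. (of_int (restrict (\<lambda>b. \<lfloor>real n * (\<xi> \<bullet> b)\<rfloor>) Basis b) / real n) *\<^sub>R b)"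
      unfolding \<xi>(2) grid_def by (intro sum.cong) auto
    ultimately show "p \<in> (\<lambda>f. \<Sum>b\<in>Basis. (of_int (f b) / real n) *\<^sub>R b) ` (PiE Basis (\<lambda>_. {- ?m .. ?m}))" by blast
  qed
  then show ?thesis by (rule finite_subset) (auto intro!: finite_PiE)
qed

lemma finite_rnd_bounded: "finite {rnd n z |z. norm z \<le> B}"
proof -
  define m where "m = \<lceil>real n * B\<rceil>"
  have "{rnd n z |z. norm z \<le> B} \<subseteq> (\<lambda>(i, j). Complex (of_int i / real n) (of_int j / real n)) ` ({- m .. m} \<times> {- m .. m})"
  proof clarify
    fix z :: complex assume z: "norm z \<le> B"
    have "\<bar>real n * t\<bar> \<le> of_int m" if "\<bar>t\<bar> \<le> norm z" for t
    proof -
      have "\<bar>real n * t\<bar> \<le> real n * B" using that z by (simp add: abs_mult mult_left_mono)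
      then show ?thesis unfolding m_def by linarith
    qed
    then have "\<lfloor>real n * Re z\<rfloor> \<in> {- m .. m}" "\<lfloor>real n * Im z\<rfloor> \<in> {- m .. m}"
      by (intro floor_in_range; simp add: abs_Re_le_cmod abs_Im_le_cmod)+
    then show "rnd n z \<in> (\<lambda>(i, j). Complex (of_int i / real n) (of_int j / real n)) ` ({- m .. m} \<times> {- m .. m})"
      unfolding rnd_def by (intro image_eqI[of _ _ "(\<lfloor>real n * Re z\<rfloor>, \<lfloor>real n * Im z\<rfloor>)"]) auto
  qed
  then show ?thesis by (rule finite_subset) simp
qed

lemma countable_range_rnd: "countable (range (rnd n))"
proof -
  have "range (rnd n) \<subseteq> range (\<lambda>(i :: int, j :: int). Complex (of_int i / real n) (of_int j / real n))"
    by (auto simp: rnd_def intro!: image_eqI[of _ _ "(\<lfloor>real n * Re _\<rfloor>, \<lfloor>real n * Im _\<rfloor>)"])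
  then show ?thesis by (rule countable_subset) simp
qed

lemma measurable_step[measurable]: "step n c \<in> borel_measurable borel"
  unfolding step_def[abs_def] by measurable

lemma step_inside: "norm \<xi> \<le> real n \<Longrightarrow> step n c \<xi> = c (grid n \<xi>)"
proof -
  assume \<xi>: "norm \<xi> \<le> real n"
  then have p: "grid n \<xi> \<in> grid_points n" by (auto simp: grid_points_def)
  have "step n c \<xi> = (\<Sum>p\<in>grid_points n. if p = grid n \<xi> then c p else 0)"
    unfolding step_def using \<xi> by (intro sum.cong) (auto simp: indicator_def)
  then show ?thesis using p by (simp add: finite_grid_points)
qed

lemma step_outside: "\<not> norm \<xi> \<le> real n \<Longrightarrow> step n c \<xi> = 0"
  by (simp add: step_def)

lemma step_restrict: "step n (restrict c (grid_points n)) = step n c"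
  by (rule ext) (auto simp: step_def intro!: sum.cong)

lemma bounded_in_weighted_L2:
  fixes g :: "'b::euclidean_space \<Rightarrow> complex"
  assumes [measurable]: "g \<in> borel_measurable borel" and B: "\<And>\<xi>. norm (g \<xi>) \<le> B"
    and u: "u > real DIM('b) / 2"
  shows "g \<in> weighted_L2 (- u)"
proof -
  have "integrable lborel (sobolev_density (- u) g)"
  proof (rule Bochner_Integration.integrable_bound)
    show "integrable lborel (\<lambda>\<xi>. B\<^sup>2 * (1 + (norm (\<xi>::'b))\<^sup>2) powr (- u))"
      using integrable_bracket_powr[OF u] by simp
    show "AE \<xi> in lborel. norm (sobolev_density (- u) g \<xi>) \<le> norm (B\<^sup>2 * (1 + (norm \<xi>)\<^sup>2) powr (- u))"
      using B by (intro AE_I2) (auto simp: sobolev_density_def mult.commute intro!: mult_right_mono power_mono)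
  qed simp
  then show ?thesis by (simp add: weighted_L2_def)
qed

lemma step_in_weighted_L2:
  "u > real DIM('b) / 2 \<Longrightarrow> step n (c :: 'b::euclidean_space \<Rightarrow> complex) \<in> weighted_L2 (- u)"
proof (rule bounded_in_weighted_L2[where B="\<Sum>p\<in>grid_points n. norm (c p)"])
  fix \<xi> :: 'b
  show "norm (step n c \<xi>) \<le> (\<Sum>p\<in>grid_points n. norm (c p))"
    unfolding step_def by (rule sum_norm_le) (auto simp: norm_mult indicator_def)
qed measurable

lemma norm_step_rnd_minus_le:
  fixes g :: "'b::euclidean_space \<Rightarrow> complex"
  assumes n: "n > 0"
  shows "(norm (sample n g \<xi> - g \<xi>))\<^sup>2 \<le>
    (if norm \<xi> \<le> real n then 8 / (real n)\<^sup>2 + 2 * (norm (g (grid n \<xi>) - g \<xi>))\<^sup>2 else (norm (g \<xi>))\<^sup>2)"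
proof (cases "norm \<xi> \<le> real n")
  case True
  let ?a = "norm (rnd n (g (grid n \<xi>)) - g (grid n \<xi>))" and ?b = "norm (g (grid n \<xi>) - g \<xi>)"
  have "norm (rnd n (g (grid n \<xi>)) - g \<xi>) \<le> ?a + ?b"
    using norm_triangle_ineq[of "rnd n (g (grid n \<xi>)) - g (grid n \<xi>)" "g (grid n \<xi>) - g \<xi>"] by simp
  then have "(norm (rnd n (g (grid n \<xi>)) - g \<xi>))\<^sup>2 \<le> (?a + ?b)\<^sup>2" by (intro power_mono) auto
  also have "\<dots> \<le> 2 * ?a\<^sup>2 + 2 * ?b\<^sup>2"
    using sum_squares_bound[of ?a ?b] by (simp add: power2_sum)
  also have "?a\<^sup>2 \<le> (2 / real n)\<^sup>2"
    using norm_minus_rnd_le[OF n, of "g (grid n \<xi>)"] by (intro power_mono) (auto simp: norm_minus_commute)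
  finally show ?thesis using True by (simp add: step_inside power_divide)
qed (simp add: step_outside)

text \<open>The transforms are close in mean square to the step functions of their rounded samples: inside the
  ball of radius \<open>n\<close> by the bound on increments, outside because the weight has a small tail. By
  Chebyshev's inequality at finitely many grid points the samples stay in a bounded set with high
  probability, and then only finitely many step functions occur. The bounds for a single \<open>\<omega>\<close> may
  depend on \<open>\<omega>\<close> and \<open>i\<close>: they serve only to place each sample path in the closure of the countable set
  of step functions.\<close>

lemma tight_family_sobolev:
  fixes g :: "'i \<Rightarrow> 'w \<Rightarrow> 'b::euclidean_space \<Rightarrow> complex"
  assumes P: "prob_space P" and \<theta>: "mollifier (\<theta> :: 'b \<Rightarrow> real)" and u: "u > real DIM('b) / 2"
    and meas: "\<And>i. i \<in> I \<Longrightarrow> (\<lambda>(\<omega>, \<xi>). g i \<omega> \<xi>) \<in> borel_measurable (P \<Otimes>\<^sub>M borel)"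
    and bdd: "\<And>i \<omega>. i \<in> I \<Longrightarrow> \<omega> \<in> space P \<Longrightarrow> \<exists>B. \<forall>\<xi>. norm (g i \<omega> \<xi>) \<le> B"
    and lip: "\<And>i \<omega>. i \<in> I \<Longrightarrow> \<omega> \<in> space P \<Longrightarrow> \<exists>B. \<forall>\<xi> \<xi>'. norm (g i \<omega> \<xi> - g i \<omega> \<xi>') \<le> B * norm (\<xi> - \<xi>')"
    and mom: "\<And>i \<xi>. i \<in> I \<Longrightarrow> (\<integral>\<^sup>+\<omega>. ennreal ((norm (g i \<omega> \<xi>))\<^sup>2) \<partial>P) \<le> ennreal C"
    and inc: "\<And>i \<xi> \<xi>'. i \<in> I \<Longrightarrow> (\<integral>\<^sup>+\<omega>. ennreal ((norm (g i \<omega> \<xi> - g i \<omega> \<xi>'))\<^sup>2) \<partial>P) \<le> ennreal (C * (norm (\<xi> - \<xi>'))\<^sup>2)"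
    and C: "C \<ge> 0"
  shows "tight_family P (sobolev_topology (- u)) I (\<lambda>i \<omega>. inverse_fourier (g i \<omega>))"
proof -
  interpret prob_space P by fact
  let ?d = "\<lambda>S T :: 'b distribution. sobolev_norm (- u) (\<lambda>f. S f - T f)"
  interpret M: Metric_space "sobolev_space (- u) :: 'b distribution set" ?d
    by (rule Metric_space_sobolev[OF \<theta>])
  define w where "w \<xi> = (1 + (norm (\<xi>::'b))\<^sup>2) powr (- u)" for \<xi>
  have w0: "w \<xi> \<ge> 0" for \<xi> by (simp add: w_def)
  have wi: "integrable lborel w" unfolding w_def[abs_def] by (rule integrable_bracket_powr[OF u])
  have [measurable]: "w \<in> borel_measurable borel" unfolding w_def by measurable
  define W where "W = (LINT \<xi>|lborel. w \<xi>)"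
  define tail where "tail n = (LINT \<xi>|lborel. w \<xi> * indicator {\<xi>. \<not> norm \<xi> \<le> real n} \<xi>)" for n
  have W0: "W \<ge> 0" "tail n \<ge> 0" for n unfolding W_def tail_def using w0 by (simp_all add: integral_nonneg_AE)
  have tail_i: "integrable lborel (\<lambda>\<xi>. w \<xi> * indicator {\<xi>. \<not> norm \<xi> \<le> real n} \<xi>)" for n
    using wi by (intro integrable_real_mult_indicator) auto
  have tail: "tail \<longlonglongrightarrow> 0"
  proof -
    have "tail \<longlonglongrightarrow> (LINT \<xi>|(lborel :: 'b measure). (0::real))"
      unfolding tail_def
    proof (rule integral_dominated_convergence[OF _ _ wi])
      show "AE \<xi> in lborel. (\<lambda>n. w \<xi> * indicator {\<xi>. \<not> norm \<xi> \<le> real n} \<xi>) \<longlonglongrightarrow> 0"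
      proof (intro AE_I2 tendsto_eventually)
        fix \<xi> :: 'b
        obtain N where "norm \<xi> \<le> real N" using real_arch_simple by blast
        then show "\<forall>\<^sub>F n in sequentially. w \<xi> * indicator {\<xi>. \<not> norm \<xi> \<le> real n} \<xi> = 0"
          by (intro eventually_sequentiallyI[of N]) auto
      qed
      show "AE \<xi> in lborel. norm (w \<xi> * indicator {\<xi>. \<not> norm \<xi> \<le> real n} \<xi>) \<le> w \<xi>" for n
        using w0 by (intro AE_I2) (auto simp: indicator_def)
    qed auto
    then show ?thesis by simp
  qed
  have gm[measurable]: "g i \<omega> \<in> borel_measurable borel" if "i \<in> I" "\<omega> \<in> space P" for i \<omega>
    using measurable_Pair2[OF meas[OF that(1)] that(2)] by simp
  have gL: "g i \<omega> \<in> weighted_L2 (- u)" if "i \<in> I" "\<omega> \<in> space P" for i \<omega>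
    using bdd[OF that] gm[OF that] bounded_in_weighted_L2[OF _ _ u] by blast
  note sL = step_in_weighted_L2[OF u]
  have dist: "?d (inverse_fourier (step n c)) (inverse_fourier (g i \<omega>))
      = weighted_norm (- u) (\<lambda>\<xi>. step n c \<xi> - g i \<omega> \<xi>)" if "i \<in> I" "\<omega> \<in> space P" for i \<omega> n c
    by (rule sobolev_distance_eq[OF \<theta> sL gL[OF that]])
  define Q where "Q = (\<Union>n. (\<lambda>c. inverse_fourier (step n c)) ` (PiE (grid_points n) (\<lambda>_::'b. range (rnd n))))"
  have Q: "countable Q" "Q \<subseteq> sobolev_space (- u)"
  proof -
    have "countable (PiE (grid_points n) (\<lambda>_::'b. range (rnd n)))" for n
      by (intro countable_PiE finite_grid_points countable_range_rnd)
    then show "countable Q" unfolding Q_def by (intro countable_UN countable_image) auto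
    show "Q \<subseteq> sobolev_space (- u)"
      unfolding Q_def using inverse_fourier_in_sobolev_space[OF sL] by auto
  qed
  have samples: "restrict (\<lambda>p. rnd n (g i \<omega> p)) (grid_points n) \<in> PiE (grid_points n) (\<lambda>_. range (rnd n))" for n i \<omega>
    by auto
  have dist': "?d (inverse_fourier (step n (\<lambda>p\<in>grid_points n. rnd n (g i \<omega> p)))) (inverse_fourier (g i \<omega>))
      = weighted_norm (- u) (\<lambda>\<xi>. sample n (g i \<omega>) \<xi> - g i \<omega> \<xi>)" if "i \<in> I" "\<omega> \<in> space P" for i \<omega> n
    unfolding dist[OF that] by (simp only: step_restrict)
  define a where "a n = 8 / (real n)\<^sup>2 + 2 * (C * (real DIM('b) / real n)\<^sup>2)" for n
  have "(\<lambda>n. a n * W + C * tail n) \<longlonglongrightarrow> 0 * W + C * 0"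
    unfolding a_def by (intro tendsto_intros tail) real_asymp
  then have lim: "(\<lambda>n. a n * W + C * tail n) \<longlonglongrightarrow> 0" by simp
  \<comment> \<open>The mean square error of the approximation by rounded samples, uniformly over the family.\<close>
  have mean: "(\<integral>\<^sup>+\<omega>. ennreal ((weighted_norm (- u) (\<lambda>\<xi>. sample n (g i \<omega>) \<xi> - g i \<omega> \<xi>))\<^sup>2) \<partial>P) \<le> ennreal (a n * W + C * tail n)"
    if i: "i \<in> I" and n: "n > 0" for i n
  proof -
    note [measurable] = meas[OF i]
    have gp[measurable]: "(\<lambda>\<omega>. g i \<omega> \<xi>) \<in> borel_measurable P" for \<xi>
      using measurable_Pair1[OF meas[OF i], of \<xi>] by simp
    have jm[measurable]: "(\<lambda>(\<omega>, \<xi>). sample n (g i \<omega>) \<xi> - g i \<omega> \<xi>) \<in> borel_measurable (P \<Otimes>\<^sub>M lborel)"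
      unfolding step_def by measurable
    have eq: "ennreal ((weighted_norm (- u) (\<lambda>\<xi>. sample n (g i \<omega>) \<xi> - g i \<omega> \<xi>))\<^sup>2)
      = (\<integral>\<^sup>+\<xi>. ennreal (w \<xi> * (norm (sample n (g i \<omega>) \<xi> - g i \<omega> \<xi>))\<^sup>2) \<partial>lborel)" if "\<omega> \<in> space P" for \<omega>
      using weighted_L2_diff[OF sL[of n "\<lambda>p. rnd n (g i \<omega> p)"] gL[OF i that]] unfolding weighted_norm_square
      by (subst nn_integral_eq_integral[symmetric])
        (auto simp: weighted_L2_def sobolev_density_nonneg sobolev_density_def[abs_def] w_def)
    have "(\<integral>\<^sup>+\<omega>. ennreal ((weighted_norm (- u) (\<lambda>\<xi>. sample n (g i \<omega>) \<xi> - g i \<omega> \<xi>))\<^sup>2) \<partial>P)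
      = (\<integral>\<^sup>+\<omega>. \<integral>\<^sup>+\<xi>. ennreal (w \<xi> * (norm (sample n (g i \<omega>) \<xi> - g i \<omega> \<xi>))\<^sup>2) \<partial>lborel \<partial>P)"
      by (intro nn_integral_cong eq)
    also have "\<dots> = (\<integral>\<^sup>+\<xi>. \<integral>\<^sup>+\<omega>. ennreal (w \<xi> * (norm (sample n (g i \<omega>) \<xi> - g i \<omega> \<xi>))\<^sup>2) \<partial>P \<partial>lborel)"
    proof -
      interpret pair_sigma_finite P "lborel :: 'b measure" by standard
      show ?thesis by (rule Fubini'[symmetric]) measurable
    qed
    also have "\<dots> \<le> (\<integral>\<^sup>+\<xi>. ennreal (a n * w \<xi> + C * (w \<xi> * indicator {\<xi>. \<not> norm \<xi> \<le> real n} \<xi>)) \<partial>lborel)"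
    proof (rule nn_integral_mono)
      fix \<xi> :: 'b
      have "(\<integral>\<^sup>+\<omega>. ennreal (w \<xi> * (norm (sample n (g i \<omega>) \<xi> - g i \<omega> \<xi>))\<^sup>2) \<partial>P)
        \<le> (\<integral>\<^sup>+\<omega>. ennreal (w \<xi>) * ennreal (if norm \<xi> \<le> real n then 8 / (real n)\<^sup>2 + 2 * (norm (g i \<omega> (grid n \<xi>) - g i \<omega> \<xi>))\<^sup>2 else (norm (g i \<omega> \<xi>))\<^sup>2) \<partial>P)"
        unfolding ennreal_mult'[OF w0, symmetric]
        by (intro nn_integral_mono ennreal_leI mult_left_mono norm_step_rnd_minus_le[OF n] w0)
      also have "\<dots> = ennreal (w \<xi>) * (\<integral>\<^sup>+\<omega>. ennreal (if norm \<xi> \<le> real n then 8 / (real n)\<^sup>2 + 2 * (norm (g i \<omega> (grid n \<xi>) - g i \<omega> \<xi>))\<^sup>2 else (norm (g i \<omega> \<xi>))\<^sup>2) \<partial>P)"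
        by (rule nn_integral_cmult) measurable
      also have "\<dots> \<le> ennreal (w \<xi>) * ennreal (if norm \<xi> \<le> real n then a n else C)"
      proof (intro mult_left_mono)
        show "(\<integral>\<^sup>+\<omega>. ennreal (if norm \<xi> \<le> real n then 8 / (real n)\<^sup>2 + 2 * (norm (g i \<omega> (grid n \<xi>) - g i \<omega> \<xi>))\<^sup>2 else (norm (g i \<omega> \<xi>))\<^sup>2) \<partial>P)
          \<le> ennreal (if norm \<xi> \<le> real n then a n else C)"
        proof (cases "norm \<xi> \<le> real n")
          case True
          have "(\<integral>\<^sup>+\<omega>. ennreal (8 / (real n)\<^sup>2 + 2 * (norm (g i \<omega> (grid n \<xi>) - g i \<omega> \<xi>))\<^sup>2) \<partial>P)
            = (\<integral>\<^sup>+\<omega>. ennreal (8 / (real n)\<^sup>2) + 2 * ennreal ((norm (g i \<omega> (grid n \<xi>) - g i \<omega> \<xi>))\<^sup>2) \<partial>P)"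
            by (intro nn_integral_cong) (simp add: ennreal_mult)
          also have "\<dots> = ennreal (8 / (real n)\<^sup>2) + 2 * (\<integral>\<^sup>+\<omega>. ennreal ((norm (g i \<omega> (grid n \<xi>) - g i \<omega> \<xi>))\<^sup>2) \<partial>P)"
            by (simp add: nn_integral_add nn_integral_cmult emeasure_space_1)
          also have "\<dots> \<le> ennreal (8 / (real n)\<^sup>2) + 2 * ennreal (C * (real DIM('b) / real n)\<^sup>2)"
          proof (intro add_left_mono mult_left_mono order_trans[OF inc[OF i]] ennreal_leI C power_mono)
            show "norm (grid n \<xi> - \<xi>) \<le> real DIM('b) / real n"
              using norm_minus_grid_le[OF n, of \<xi>] by (simp add: norm_minus_commute)
          qed auto
          also have "\<dots> = ennreal (a n)"
            using C by (simp add: a_def ennreal_mult)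
          finally show ?thesis using True by simp
        next
          case False
          then show ?thesis using mom[OF i, of \<xi>] by simp
        qed
      qed simp
      also have "\<dots> = ennreal (w \<xi> * (if norm \<xi> \<le> real n then a n else C))"
        using w0[of \<xi>] C by (intro ennreal_mult[symmetric]) (auto simp: a_def)
      also have "\<dots> \<le> ennreal (a n * w \<xi> + C * (w \<xi> * indicator {\<xi>. \<not> norm \<xi> \<le> real n} \<xi>))"
        using w0[of \<xi>] C by (intro ennreal_leI) (auto simp: a_def mult.commute)
      finally show "(\<integral>\<^sup>+\<omega>. ennreal (w \<xi> * (norm (sample n (g i \<omega>) \<xi> - g i \<omega> \<xi>))\<^sup>2) \<partial>P)
        \<le> ennreal (a n * w \<xi> + C * (w \<xi> * indicator {\<xi>. \<not> norm \<xi> \<le> real n} \<xi>))" .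
    qed
    also have "\<dots> = ennreal (LINT \<xi>|lborel. a n * w \<xi> + C * (w \<xi> * indicator {\<xi>. \<not> norm \<xi> \<le> real n} \<xi>))"
      using wi tail_i w0 C by (intro nn_integral_eq_integral) (auto simp: a_def)
    also have "\<dots> = ennreal (a n * W + C * tail n)"
      using wi tail_i by (simp add: W_def tail_def)
    finally show ?thesis .
  qed
  have "tight_family P M.mtopology I (\<lambda>i \<omega>. inverse_fourier (g i \<omega>))"
  proof (rule M.tight_familyI[OF P mcomplete_sobolev[OF \<theta>] Q])
    fix i \<omega> assume i: "i \<in> I" and \<omega>: "\<omega> \<in> space P"
    show "inverse_fourier (g i \<omega>) \<in> sobolev_space (- u)"
      by (rule inverse_fourier_in_sobolev_space[OF gL[OF i \<omega>]])
    fix r :: real assume r: "r > 0"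
    obtain B where B: "\<And>\<xi>. norm (g i \<omega> \<xi>) \<le> B" using bdd[OF i \<omega>] by blast
    have B0: "B \<ge> 0" using order_trans[OF norm_ge_zero B[of 0]] .
    obtain L where L: "\<And>\<xi> \<xi>'. norm (g i \<omega> \<xi> - g i \<omega> \<xi>') \<le> L * norm (\<xi> - \<xi>')" using lip[OF i \<omega>] by blast
    define L' where "L' = max L 0"
    have L': "L' \<ge> 0" "norm (g i \<omega> \<xi> - g i \<omega> \<xi>') \<le> L' * norm (\<xi> - \<xi>')" for \<xi> \<xi>'
      unfolding L'_def using order_trans[OF L mult_right_mono[of L "max L 0"]] by auto
    define e where "e n = (8 / (real n)\<^sup>2 + 2 * (L' * (real DIM('b) / real n))\<^sup>2) * W + B\<^sup>2 * tail n" for n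
    have "e \<longlonglongrightarrow> 0 * W + B\<^sup>2 * 0"
      unfolding e_def power_mult_distrib by (intro tendsto_intros tail) real_asymp
    then have "\<forall>\<^sub>F n in sequentially. e n < r\<^sup>2" using r by (intro order_tendstoD(2)) auto
    then obtain n where n: "n > 0" "e n < r\<^sup>2"
      using eventually_gt_at_top[of 0] by (metis (mono_tags, lifting) eventually_conj eventually_sequentially order_refl)
    let ?s = "sample n (g i \<omega>)"
    have "(weighted_norm (- u) (\<lambda>\<xi>. ?s \<xi> - g i \<omega> \<xi>))\<^sup>2
      \<le> (LINT \<xi>|lborel. (8 / (real n)\<^sup>2 + 2 * (L' * (real DIM('b) / real n))\<^sup>2) * w \<xi> + B\<^sup>2 * (w \<xi> * indicator {\<xi>. \<not> norm \<xi> \<le> real n} \<xi>))"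
      unfolding weighted_norm_square
    proof (rule integral_mono)
      show "integrable lborel (sobolev_density (- u) (\<lambda>\<xi>. ?s \<xi> - g i \<omega> \<xi>))"
        using weighted_L2_diff[OF sL gL[OF i \<omega>]] by (simp add: weighted_L2_def)
      fix \<xi> :: 'b
      have 1: "norm (g i \<omega> (grid n \<xi>) - g i \<omega> \<xi>) \<le> L' * (real DIM('b) / real n)"
        using norm_minus_grid_le[OF n(1), of \<xi>] L'(1)
        by (intro order_trans[OF L'(2)] mult_left_mono) (auto simp: norm_minus_commute)
      have "(norm (?s \<xi> - g i \<omega> \<xi>))\<^sup>2 \<le> (if norm \<xi> \<le> real n then 8 / (real n)\<^sup>2 + 2 * (L' * (real DIM('b) / real n))\<^sup>2 else B\<^sup>2)"
        using 1 B by (intro order_trans[OF norm_step_rnd_minus_le[OF n(1)]]) (auto intro!: power_mono add_left_mono)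
      then have "w \<xi> * (norm (?s \<xi> - g i \<omega> \<xi>))\<^sup>2 \<le> w \<xi> * (if norm \<xi> \<le> real n then 8 / (real n)\<^sup>2 + 2 * (L' * (real DIM('b) / real n))\<^sup>2 else B\<^sup>2)"
        using w0 by (intro mult_left_mono)
      also have "\<dots> \<le> (8 / (real n)\<^sup>2 + 2 * (L' * (real DIM('b) / real n))\<^sup>2) * w \<xi> + B\<^sup>2 * (w \<xi> * indicator {\<xi>. \<not> norm \<xi> \<le> real n} \<xi>)"
        using w0[of \<xi>] L'(1) by (auto simp: mult.commute)
      finally show "sobolev_density (- u) (\<lambda>\<xi>. ?s \<xi> - g i \<omega> \<xi>) \<xi>
        \<le> (8 / (real n)\<^sup>2 + 2 * (L' * (real DIM('b) / real n))\<^sup>2) * w \<xi> + B\<^sup>2 * (w \<xi> * indicator {\<xi>. \<not> norm \<xi> \<le> real n} \<xi>)"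
        by (simp add: sobolev_density_def w_def)
    qed (use wi tail_i in auto)
    also have "\<dots> = e n" using wi tail_i by (simp add: e_def W_def tail_def)
    finally have "(weighted_norm (- u) (\<lambda>\<xi>. ?s \<xi> - g i \<omega> \<xi>))\<^sup>2 < r\<^sup>2" using n by simp
    then have "weighted_norm (- u) (\<lambda>\<xi>. ?s \<xi> - g i \<omega> \<xi>) < r" by (rule power_less_imp_less_base) (use r in simp)
    then show "\<exists>q\<in>Q. ?d q (inverse_fourier (g i \<omega>)) < r"
    proof (intro bexI)
      show "?d (inverse_fourier (step n (\<lambda>p\<in>grid_points n. rnd n (g i \<omega> p)))) (inverse_fourier (g i \<omega>)) < r"
        if "weighted_norm (- u) (\<lambda>\<xi>. ?s \<xi> - g i \<omega> \<xi>) < r"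
        unfolding dist'[OF i \<omega>] by (rule that)
      show "inverse_fourier (step n (\<lambda>p\<in>grid_points n. rnd n (g i \<omega> p))) \<in> Q"
        unfolding Q_def using samples[of n i \<omega>] by blast
    qed
  next
    fix i and q :: "'b distribution" assume i: "i \<in> I" and "q \<in> Q"
    then obtain n c where q: "q = inverse_fourier (step n c)" by (auto simp: Q_def)
    have "(\<lambda>\<omega>. weighted_norm (- u) (\<lambda>\<xi>. step n c \<xi> - g i \<omega> \<xi>)) \<in> borel_measurable P"
    proof -
      have [measurable]: "(\<lambda>(\<omega>, \<xi>). g i \<omega> \<xi>) \<in> borel_measurable (P \<Otimes>\<^sub>M lborel)" using meas[OF i] by simp
      show ?thesis unfolding weighted_norm_def sobolev_density_def by measurable
    qed
    then show "(\<lambda>\<omega>. ?d q (inverse_fourier (g i \<omega>))) \<in> borel_measurable P"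
      unfolding q by (rule measurable_cong[THEN iffD1, rotated]) (simp add: dist[OF i])
  next
    fix r \<eta> :: real assume r: "r > 0" and \<eta>: "\<eta> > 0"
    have "\<forall>\<^sub>F n in sequentially. a n * W + C * tail n < r\<^sup>2 * (\<eta> / 2)"
      using r \<eta> by (intro order_tendstoD(2)[OF lim]) auto
    then obtain n where n: "n > 0" "a n * W + C * tail n < r\<^sup>2 * (\<eta> / 2)"
      using eventually_gt_at_top[of 0] by (metis (mono_tags, lifting) eventually_conj eventually_sequentially order_refl)
    define N where "N = real (card (grid_points n :: 'b set))"
    define B where "B = sqrt (2 * N * C / \<eta>) + 1"
    have N0: "N \<ge> 0" by (simp add: N_def)
    have B: "B > 0" "N * (C / B\<^sup>2) \<le> \<eta> / 2"
    proof -
      have s: "sqrt (2 * N * C / \<eta>) \<ge> 0" using N0 C \<eta> by simp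
      then show "B > 0" unfolding B_def by linarith
      have "2 * N * C / \<eta> = (sqrt (2 * N * C / \<eta>))\<^sup>2" using N0 C \<eta> by simp
      also have "\<dots> \<le> B\<^sup>2" using s by (intro power_mono) (auto simp: B_def)
      finally show "N * (C / B\<^sup>2) \<le> \<eta> / 2" using \<open>B > 0\<close> \<eta> by (simp add: field_simps)
    qed
    define F where "F = (\<lambda>c. inverse_fourier (step n c)) ` (PiE (grid_points n) (\<lambda>_::'b. {rnd n z |z. norm z \<le> B}))"
    have "finite F" unfolding F_def by (intro finite_imageI finite_PiE finite_grid_points finite_rnd_bounded)
    moreover have "F \<subseteq> Q"
    proof -
      have "PiE (grid_points n) (\<lambda>_::'b. {rnd n z |z. norm z \<le> B}) \<subseteq> PiE (grid_points n) (\<lambda>_::'b. range (rnd n))"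
        by (intro PiE_mono) auto
      then show ?thesis unfolding F_def Q_def by blast
    qed
    moreover have "measure P {\<omega>\<in>space P. \<forall>q\<in>F. r < ?d q (inverse_fourier (g i \<omega>))} \<le> \<eta>" if i: "i \<in> I" for i
    proof -
      note [measurable] = meas[OF i]
      have gp[measurable]: "(\<lambda>\<omega>. g i \<omega> \<xi>) \<in> borel_measurable P" for \<xi>
        using measurable_Pair1[OF meas[OF i], of \<xi>] by simp
      let ?e = "\<lambda>\<omega>. weighted_norm (- u) (\<lambda>\<xi>. sample n (g i \<omega>) \<xi> - g i \<omega> \<xi>)"
      have em[measurable]: "?e \<in> borel_measurable P"
      proof -
        have [measurable]: "(\<lambda>(\<omega>, \<xi>). g i \<omega> \<xi>) \<in> borel_measurable (P \<Otimes>\<^sub>M lborel)" using meas[OF i] by simp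
        show ?thesis unfolding weighted_norm_def sobolev_density_def step_def by measurable
      qed
      have cheb: "measure P {\<omega>\<in>space P. t < h \<omega>} \<le> c / t\<^sup>2"
        if [measurable]: "h \<in> borel_measurable P" and t: "t > 0" and c: "c \<ge> 0" "(\<integral>\<^sup>+\<omega>. ennreal ((h \<omega>)\<^sup>2) \<partial>P) \<le> ennreal c"
          and h: "\<And>\<omega>. h \<omega> \<ge> 0" for h :: "'w \<Rightarrow> real" and t c
      proof -
        have "ennreal (t\<^sup>2) * emeasure P {\<omega>\<in>space P. t < h \<omega>} = (\<integral>\<^sup>+\<omega>. ennreal (t\<^sup>2) * indicator {\<omega>\<in>space P. t < h \<omega>} \<omega> \<partial>P)"
          by (rule nn_integral_cmult_indicator[symmetric]) measurable
        also have "\<dots> \<le> (\<integral>\<^sup>+\<omega>. ennreal ((h \<omega>)\<^sup>2) \<partial>P)"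
          using t by (intro nn_integral_mono) (auto simp: indicator_def intro!: ennreal_leI power_mono)
        also have "\<dots> \<le> ennreal c" by fact
        finally have "t\<^sup>2 * measure P {\<omega>\<in>space P. t < h \<omega>} \<le> c"
          using t c(1) by (simp add: emeasure_eq_measure flip: ennreal_mult)
        then show ?thesis using t by (simp add: field_simps)
      qed
      let ?A = "{\<omega>\<in>space P. r < ?e \<omega>}"
      let ?G = "\<lambda>p. {\<omega>\<in>space P. B < norm (g i \<omega> p)}"
      have "{\<omega>\<in>space P. \<forall>q\<in>F. r < ?d q (inverse_fourier (g i \<omega>))} \<subseteq> ?A \<union> (\<Union>p\<in>grid_points n. ?G p)"
      proof
        fix \<omega> assume "\<omega> \<in> {\<omega>\<in>space P. \<forall>q\<in>F. r < ?d q (inverse_fourier (g i \<omega>))}"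
        then have \<omega>: "\<omega> \<in> space P" "\<And>q. q \<in> F \<Longrightarrow> r < ?d q (inverse_fourier (g i \<omega>))" by auto
        show "\<omega> \<in> ?A \<union> (\<Union>p\<in>grid_points n. ?G p)"
        proof (cases "\<exists>p\<in>grid_points n. B < norm (g i \<omega> p)")
          case True then show ?thesis using \<omega> by auto
        next
          case False
          let ?c = "restrict (\<lambda>p. rnd n (g i \<omega> p)) (grid_points n)"
          have "?c \<in> PiE (grid_points n) (\<lambda>_. {rnd n z |z. norm z \<le> B})"
            using False by (auto simp: not_less)
          then have "inverse_fourier (step n ?c) \<in> F" unfolding F_def by blast
          from \<omega>(2)[OF this] show ?thesis using \<omega>(1) dist'[OF i \<omega>(1), of n] by simp
        qed
      qed
      then have "measure P {\<omega>\<in>space P. \<forall>q\<in>F. r < ?d q (inverse_fourier (g i \<omega>))}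
        \<le> measure P (?A \<union> (\<Union>p\<in>grid_points n. ?G p))"
        by (rule finite_measure_mono) (intro sets.Un sets.finite_UN finite_grid_points; measurable)
      also have "\<dots> \<le> measure P ?A + measure P (\<Union>p\<in>grid_points n. ?G p)"
        by (rule measure_Un_le) (auto intro!: sets.finite_UN finite_grid_points)
      also have "measure P (\<Union>p\<in>grid_points n. ?G p) \<le> (\<Sum>p\<in>grid_points n. measure P (?G p))"
        by (rule finite_measure_subadditive_finite) (auto intro: finite_grid_points)
      also have "\<dots> \<le> (\<Sum>p\<in>(grid_points n :: 'b set). C / B\<^sup>2)"
        using B(1) C mom[OF i] by (intro sum_mono cheb) auto
      also have "\<dots> = N * (C / B\<^sup>2)" by (simp add: N_def)
      also have "\<dots> \<le> \<eta> / 2" by (rule B)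
      also have "measure P ?A \<le> (a n * W + C * tail n) / r\<^sup>2"
        using r C W0 mean[OF i n(1)] by (intro cheb em weighted_norm_nonneg) (auto simp: a_def)
      also have "\<dots> \<le> \<eta> / 2" using n(2) r by (simp add: field_simps)
      finally show ?thesis by simp
    qed
    ultimately show "\<exists>F\<subseteq>Q. finite F \<and> (\<forall>i\<in>I. measure P {\<omega>\<in>space P. \<forall>q\<in>F. r < ?d q (inverse_fourier (g i \<omega>))} \<le> \<eta>)"
      by blast
  qed
  then show ?thesis by (simp add: sobolev_topology_def)
qed

section \<open>Exponential moments of Gaussian pairs\<close>

lemma centered_normal_moments:
  assumes P: "prob_space P" and Z[measurable]: "Z \<in> borel_measurable P"
    and d: "distr P borel Z = centered_normal \<sigma>" "\<sigma> \<ge> 0"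
  shows "integrable P (\<lambda>\<omega>. exp (Z \<omega>))" "integrable P (\<lambda>\<omega>. (Z \<omega>)\<^sup>2)"
    "(LINT \<omega>|P. exp (Z \<omega>)) = exp ((LINT \<omega>|P. (Z \<omega>)\<^sup>2) / 2)"
proof -
  interpret prob_space P by fact
  have A: "integrable P (\<lambda>\<omega>. h (Z \<omega>)) \<longleftrightarrow> integrable (centered_normal \<sigma>) h"
    "(LINT \<omega>|P. h (Z \<omega>)) = (LINT x|centered_normal \<sigma>. h x)"
    if [measurable]: "h \<in> borel_measurable borel" for h :: "real \<Rightarrow> real"
    unfolding d(1)[symmetric] by (simp_all add: integrable_distr_eq integral_distr)
  have "integrable (centered_normal \<sigma>) exp \<and> integrable (centered_normal \<sigma>) (\<lambda>x. x\<^sup>2) \<and>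
    (LINT x|centered_normal \<sigma>. exp x) = exp ((LINT x|centered_normal \<sigma>. x\<^sup>2) / 2)"
  proof (cases "\<sigma> = 0")
    case True
    have i: "integrable (return borel 0) h" if [measurable]: "h \<in> borel_measurable borel" for h :: "real \<Rightarrow> real"
      by (rule integrableI_bounded) (auto simp: nn_integral_return)
    have v: "(LINT x|return borel 0. h x) = h 0" if "h \<in> borel_measurable borel" for h :: "real \<Rightarrow> real"
      using that by (intro integral_return) auto
    have m: "(exp :: real \<Rightarrow> real) \<in> borel_measurable borel" "(\<lambda>x::real. x\<^sup>2) \<in> borel_measurable borel"
      by measurable
    show ?thesis
      using True i[OF m(1)] i[OF m(2)] v[OF m(1)] v[OF m(2)] by (simp add: centered_normal_def)
  next
    case False
    with d have s: "\<sigma> > 0" by simp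
    have nd: "centered_normal \<sigma> = density lborel (\<lambda>x. ennreal (normal_density 0 \<sigma> x))"
      using False by (simp add: centered_normal_def)
    \<comment> \<open>Completing the square shifts the mean to \<open>\<sigma>\<^sup>2\<close>.\<close>
    have sq: "normal_density 0 \<sigma> x * exp x = exp (\<sigma>\<^sup>2 / 2) * normal_density (\<sigma>\<^sup>2) \<sigma> x" for x
    proof -
      have "- (x\<^sup>2 / (2 * \<sigma>\<^sup>2)) + x = \<sigma>\<^sup>2 / 2 - (x - \<sigma>\<^sup>2)\<^sup>2 / (2 * \<sigma>\<^sup>2)"
        using s by (simp add: field_simps power2_eq_square)
      then have "exp (- (x\<^sup>2 / (2 * \<sigma>\<^sup>2))) * exp x = exp (\<sigma>\<^sup>2 / 2) * exp (- (x - \<sigma>\<^sup>2)\<^sup>2 / (2 * \<sigma>\<^sup>2))"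
        by (simp flip: exp_add)
      then show ?thesis unfolding normal_density_def by simp
    qed
    have ie: "integrable (centered_normal \<sigma>) exp"
      unfolding nd by (subst integrable_density) (auto simp: sq s)
    have "(LINT x|centered_normal \<sigma>. exp x) = exp (\<sigma>\<^sup>2 / 2)"
      unfolding nd by (subst integral_density) (auto simp: sq s)
    moreover have i2: "integrable (centered_normal \<sigma>) (\<lambda>x. x\<^sup>2)"
      unfolding nd using integrable_normal_moment[of \<sigma> 0 2] s by (subst integrable_density) auto
    moreover have "(LINT x|centered_normal \<sigma>. x\<^sup>2) = \<sigma>\<^sup>2"
      unfolding nd using integral_normal_moment_even[of \<sigma> 0 1] s by (subst integral_density) auto
    ultimately show ?thesis using ie by simp
  qed
  then show "integrable P (\<lambda>\<omega>. exp (Z \<omega>))" "integrable P (\<lambda>\<omega>. (Z \<omega>)\<^sup>2)"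
    "(LINT \<omega>|P. exp (Z \<omega>)) = exp ((LINT \<omega>|P. (Z \<omega>)\<^sup>2) / 2)"
    using A[of exp] A[of "\<lambda>x. x\<^sup>2"] by auto
qed

text \<open>Joint Gaussianity of two variables, through all their linear combinations.\<close>

definition gaussian_pair :: "'w measure \<Rightarrow> ('w \<Rightarrow> real) \<Rightarrow> ('w \<Rightarrow> real) \<Rightarrow> bool" where
  "gaussian_pair P A B \<longleftrightarrow> A \<in> borel_measurable P \<and> B \<in> borel_measurable P \<and>
     (\<forall>a b. \<exists>\<sigma>\<ge>0. distr P borel (\<lambda>\<omega>. a * A \<omega> + b * B \<omega>) = centered_normal \<sigma>)"

lemma gaussian_pair_of_process:
  assumes X: "centered_gaussian_process P I X" and ij: "i \<in> I" "j \<in> I"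
    and A[measurable]: "A \<in> borel_measurable P" "AE \<omega> in P. A \<omega> = X i \<omega>"
    and B[measurable]: "B \<in> borel_measurable P" "AE \<omega> in P. B \<omega> = X j \<omega>"
  shows "gaussian_pair P A B"
  unfolding gaussian_pair_def
proof (intro conjI allI A B)
  fix a b :: real
  have [measurable]: "X i \<in> borel_measurable P" "X j \<in> borel_measurable P"
    using X ij by (auto simp: centered_gaussian_process_def)
  \<comment> \<open>The indices may coincide.\<close>
  define c where "c k = (if i = j then a + b else if k = i then a else b)" for k
  have "\<exists>\<sigma>\<ge>0. distr P borel (\<lambda>\<omega>. \<Sum>k\<in>{i, j}. c k * X k \<omega>) = centered_normal \<sigma>"
  proof -
    have "\<forall>F c. finite F \<and> F \<subseteq> I \<longrightarrow>
        (\<exists>\<sigma>\<ge>0. distr P borel (\<lambda>\<omega>. \<Sum>k\<in>F. c k * X k \<omega>) = centered_normal \<sigma>)"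
      using X unfolding centered_gaussian_process_def by (rule conjunct2)
    from this[rule_format, of "{i, j}" c] show ?thesis using ij by simp
  qed
  moreover have "(\<Sum>k\<in>{i, j}. c k * X k \<omega>) = a * X i \<omega> + b * X j \<omega>" for \<omega>
    by (cases "i = j") (auto simp: c_def algebra_simps)
  moreover have "distr P borel (\<lambda>\<omega>. a * A \<omega> + b * B \<omega>) = distr P borel (\<lambda>\<omega>. a * X i \<omega> + b * X j \<omega>)"
  proof (rule distr_cong_AE)
    show "AE \<omega> in P. a * A \<omega> + b * B \<omega> = a * X i \<omega> + b * X j \<omega>"
      using A(2) B(2) by eventually_elim simp
  qed simp_all
  ultimately show "\<exists>\<sigma>\<ge>0. distr P borel (\<lambda>\<omega>. a * A \<omega> + b * B \<omega>) = centered_normal \<sigma>" by simp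
qed

lemma gaussian_pair_linear:
  assumes "gaussian_pair P A B"
  shows "gaussian_pair P (\<lambda>\<omega>. a * A \<omega> + b * B \<omega>) (\<lambda>\<omega>. c * A \<omega> + d * B \<omega>)"
  unfolding gaussian_pair_def
proof (intro conjI allI)
  have [measurable]: "A \<in> borel_measurable P" "B \<in> borel_measurable P"
    using assms by (auto simp: gaussian_pair_def)
  show "(\<lambda>\<omega>. a * A \<omega> + b * B \<omega>) \<in> borel_measurable P" "(\<lambda>\<omega>. c * A \<omega> + d * B \<omega>) \<in> borel_measurable P"
    by measurable
  fix s t
  have "s * (a * A \<omega> + b * B \<omega>) + t * (c * A \<omega> + d * B \<omega>) = (s * a + t * c) * A \<omega> + (s * b + t * d) * B \<omega>" for \<omega>
    by (simp add: algebra_simps)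
  then show "\<exists>\<sigma>\<ge>0. distr P borel (\<lambda>\<omega>. s * (a * A \<omega> + b * B \<omega>) + t * (c * A \<omega> + d * B \<omega>)) = centered_normal \<sigma>"
    using assms unfolding gaussian_pair_def by simp
qed

lemma gaussian_pair_moments:
  assumes P: "prob_space P" and AB: "gaussian_pair P A B"
  shows "integrable P (\<lambda>\<omega>. A \<omega> * B \<omega>)" "integrable P (\<lambda>\<omega>. (A \<omega>)\<^sup>2)" "integrable P (\<lambda>\<omega>. (B \<omega>)\<^sup>2)"
    "integrable P (\<lambda>\<omega>. exp (A \<omega> + t * B \<omega>))"
    "(LINT \<omega>|P. exp (A \<omega> + t * B \<omega>)) =
      exp (((LINT \<omega>|P. (A \<omega>)\<^sup>2) + 2 * t * (LINT \<omega>|P. A \<omega> * B \<omega>) + t\<^sup>2 * (LINT \<omega>|P. (B \<omega>)\<^sup>2)) / 2)"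
proof -
  have m[measurable]: "A \<in> borel_measurable P" "B \<in> borel_measurable P"
    using AB by (auto simp: gaussian_pair_def)
  have *: "integrable P (\<lambda>\<omega>. exp (a * A \<omega> + b * B \<omega>))" "integrable P (\<lambda>\<omega>. (a * A \<omega> + b * B \<omega>)\<^sup>2)"
    "(LINT \<omega>|P. exp (a * A \<omega> + b * B \<omega>)) = exp ((LINT \<omega>|P. (a * A \<omega> + b * B \<omega>)\<^sup>2) / 2)" for a b
  proof -
    obtain \<sigma> where "\<sigma> \<ge> 0" "distr P borel (\<lambda>\<omega>. a * A \<omega> + b * B \<omega>) = centered_normal \<sigma>"
      using AB unfolding gaussian_pair_def by blast
    then show "integrable P (\<lambda>\<omega>. exp (a * A \<omega> + b * B \<omega>))" "integrable P (\<lambda>\<omega>. (a * A \<omega> + b * B \<omega>)\<^sup>2)"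
      "(LINT \<omega>|P. exp (a * A \<omega> + b * B \<omega>)) = exp ((LINT \<omega>|P. (a * A \<omega> + b * B \<omega>)\<^sup>2) / 2)"
      using centered_normal_moments[OF P, of "\<lambda>\<omega>. a * A \<omega> + b * B \<omega>" \<sigma>] by simp_all
  qed
  show A2: "integrable P (\<lambda>\<omega>. (A \<omega>)\<^sup>2)" using *(2)[of 1 0] by simp
  show B2: "integrable P (\<lambda>\<omega>. (B \<omega>)\<^sup>2)" using *(2)[of 0 1] by simp
  show ABi: "integrable P (\<lambda>\<omega>. A \<omega> * B \<omega>)"
  proof (rule Bochner_Integration.integrable_bound[of P "\<lambda>\<omega>. (A \<omega>)\<^sup>2 + (B \<omega>)\<^sup>2"])
    show "AE \<omega> in P. norm (A \<omega> * B \<omega>) \<le> norm ((A \<omega>)\<^sup>2 + (B \<omega>)\<^sup>2)"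
    proof (intro AE_I2)
      fix \<omega>
      have "2 * \<bar>A \<omega>\<bar> * \<bar>B \<omega>\<bar> \<le> (A \<omega>)\<^sup>2 + (B \<omega>)\<^sup>2" using sum_squares_bound[of "\<bar>A \<omega>\<bar>" "\<bar>B \<omega>\<bar>"] by simp
      moreover have "0 \<le> \<bar>A \<omega>\<bar> * \<bar>B \<omega>\<bar>" by simp
      moreover have "norm ((A \<omega>)\<^sup>2 + (B \<omega>)\<^sup>2) = (A \<omega>)\<^sup>2 + (B \<omega>)\<^sup>2" by simp
      ultimately show "norm (A \<omega> * B \<omega>) \<le> norm ((A \<omega>)\<^sup>2 + (B \<omega>)\<^sup>2)" unfolding norm_mult real_norm_def by linarith
    qed
  qed (use A2 B2 in auto)
  show "integrable P (\<lambda>\<omega>. exp (A \<omega> + t * B \<omega>))" using *(1)[of 1 t] by simp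
  have "(LINT \<omega>|P. exp (A \<omega> + t * B \<omega>)) = exp ((LINT \<omega>|P. (A \<omega> + t * B \<omega>)\<^sup>2) / 2)"
    using *(3)[of 1 t] by simp
  also have "(LINT \<omega>|P. (A \<omega> + t * B \<omega>)\<^sup>2) = (LINT \<omega>|P. (A \<omega>)\<^sup>2 + 2 * t * (A \<omega> * B \<omega>) + t\<^sup>2 * (B \<omega>)\<^sup>2)"
    by (intro Bochner_Integration.integral_cong) (simp_all add: power2_eq_square algebra_simps)
  also have "\<dots> = (LINT \<omega>|P. (A \<omega>)\<^sup>2) + 2 * t * (LINT \<omega>|P. A \<omega> * B \<omega>) + t\<^sup>2 * (LINT \<omega>|P. (B \<omega>)\<^sup>2)"
    using A2 B2 ABi by simp
  finally show "(LINT \<omega>|P. exp (A \<omega> + t * B \<omega>)) =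
      exp (((LINT \<omega>|P. (A \<omega>)\<^sup>2) + 2 * t * (LINT \<omega>|P. A \<omega> * B \<omega>) + t\<^sup>2 * (LINT \<omega>|P. (B \<omega>)\<^sup>2)) / 2)" .
qed

text \<open>Both sides are entire in \<open>z\<close>, the left one as the sum of the power series of its exponential moments,
  and they agree on the real line.\<close>

lemma gaussian_pair_complex_exp:
  fixes z :: complex
  assumes P: "prob_space P" and AB: "gaussian_pair P A B"
  shows "(LINT \<omega>|P. exp (of_real (A \<omega>) + z * of_real (B \<omega>))) =
    exp ((of_real (LINT \<omega>|P. (A \<omega>)\<^sup>2) + 2 * z * of_real (LINT \<omega>|P. A \<omega> * B \<omega>) + z\<^sup>2 * of_real (LINT \<omega>|P. (B \<omega>)\<^sup>2)) / 2)"
proof -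
  have m[measurable]: "A \<in> borel_measurable P" "B \<in> borel_measurable P"
    using AB by (auto simp: gaussian_pair_def)
  define a where "a n = (LINT \<omega>|P. of_real (B \<omega>) ^ n /\<^sub>R fact n * complex_of_real (exp (A \<omega>)))" for n
  define F where "F z = (LINT \<omega>|P. exp (of_real (A \<omega>) + z * of_real (B \<omega>)))" for z :: complex
  have sums: "(\<lambda>n. a n * z ^ n) sums F z" for z
  proof -
    \<comment> \<open>An integrable bound for the partial sums of the exponential series, from
      \<open>exp (r |B|) \<le> exp (r B) + exp (- r B)\<close>.\<close>
    define W where "W \<omega> = exp (A \<omega> + cmod z * B \<omega>) + exp (A \<omega> + (- cmod z) * B \<omega>)" for \<omega>
    have W: "integrable P W"
      unfolding W_def by (intro Bochner_Integration.integrable_add gaussian_pair_moments(4)[OF P AB])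
    have bound: "exp (cmod (z * of_real (B \<omega>))) * exp (A \<omega>) \<le> W \<omega>" for \<omega>
    proof -
      have "cmod (z * of_real (B \<omega>)) = cmod z * B \<omega> \<or> cmod (z * of_real (B \<omega>)) = - cmod z * B \<omega>"
        by (auto simp: norm_mult abs_if)
      then have "exp (A \<omega> + cmod (z * of_real (B \<omega>))) \<le> W \<omega>"
        unfolding W_def by (elim disjE) simp_all
      then show ?thesis by (simp add: exp_add mult.commute)
    qed
    define T where "T n \<omega> = (z * of_real (B \<omega>)) ^ n /\<^sub>R fact n * complex_of_real (exp (A \<omega>))" for n \<omega>
    have [measurable]: "T n \<in> borel_measurable P" for n unfolding T_def by measurable
    have Tb: "norm (\<Sum>n<N. T n \<omega>) \<le> W \<omega>" for N \<omega>
    proof -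
      let ?x = "cmod (z * of_real (B \<omega>))"
      have "norm (\<Sum>n<N. T n \<omega>) \<le> (\<Sum>n<N. ?x ^ n /\<^sub>R fact n * exp (A \<omega>))"
        by (rule order_trans[OF norm_sum]) (simp add: T_def norm_mult norm_power norm_divide power_mult_distrib mult.assoc)
      also have "\<dots> = (\<Sum>n<N. ?x ^ n /\<^sub>R fact n) * exp (A \<omega>)" by (simp add: sum_distrib_right)
      also have "\<dots> \<le> exp ?x * exp (A \<omega>)"
      proof (rule mult_right_mono)
        have "(\<Sum>n<N. ?x ^ n /\<^sub>R fact n) \<le> (\<Sum>n. ?x ^ n /\<^sub>R fact n)"
          by (rule sum_le_suminf[OF summable_exp_generic]) auto
        then show "(\<Sum>n<N. ?x ^ n /\<^sub>R fact n) \<le> exp ?x"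
          using sums_unique[OF exp_converges[of ?x]] by simp
      qed simp
      finally show ?thesis using bound[of \<omega>] by linarith
    qed
    have Ti: "integrable P (T n)" for n
    proof (rule Bochner_Integration.integrable_bound[OF integrable_mult_right[OF W, of 2]])
      show "AE \<omega> in P. norm (T n \<omega>) \<le> norm (2 * W \<omega>)"
      proof (intro AE_I2)
        fix \<omega>
        have "T n \<omega> = (\<Sum>n<Suc n. T n \<omega>) - (\<Sum>n<n. T n \<omega>)" by simp
        then have "norm (T n \<omega>) \<le> norm (\<Sum>n<Suc n. T n \<omega>) + norm (\<Sum>n<n. T n \<omega>)"
          by (metis norm_triangle_ineq4)
        also have "\<dots> \<le> W \<omega> + W \<omega>" by (intro add_mono Tb)
        finally show "norm (T n \<omega>) \<le> norm (2 * W \<omega>)" by simp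
      qed
    qed simp
    have "(\<lambda>N. LINT \<omega>|P. (\<Sum>n<N. T n \<omega>)) \<longlonglongrightarrow> F z"
      unfolding F_def
    proof (rule integral_dominated_convergence[OF _ _ W])
      show "AE \<omega> in P. (\<lambda>N. \<Sum>n<N. T n \<omega>) \<longlonglongrightarrow> exp (of_real (A \<omega>) + z * of_real (B \<omega>))"
      proof (intro AE_I2)
        fix \<omega>
        have "(\<lambda>n. T n \<omega>) sums (exp (z * of_real (B \<omega>)) * complex_of_real (exp (A \<omega>)))"
          unfolding T_def by (intro sums_mult2 exp_converges)
        then show "(\<lambda>N. \<Sum>n<N. T n \<omega>) \<longlonglongrightarrow> exp (of_real (A \<omega>) + z * of_real (B \<omega>))"
          by (simp add: sums_def exp_add exp_of_real mult.commute)
      qed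
    qed (use Tb in auto)
    moreover have "(LINT \<omega>|P. (\<Sum>n<N. T n \<omega>)) = (\<Sum>n<N. a n * z ^ n)" for N
    proof -
      have "(LINT \<omega>|P. (\<Sum>n<N. T n \<omega>)) = (\<Sum>n<N. LINT \<omega>|P. T n \<omega>)"
        by (rule Bochner_Integration.integral_sum) (rule Ti)
      moreover have "(LINT \<omega>|P. T n \<omega>) = a n * z ^ n" for n
      proof -
        have "T n \<omega> = of_real (B \<omega>) ^ n /\<^sub>R fact n * complex_of_real (exp (A \<omega>)) * z ^ n" for \<omega>
          by (simp add: T_def power_mult_distrib)
        then show ?thesis unfolding a_def by (simp only: integral_mult_left_zero)
      qed
      ultimately show ?thesis by simp
    qed
    ultimately show ?thesis by (simp add: sums_def)
  qed
  define G where "G z = exp ((of_real (LINT \<omega>|P. (A \<omega>)\<^sup>2) + 2 * z * of_real (LINT \<omega>|P. A \<omega> * B \<omega>) + z\<^sup>2 * of_real (LINT \<omega>|P. (B \<omega>)\<^sup>2)) / 2)"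
    for z :: complex
  have real: "F (of_real t) = G (of_real t)" for t
  proof -
    have "F (of_real t) = (LINT \<omega>|P. complex_of_real (exp (A \<omega> + t * B \<omega>)))"
      unfolding F_def by (simp flip: exp_of_real)
    also have "\<dots> = of_real (LINT \<omega>|P. exp (A \<omega> + t * B \<omega>))" by (rule integral_complex_of_real)
    also have "\<dots> = G (of_real t)"
      unfolding gaussian_pair_moments(5)[OF P AB] G_def by (simp flip: exp_of_real)
    finally show ?thesis .
  qed
  let ?S = "ball 0 (cmod z + 1) :: complex set"
  have hF: "F holomorphic_on ?S"
    using sums by (intro power_series_holomorphic[where a=a]) simp
  have hG: "G holomorphic_on ?S" unfolding G_def by (intro holomorphic_intros) auto
  have "F z - G z = 0"
  proof (rule analytic_continuation[where f="\<lambda>z. F z - G z" and S="?S" and U="of_real ` {-1<..<1}" and \<xi>=0])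
    show "(\<lambda>z. F z - G z) holomorphic_on ?S" using hF hG by (rule holomorphic_on_diff)
    show "complex_of_real ` {-1<..<1} \<subseteq> ?S"
    proof
      fix w assume "w \<in> complex_of_real ` {-1<..<1}"
      then have "cmod w < 1" by auto
      then show "w \<in> ?S" using norm_ge_zero[of z] unfolding mem_ball_0 by linarith
    qed
    show "(0::complex) islimpt complex_of_real ` {-1<..<1}"
      unfolding islimpt_approachable
    proof (intro allI impI)
      fix e :: real assume "e > 0"
      then show "\<exists>x'\<in>complex_of_real ` {-1<..<1}. x' \<noteq> 0 \<and> dist x' 0 < e"
        by (intro bexI[of _ "of_real (min (e / 2) (1 / 2))"]) (auto simp: dist_norm)
    qed
    show "0 \<in> ?S" using norm_ge_zero[of z] unfolding mem_ball_0 norm_zero by linarith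
  qed (auto simp: real)
  then show ?thesis by (simp add: F_def G_def)
qed

text \<open>With \<open>\<gamma> = \<alpha> + i \<beta>\<close> the exponent is \<open>U + i \<beta> V\<close> for \<open>U = \<alpha> (A + B)\<close> and \<open>V = A - B\<close>, up to the deterministic
  terms. Those cancel everything except \<open>(\<alpha>\<^sup>2 + \<beta>\<^sup>2) \<E> [A B]\<close>.\<close>

lemma gaussian_pair_chaos_covariance:
  fixes \<gamma> :: complex
  assumes P: "prob_space P" and AB: "gaussian_pair P A B"
  shows "(LINT \<omega>|P. exp (\<gamma> * of_real (A \<omega>) - \<gamma>\<^sup>2 / 2 * of_real (LINT \<omega>'|P. A \<omega>' * A \<omega>')) *
      cnj (exp (\<gamma> * of_real (B \<omega>) - \<gamma>\<^sup>2 / 2 * of_real (LINT \<omega>'|P. B \<omega>' * B \<omega>')))) =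
    of_real (exp ((cmod \<gamma>)\<^sup>2 * (LINT \<omega>'|P. A \<omega>' * B \<omega>')))"
proof -
  note mom = gaussian_pair_moments[OF P AB]
  let ?a = "LINT \<omega>|P. A \<omega> * A \<omega>" and ?b = "LINT \<omega>|P. B \<omega> * B \<omega>" and ?c = "LINT \<omega>|P. A \<omega> * B \<omega>"
  define \<alpha> where "\<alpha> = Re \<gamma>"
  define \<beta> where "\<beta> = Im \<gamma>"
  have g: "\<gamma> = of_real \<alpha> + \<i> * of_real \<beta>" by (simp add: \<alpha>_def \<beta>_def complex_eq mult.commute)
  define U where "U \<omega> = \<alpha> * A \<omega> + \<alpha> * B \<omega>" for \<omega>
  define V where "V \<omega> = 1 * A \<omega> + (- 1) * B \<omega>" for \<omega>
  have UV: "gaussian_pair P U V" unfolding U_def V_def by (rule gaussian_pair_linear[OF AB])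
  have i: "integrable P (\<lambda>\<omega>. A \<omega> * A \<omega>)" "integrable P (\<lambda>\<omega>. B \<omega> * B \<omega>)" "integrable P (\<lambda>\<omega>. A \<omega> * B \<omega>)"
    using mom(1-3) by (simp_all add: power2_eq_square)
  have "(LINT \<omega>|P. (U \<omega>)\<^sup>2) = (LINT \<omega>|P. \<alpha>\<^sup>2 * (A \<omega> * A \<omega>) + 2 * \<alpha>\<^sup>2 * (A \<omega> * B \<omega>) + \<alpha>\<^sup>2 * (B \<omega> * B \<omega>))"
    unfolding U_def by (intro Bochner_Integration.integral_cong) (simp_all add: power2_eq_square algebra_simps)
  also have "\<dots> = \<alpha>\<^sup>2 * ?a + 2 * \<alpha>\<^sup>2 * ?c + \<alpha>\<^sup>2 * ?b" using i by simp
  finally have UU: "(LINT \<omega>|P. (U \<omega>)\<^sup>2) = \<alpha>\<^sup>2 * ?a + 2 * \<alpha>\<^sup>2 * ?c + \<alpha>\<^sup>2 * ?b" .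
  have "(LINT \<omega>|P. U \<omega> * V \<omega>) = (LINT \<omega>|P. \<alpha> * (A \<omega> * A \<omega>) - \<alpha> * (B \<omega> * B \<omega>))"
    unfolding U_def V_def by (intro Bochner_Integration.integral_cong) (simp_all add: algebra_simps)
  also have "\<dots> = \<alpha> * ?a - \<alpha> * ?b" using i by simp
  finally have UV': "(LINT \<omega>|P. U \<omega> * V \<omega>) = \<alpha> * ?a - \<alpha> * ?b" .
  have "(LINT \<omega>|P. (V \<omega>)\<^sup>2) = (LINT \<omega>|P. A \<omega> * A \<omega> - 2 * (A \<omega> * B \<omega>) + B \<omega> * B \<omega>)"
    unfolding V_def by (intro Bochner_Integration.integral_cong) (simp_all add: power2_eq_square algebra_simps)
  also have "\<dots> = ?a - 2 * ?c + ?b" using i by simp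
  finally have VV: "(LINT \<omega>|P. (V \<omega>)\<^sup>2) = ?a - 2 * ?c + ?b" .
  let ?k = "- \<gamma>\<^sup>2 / 2 * of_real ?a - cnj \<gamma> ^ 2 / 2 * of_real ?b"
  have "(LINT \<omega>|P. exp (\<gamma> * of_real (A \<omega>) - \<gamma>\<^sup>2 / 2 * of_real ?a) * cnj (exp (\<gamma> * of_real (B \<omega>) - \<gamma>\<^sup>2 / 2 * of_real ?b)))
    = (LINT \<omega>|P. exp ?k * exp (of_real (U \<omega>) + (\<i> * of_real \<beta>) * of_real (V \<omega>)))"
    unfolding exp_cnj exp_add[symmetric]
    by (intro Bochner_Integration.integral_cong refl arg_cong[where f=exp])
      (simp add: g U_def V_def algebra_simps)
  also have "\<dots> = exp ?k * exp ((of_real (\<alpha>\<^sup>2 * ?a + 2 * \<alpha>\<^sup>2 * ?c + \<alpha>\<^sup>2 * ?b) + 2 * (\<i> * of_real \<beta>) * of_real (\<alpha> * ?a - \<alpha> * ?b)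
      + (\<i> * of_real \<beta>)\<^sup>2 * of_real (?a - 2 * ?c + ?b)) / 2)"
    using gaussian_pair_complex_exp[OF P UV, of "\<i> * of_real \<beta>"] by (simp add: UU UV' VV)
  also have "\<dots> = exp (of_real ((\<alpha>\<^sup>2 + \<beta>\<^sup>2) * ?c))"
    unfolding exp_add[symmetric] g
    by (rule arg_cong[where f=exp]) (simp add: power2_eq_square field_simps)
  also have "\<alpha>\<^sup>2 + \<beta>\<^sup>2 = (cmod \<gamma>)\<^sup>2" by (simp add: \<alpha>_def \<beta>_def cmod_power2)
  finally show ?thesis by (simp only: exp_of_real)
qed

text \<open>A crude bound for the absolute values, which justifies Fubini's theorem.\<close>

lemma gaussian_pair_exp_bound:
  assumes P: "prob_space P" and AB: "gaussian_pair P A B"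
    and K: "(LINT \<omega>|P. A \<omega> * A \<omega>) \<le> K" "(LINT \<omega>|P. B \<omega> * B \<omega>) \<le> K"
  shows "integrable P (\<lambda>\<omega>. exp (\<alpha> * (A \<omega> + B \<omega>)))" "(LINT \<omega>|P. exp (\<alpha> * (A \<omega> + B \<omega>))) \<le> exp (2 * \<alpha>\<^sup>2 * K)"
proof -
  have 0: "gaussian_pair P (\<lambda>\<omega>. \<alpha> * A \<omega> + \<alpha> * B \<omega>) (\<lambda>\<omega>. 0 * A \<omega> + 0 * B \<omega>)"
    by (rule gaussian_pair_linear[OF AB])
  note m = gaussian_pair_moments[OF P AB]
  note m' = gaussian_pair_moments(4,5)[OF P 0, of 0]
  show "integrable P (\<lambda>\<omega>. exp (\<alpha> * (A \<omega> + B \<omega>)))" using m'(1) by (simp add: distrib_left)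
  have "(LINT \<omega>|P. (\<alpha> * A \<omega> + \<alpha> * B \<omega>)\<^sup>2) \<le> (LINT \<omega>|P. 2 * \<alpha>\<^sup>2 * (A \<omega>)\<^sup>2 + 2 * \<alpha>\<^sup>2 * (B \<omega>)\<^sup>2)"
  proof (rule integral_mono)
    show "(\<alpha> * A \<omega> + \<alpha> * B \<omega>)\<^sup>2 \<le> 2 * \<alpha>\<^sup>2 * (A \<omega>)\<^sup>2 + 2 * \<alpha>\<^sup>2 * (B \<omega>)\<^sup>2" for \<omega>
      using zero_le_power2[of "\<alpha> * A \<omega> - \<alpha> * B \<omega>"] by (simp add: power2_eq_square algebra_simps)
    show "integrable P (\<lambda>\<omega>. (\<alpha> * A \<omega> + \<alpha> * B \<omega>)\<^sup>2)" using gaussian_pair_moments(2)[OF P 0] .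
  qed (use m in auto)
  also have "\<dots> = 2 * \<alpha>\<^sup>2 * (LINT \<omega>|P. A \<omega> * A \<omega>) + 2 * \<alpha>\<^sup>2 * (LINT \<omega>|P. B \<omega> * B \<omega>)"
    using m(2,3) by (simp add: power2_eq_square)
  also have "\<dots> \<le> 2 * \<alpha>\<^sup>2 * K + 2 * \<alpha>\<^sup>2 * K"
    using K by (intro add_mono mult_left_mono) auto
  finally have "(LINT \<omega>|P. (\<alpha> * A \<omega> + \<alpha> * B \<omega>)\<^sup>2) / 2 \<le> 2 * \<alpha>\<^sup>2 * K" by linarith
  moreover have "(LINT \<omega>|P. exp (\<alpha> * (A \<omega> + B \<omega>))) = exp ((LINT \<omega>|P. (\<alpha> * A \<omega> + \<alpha> * B \<omega>)\<^sup>2) / 2)"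
    using m'(2) by (simp add: distrib_left)
  ultimately show "(LINT \<omega>|P. exp (\<alpha> * (A \<omega> + B \<omega>))) \<le> exp (2 * \<alpha>\<^sup>2 * K)"
    by (simp only: exp_le_cancel_iff)
qed

section \<open>Covariance of the mollified field\<close>

lemma lborel_nn_integral_translate:
  assumes [measurable]: "h \<in> borel_measurable borel"
  shows "(\<integral>\<^sup>+y. h (y - a) \<partial>lborel) = (\<integral>\<^sup>+(y::'b::euclidean_space). h y \<partial>lborel)"
proof -
  have "(\<integral>\<^sup>+y. h y \<partial>lborel) = (\<integral>\<^sup>+y. h y \<partial>(distr lborel borel ((+) (- a))))"
    by (simp add: lborel_distr_plus)
  also have "\<dots> = (\<integral>\<^sup>+y. h (y - a) \<partial>lborel)" by (subst nn_integral_distr) auto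
  finally show ?thesis ..
qed

text \<open>The positive part of the excess of \<open>log (1 / |w|)\<close> over \<open>log (1 / \<epsilon>)\<close>. At \<open>w = 0\<close> the conventions for
  division and the logarithm give the value \<open>0\<close>, not \<open>\<infinity>\<close>.\<close>

definition log_excess :: "real \<Rightarrow> 'b::euclidean_space \<Rightarrow> real" where
  "log_excess \<epsilon> w = max 0 (ln (\<epsilon> / norm w))"

lemma measurable_log_excess[measurable]: "log_excess \<epsilon> \<in> borel_measurable borel"
  unfolding log_excess_def[abs_def] by measurable

lemma log_excess_nonneg: "0 \<le> log_excess \<epsilon> w"
  by (simp add: log_excess_def)

text \<open>A discrete layer-cake formula: \<open>ln t \<le> log 2 t\<close> is at most the number of \<open>n\<close> with \<open>2\<^sup>n < t\<close>. It makes the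
  integral of the logarithm a sum of volumes of balls.\<close>

lemma log_excess_le_count:
  assumes \<epsilon>: "\<epsilon> > 0"
  shows "ennreal (log_excess \<epsilon> (w::'b::euclidean_space)) \<le> (\<Sum>n. indicator (ball 0 (\<epsilon> / 2 ^ n)) w)"
proof (cases "w = 0 \<or> \<epsilon> / norm w \<le> 1")
  case True
  then have "ln (\<epsilon> / norm w) \<le> 0"
    using \<epsilon> by (cases "w = 0") auto
  then have "log_excess \<epsilon> w = 0"
    by (simp add: log_excess_def)
  then show ?thesis by simp
next
  case False
  define t where "t = \<epsilon> / norm w"
  have t: "t > 1" using False unfolding t_def by linarith
  define N where "N = nat \<lceil>log 2 t\<rceil>"
  have "ln t \<le> log 2 t"
  proof -
    have "ln 2 \<le> (1::real)" using ln_le_minus_one[of 2] by simp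
    then show ?thesis using t by (simp add: log_def field_simps mult_left_le)
  qed
  also have "\<dots> \<le> real N" unfolding N_def by (rule real_nat_ceiling_ge)
  finally have "log_excess \<epsilon> w \<le> real N" by (simp add: log_excess_def t_def)
  then have "ennreal (log_excess \<epsilon> w) \<le> of_nat N" by (metis ennreal_leI ennreal_of_nat_eq_real_of_nat)
  also have "of_nat N = (\<Sum>n<N. indicator (ball 0 (\<epsilon> / 2 ^ n)) w :: ennreal)"
  proof -
    have "w \<in> ball 0 (\<epsilon> / 2 ^ n)" if "n < N" for n
    proof -
      have "real n < log 2 t" using that by (simp add: N_def) linarith
      then have "2 ^ n < t" using t by (simp add: less_log_iff powr_realpow)
      then show ?thesis using False by (simp add: t_def field_simps)
    qed
    then show ?thesis by simp
  qed
  also have "\<dots> \<le> (\<Sum>n. indicator (ball 0 (\<epsilon> / 2 ^ n)) w)"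
    by (rule sum_le_suminf) auto
  finally show ?thesis .
qed

lemma nn_integral_log_excess_le:
  assumes \<epsilon>: "\<epsilon> > 0"
  shows "(\<integral>\<^sup>+w. ennreal (log_excess \<epsilon> (w::'b::euclidean_space)) \<partial>lborel)
    \<le> ennreal (2 * unit_ball_vol DIM('b) * \<epsilon> ^ DIM('b))"
proof -
  have "(\<integral>\<^sup>+w. ennreal (log_excess \<epsilon> (w::'b)) \<partial>lborel) \<le> (\<integral>\<^sup>+w. (\<Sum>n. indicator (ball (0::'b) (\<epsilon> / 2 ^ n)) w) \<partial>lborel)"
    by (intro nn_integral_mono log_excess_le_count \<epsilon>)
  also have "\<dots> = (\<Sum>n. \<integral>\<^sup>+w. indicator (ball (0::'b) (\<epsilon> / 2 ^ n)) w \<partial>lborel)"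
    by (rule nn_integral_suminf) (intro borel_measurable_indicator, simp)
  also have "\<dots> = (\<Sum>n. ennreal (unit_ball_vol DIM('b) * (\<epsilon> / 2 ^ n) ^ DIM('b)))"
    using \<epsilon> by (intro suminf_cong) (simp add: emeasure_ball)
  also have "\<dots> \<le> (\<Sum>n. ennreal (unit_ball_vol DIM('b) * \<epsilon> ^ DIM('b) * (1 / 2) ^ n))"
  proof (intro suminf_le summableI ennreal_leI)
    fix n
    have "(1 / 2 ^ n) ^ DIM('b) \<le> (1 / 2 ^ n :: real) ^ 1"
      by (intro power_decreasing) (auto simp: Suc_le_eq)
    then have "unit_ball_vol DIM('b) * \<epsilon> ^ DIM('b) * (1 / 2 ^ n) ^ DIM('b) \<le> unit_ball_vol DIM('b) * \<epsilon> ^ DIM('b) * (1 / 2) ^ n"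
      using \<epsilon> by (intro mult_left_mono) (auto simp: power_one_over)
    then show "unit_ball_vol DIM('b) * (\<epsilon> / 2 ^ n) ^ DIM('b) \<le> unit_ball_vol DIM('b) * \<epsilon> ^ DIM('b) * (1 / 2) ^ n"
      by (simp add: power_divide)
  qed
  also have "\<dots> = ennreal (\<Sum>n. unit_ball_vol DIM('b) * \<epsilon> ^ DIM('b) * (1 / 2) ^ n)"
    using \<epsilon> by (intro suminf_ennreal2 summable_mult) (auto simp: summable_geometric)
  also have "(\<Sum>n. unit_ball_vol DIM('b) * \<epsilon> ^ DIM('b) * (1 / 2) ^ n) = 2 * unit_ball_vol DIM('b) * \<epsilon> ^ DIM('b)"
    by (subst suminf_mult) (auto simp: summable_geometric suminf_geometric)
  finally show ?thesis .
qed

locale log_correlated =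
  fixes D :: "'a::euclidean_space set" and K :: "'a \<Rightarrow> 'a \<Rightarrow> ereal" and L :: "'a \<times> 'a \<Rightarrow> real"
    and \<theta> :: "'a \<Rightarrow> real"
  assumes D: "open D"
    and K: "\<And>x y. x \<in> D \<Longrightarrow> y \<in> D \<Longrightarrow> K x y = ereal (L (x, y)) + log_kernel x y"
    and L: "continuous_on (D \<times> D) L"
    and \<theta>: "mollifier \<theta>"
begin

definition bump_measure :: "real \<Rightarrow> 'a \<Rightarrow> 'a measure" where
  "bump_measure \<epsilon> x = density (restrict_space lborel D) (\<lambda>y. ennreal (rescaled \<theta> \<epsilon> (x - y)))"

abbreviation null_D :: "'a measure" where
  "null_D \<equiv> null_measure (restrict_space borel D)"

lemma measurable_\<theta>[measurable]: "\<theta> \<in> borel_measurable borel"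
  using \<theta> by (intro borel_measurable_continuous_onI C_k_imp_continuous[of 0]) (simp add: mollifier_def smooth_def del: C_k.simps)

lemma measurable_rescaled[measurable]: "rescaled \<theta> \<epsilon> \<in> borel_measurable borel"
  unfolding rescaled_def[abs_def] by measurable

lemma D_sets[measurable]: "D \<in> sets borel"
  using D by simp

lemma sets_bump_measure[measurable_cong]: "sets (bump_measure \<epsilon> x) = sets (restrict_space borel D)"
  by (simp add: bump_measure_def sets_restrict_space)

lemma space_bump_measure: "space (bump_measure \<epsilon> x) = D"
  by (simp add: bump_measure_def space_restrict_space)

lemma rescaled_nonneg: "0 \<le> rescaled \<theta> \<epsilon> x"
  using \<theta> by (simp add: rescaled_def mollifier_def)

lemma rescaled_zero:
  assumes "\<epsilon> > 0" "norm x > \<epsilon>"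
  shows "rescaled \<theta> \<epsilon> x = 0"
proof -
  have "x /\<^sub>R \<epsilon> \<notin> tsupport \<theta>"
    using \<theta> assms by (force simp: mollifier_def field_simps)
  then show ?thesis by (simp add: rescaled_def zero_off_tsupport)
qed

lemma rescaled_bound: "\<exists>B\<ge>0. \<forall>\<epsilon>>0. \<forall>x. rescaled \<theta> \<epsilon> x \<le> B / \<epsilon> ^ DIM('a)"
proof -
  have "bounded (range \<theta>)"
    using \<theta> C_k_imp_continuous[of 0 \<theta>] by (intro continuous_compact_support_integrable) (auto simp: mollifier_def smooth_def)
  then obtain B where B: "\<And>x. \<bar>\<theta> x\<bar> \<le> B" by (auto simp: bounded_iff)
  have "B \<ge> 0" using B[of 0] by linarith
  moreover have "rescaled \<theta> \<epsilon> x \<le> B / \<epsilon> ^ DIM('a)" if "\<epsilon> > 0" for \<epsilon> x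
    using B[of "x /\<^sub>R \<epsilon>"] that by (simp add: rescaled_def powr_minus powr_realpow field_simps)
  ultimately show ?thesis by blast
qed

lemma nn_integral_rescaled:
  assumes "\<epsilon> > 0"
  shows "(\<integral>\<^sup>+y. ennreal (rescaled \<theta> \<epsilon> (x - y)) \<partial>lborel) = 1"
proof -
  have \<theta>i: "integrable lborel \<theta>" "(LINT x|lborel. \<theta> x) = 1"
    using \<theta> not_integrable_integral_eq[of lborel \<theta>] by (auto simp: mollifier_def)
  have eq: "rescaled \<theta> \<epsilon> (x - y) = \<epsilon> powr (- real DIM('a)) * \<theta> ((1 / \<epsilon>) *\<^sub>R x + (- 1 / \<epsilon>) *\<^sub>R y)" for y
    by (simp add: rescaled_def scaleR_diff_right divide_inverse)
  have i: "integrable lborel (\<lambda>y. rescaled \<theta> \<epsilon> (x - y))"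
    unfolding eq using assms by (intro integrable_mult_right lborel_integrable_scale \<theta>i) auto
  have "(LINT y|lborel. rescaled \<theta> \<epsilon> (x - y)) = \<epsilon> powr (- real DIM('a)) * \<epsilon> ^ DIM('a)"
  proof -
    have "(LINT y|lborel. \<theta> ((1 / \<epsilon>) *\<^sub>R x + (- 1 / \<epsilon>) *\<^sub>R y)) = (1 / \<bar>- 1 / \<epsilon>\<bar> ^ DIM('a)) *\<^sub>R (LINT y|lborel. \<theta> y)"
      using assms by (intro lborel_integral_scale) auto
    also have "\<dots> = \<epsilon> ^ DIM('a)" using assms \<theta>i by (simp add: power_divide)
    finally show ?thesis unfolding eq by simp
  qed
  also have "\<dots> = 1" using assms by (simp add: powr_minus powr_realpow)
  finally show ?thesis
    using nn_integral_eq_integral[OF i] by (simp add: rescaled_nonneg)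
qed

lemma inner_domain_ball:
  assumes "x \<in> inner_domain D \<epsilon>" "\<epsilon> > 0" "norm (x - y) \<le> \<epsilon>"
  shows "y \<in> D"
  using assms by (force simp: inner_domain_def)

lemma nn_integral_bump_measure:
  assumes x: "x \<in> inner_domain D \<epsilon>" "\<epsilon> > 0" and [measurable]: "h \<in> borel_measurable borel"
  shows "(\<integral>\<^sup>+y. h y \<partial>(bump_measure \<epsilon> x)) = (\<integral>\<^sup>+y. ennreal (rescaled \<theta> \<epsilon> (x - y)) * h y \<partial>lborel)"
proof -
  have [measurable]: "h \<in> borel_measurable (restrict_space lborel D)"
    "(\<lambda>y. ennreal (rescaled \<theta> \<epsilon> (x - y))) \<in> borel_measurable (restrict_space lborel D)"
    by (auto intro!: measurable_restrict_space1)
  have "(\<integral>\<^sup>+y. h y \<partial>(bump_measure \<epsilon> x)) = (\<integral>\<^sup>+y. ennreal (rescaled \<theta> \<epsilon> (x - y)) * h y * indicator D y \<partial>lborel)"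
    unfolding bump_measure_def
    by (subst nn_integral_density) (auto simp: nn_integral_restrict_space)
  also have "\<dots> = (\<integral>\<^sup>+y. ennreal (rescaled \<theta> \<epsilon> (x - y)) * h y \<partial>lborel)"
  proof (intro nn_integral_cong)
    fix y
    show "ennreal (rescaled \<theta> \<epsilon> (x - y)) * h y * indicator D y = ennreal (rescaled \<theta> \<epsilon> (x - y)) * h y"
      using inner_domain_ball[OF x, of y] rescaled_zero[OF x(2), of "x - y"]
      by (cases "norm (x - y) \<le> \<epsilon>") auto
  qed
  finally show ?thesis .
qed

lemma prob_space_bump_measure:
  assumes x: "x \<in> inner_domain D \<epsilon>" "\<epsilon> > 0"
  shows "prob_space (bump_measure \<epsilon> x)"
proof
  have "emeasure (bump_measure \<epsilon> x) (space (bump_measure \<epsilon> x)) = (\<integral>\<^sup>+y. 1 \<partial>(bump_measure \<epsilon> x))"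
    by simp
  also have "\<dots> = 1"
    using nn_integral_bump_measure[OF x, of "\<lambda>_. 1"] nn_integral_rescaled[OF x(2)] by simp
  finally show "emeasure (bump_measure \<epsilon> x) (space (bump_measure \<epsilon> x)) = 1" .
qed

lemma AE_bump_measure:
  assumes x: "\<epsilon> > 0"
  shows "AE y in bump_measure \<epsilon> x. norm (x - y) \<le> \<epsilon>"
proof -
  have m: "(\<lambda>y. ennreal (rescaled \<theta> \<epsilon> (x - y))) \<in> borel_measurable (restrict_space lborel D)"
    by (auto intro!: measurable_restrict_space1)
  show ?thesis
    unfolding bump_measure_def AE_density[OF m]
    using rescaled_zero[OF x, of "x - _"] by (intro AE_I2) (metis ennreal_0 less_irrefl not_le)
qed

lemma AE_bump_measure_neq:
  assumes x: "x \<in> inner_domain D \<epsilon>" "\<epsilon> > 0"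
  shows "AE y in bump_measure \<epsilon> x. y \<noteq> z"
proof -
  have m: "(\<lambda>y. ennreal (rescaled \<theta> \<epsilon> (x - y))) \<in> borel_measurable (restrict_space lborel D)"
    by (auto intro!: measurable_restrict_space1)
  have "AE y in lborel. y \<noteq> z" by (rule AE_lborel_singleton)
  then have "AE y in restrict_space lborel D. y \<noteq> z"
    by (subst AE_restrict_space_iff) auto
  then show ?thesis unfolding bump_measure_def AE_density[OF m] by eventually_elim simp
qed

text \<open>The bump has height of order \<open>\<epsilon>\<^sup>-\<^sup>d\<close> and the excess has integral of order \<open>\<epsilon>\<^sup>d\<close>, so the powers of \<open>\<epsilon>\<close>
  cancel.\<close>

lemma log_excess_potential_bound:
  "\<exists>C\<ge>0. \<forall>\<epsilon>>0. \<forall>x\<in>inner_domain D \<epsilon>. \<forall>z. (\<integral>\<^sup>+y. ennreal (log_excess \<epsilon> (z - y)) \<partial>(bump_measure \<epsilon> x)) \<le> ennreal C"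
proof -
  obtain B where B: "B \<ge> 0" "\<And>\<epsilon> x. \<epsilon> > 0 \<Longrightarrow> rescaled \<theta> \<epsilon> x \<le> B / \<epsilon> ^ DIM('a)"
    using rescaled_bound by blast
  have "(\<integral>\<^sup>+y. ennreal (log_excess \<epsilon> (z - y)) \<partial>(bump_measure \<epsilon> x)) \<le> ennreal (B * 2 * unit_ball_vol DIM('a))"
    if \<epsilon>: "\<epsilon> > 0" and x: "x \<in> inner_domain D \<epsilon>" for \<epsilon> x z
  proof -
    have "(\<integral>\<^sup>+y. ennreal (log_excess \<epsilon> (z - y)) \<partial>(bump_measure \<epsilon> x))
      = (\<integral>\<^sup>+y. ennreal (rescaled \<theta> \<epsilon> (x - y)) * ennreal (log_excess \<epsilon> (z - y)) \<partial>lborel)"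
      by (rule nn_integral_bump_measure[OF x \<epsilon>]) measurable
    also have "\<dots> \<le> (\<integral>\<^sup>+y. ennreal (B / \<epsilon> ^ DIM('a)) * ennreal (log_excess \<epsilon> (y - z)) \<partial>lborel)"
      using B \<epsilon> by (intro nn_integral_mono mult_mono ennreal_leI) (auto simp: log_excess_def norm_minus_commute)
    also have "\<dots> = ennreal (B / \<epsilon> ^ DIM('a)) * (\<integral>\<^sup>+y. ennreal (log_excess \<epsilon> (y - z)) \<partial>lborel)"
      by (rule nn_integral_cmult) measurable
    also have "(\<integral>\<^sup>+y. ennreal (log_excess \<epsilon> (y - z)) \<partial>lborel) = (\<integral>\<^sup>+y. ennreal (log_excess \<epsilon> (y::'a)) \<partial>lborel)"
      by (rule lborel_nn_integral_translate) measurable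
    also have "ennreal (B / \<epsilon> ^ DIM('a)) * \<dots> \<le> ennreal (B / \<epsilon> ^ DIM('a)) * ennreal (2 * unit_ball_vol DIM('a) * \<epsilon> ^ DIM('a))"
      by (intro mult_left_mono nn_integral_log_excess_le[OF \<epsilon>]) simp
    also have "\<dots> = ennreal (B * 2 * unit_ball_vol DIM('a))"
      using B(1) \<epsilon> by (simp flip: ennreal_mult)
    finally show ?thesis .
  qed
  then show ?thesis using B(1) by (intro exI[of _ "B * 2 * unit_ball_vol DIM('a)"]) auto
qed

text \<open>The balls of radius \<open>\<epsilon>\<close> around points of a compact set that are at distance \<open>\<ge> 2 \<epsilon>\<close> from
  the complement stay in a compact set which does not depend on \<open>\<epsilon>\<close>: large \<open>\<epsilon>\<close> are controlled by the
  definition of the inner domain, small \<open>\<epsilon>\<close> by compactness.\<close>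

lemma compact_neighbourhood:
  assumes S: "compact S" "S \<subseteq> D"
  shows "\<exists>C\<subseteq>D. compact C \<and> (\<forall>\<epsilon>\<in>{0<..<1}. \<forall>x\<in>S \<inter> inner_domain D \<epsilon>. \<forall>y. norm (x - y) \<le> \<epsilon> \<longrightarrow> y \<in> C)"
proof -
  obtain \<delta> where \<delta>: "\<delta> > 0" "\<And>x z. x \<in> S \<Longrightarrow> z \<notin> D \<Longrightarrow> \<delta> \<le> dist x z"
  proof -
    have "closed (- D)" "S \<inter> - D = {}" using D S by auto
    from separate_compact_closed[OF S(1) this] show ?thesis using that by auto
  qed
  obtain R where R: "\<And>x. x \<in> S \<Longrightarrow> norm x \<le> R" using S compact_imp_bounded bounded_iff by metis
  define C where "C = cball 0 (R + 1) \<inter> (\<Inter>z\<in>- D. {y. \<delta> / 2 \<le> dist y z})"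
  have "closed {y. \<delta> / 2 \<le> dist y z}" for z :: 'a
    by (intro closed_Collect_le continuous_intros)
  then have "compact C" unfolding C_def by (intro compact_Int_closed closed_INT) auto
  moreover have "C \<subseteq> D"
  proof
    fix y assume "y \<in> C"
    then have "\<And>z. z \<notin> D \<Longrightarrow> \<delta> / 2 \<le> dist y z" by (auto simp: C_def)
    from this[of y] show "y \<in> D" using \<delta>(1) by auto
  qed
  moreover have "y \<in> C" if \<epsilon>: "\<epsilon> \<in> {0<..<1}" and x: "x \<in> S" "x \<in> inner_domain D \<epsilon>" and y: "norm (x - y) \<le> \<epsilon>" for \<epsilon> x y
  proof -
    have "norm y \<le> R + 1"
      using R[OF x(1)] y \<epsilon> norm_triangle_ineq2[of y x] by (simp add: norm_minus_commute)
    moreover have "\<delta> / 2 \<le> dist y z" if z: "z \<notin> D" for z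
    proof -
      have "2 * \<epsilon> \<le> dist x z" using x(2) z by (auto simp: inner_domain_def dist_norm)
      moreover have "dist x z \<le> dist y z + \<epsilon>"
        using dist_triangle[of x z y] y by (simp add: dist_norm)
      ultimately show ?thesis using \<delta>(2)[OF x(1) z] by linarith
    qed
    ultimately show ?thesis by (auto simp: C_def)
  qed
  ultimately show ?thesis by blast
qed

text \<open>The real-valued kernel on \<open>D \<times> D\<close>, extended to a Borel function on the whole space. Its value on the
  diagonal is that of \<^const>\<open>real_of_ereal\<close> at \<open>\<infinity>\<close>.\<close>

definition kernel_value :: "'a \<times> 'a \<Rightarrow> real" where
  "kernel_value p = (if fst p = snd p then 0 else indicator (D \<times> D) p *\<^sub>R L p + ln (1 / norm (fst p - snd p)))"

lemma real_kernel: "x \<in> D \<Longrightarrow> y \<in> D \<Longrightarrow> real_of_ereal (K x y) = kernel_value (x, y)"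
  by (simp add: K kernel_value_def log_kernel_def)

lemma measurable_kernel_value[measurable]: "kernel_value \<in> borel_measurable (borel \<Otimes>\<^sub>M borel)"
proof -
  have "(\<lambda>p. indicator (D \<times> D) p *\<^sub>R L p) \<in> borel_measurable borel"
    using L by (intro borel_measurable_continuous_on_indicator borel_open open_Times D) auto
  then have [measurable]: "(\<lambda>p. indicator (D \<times> D) p *\<^sub>R L p) \<in> borel_measurable (borel \<Otimes>\<^sub>M borel)"
    by (simp add: borel_prod)
  have [measurable]: "Measurable.pred (borel \<Otimes>\<^sub>M borel) (\<lambda>p::'a \<times> 'a. fst p = snd p)"
    by measurable
  show ?thesis unfolding kernel_value_def[abs_def] by measurable
qed

text \<open>For \<open>r = |x' - y'|\<close> one has \<open>max |x - y| \<epsilon> \<le> r + 2 \<epsilon> \<le> 4 max r \<epsilon>\<close>, and \<open>ln (max r \<epsilon>) - ln r\<close> is the excess.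
  On the diagonal, where the kernel has the value \<open>0\<close>, the upper bound is nonnegative, because
  \<open>|x - y| \<le> 2 \<epsilon> < 2\<close> and \<open>A \<ge> ln 4\<close>.\<close>

lemma kernel_bounds:
  assumes S: "compact S" "S \<subseteq> D"
  shows "\<exists>A. \<forall>\<epsilon>\<in>{0<..<1}. \<forall>x\<in>S \<inter> inner_domain D \<epsilon>. \<forall>y\<in>S \<inter> inner_domain D \<epsilon>. \<forall>x' y'.
    norm (x - x') \<le> \<epsilon> \<longrightarrow> norm (y - y') \<le> \<epsilon> \<longrightarrow>
    kernel_value (x', y') \<le> A - ln (max (norm (x - y)) \<epsilon>) + log_excess \<epsilon> (x' - y') \<and>
    \<bar>kernel_value (x', y')\<bar> \<le> A + 2 * \<bar>ln \<epsilon>\<bar> + log_excess \<epsilon> (x' - y')"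
proof -
  obtain C where C: "C \<subseteq> D" "compact C" "\<And>\<epsilon> x y. \<epsilon> \<in> {0<..<1} \<Longrightarrow> x \<in> S \<inter> inner_domain D \<epsilon> \<Longrightarrow> norm (x - y) \<le> \<epsilon> \<Longrightarrow> y \<in> C"
    using compact_neighbourhood[OF S] by blast
  have "compact (L ` (C \<times> C))"
    using C by (intro compact_continuous_image compact_Times continuous_on_subset[OF L]) auto
  then obtain M where M: "\<And>x y. x \<in> C \<Longrightarrow> y \<in> C \<Longrightarrow> \<bar>L (x, y)\<bar> \<le> M"
  proof -
    have "bounded (L ` (C \<times> C))" using \<open>compact (L ` (C \<times> C))\<close> by (rule compact_imp_bounded)
    then obtain M where "\<forall>v\<in>L ` (C \<times> C). norm v \<le> M" unfolding bounded_iff by blast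
    then show ?thesis by (intro that[of M]) auto
  qed
  obtain R where R: "\<And>x. x \<in> C \<Longrightarrow> norm x \<le> R" using C compact_imp_bounded bounded_iff by metis
  define A where "A = max M 0 + ln 4 + ln (2 * max R 1)"
  have lnR: "ln (2 * max R 1) \<ge> 0" by simp
  have "kernel_value (x', y') \<le> A - ln (max (norm (x - y)) \<epsilon>) + log_excess \<epsilon> (x' - y') \<and>
    \<bar>kernel_value (x', y')\<bar> \<le> A + 2 * \<bar>ln \<epsilon>\<bar> + log_excess \<epsilon> (x' - y')"
    if \<epsilon>: "\<epsilon> \<in> {0<..<1}" and xy: "x \<in> S \<inter> inner_domain D \<epsilon>" "y \<in> S \<inter> inner_domain D \<epsilon>"
      and x': "norm (x - x') \<le> \<epsilon>" and y': "norm (y - y') \<le> \<epsilon>" for \<epsilon> x y x' y'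
  proof -
    have C': "x' \<in> C" "y' \<in> C" using C(3) \<epsilon> xy x' y' by blast+
    define r where "r = norm (x' - y')"
    define m where "m = max (norm (x - y)) \<epsilon>"
    have m: "m > 0" "m \<ge> \<epsilon>" using \<epsilon> by (auto simp: m_def)
    have tri: "norm (x - y) \<le> r + 2 * \<epsilon>"
    proof -
      have "x - y = (x - x') + (x' - y') + (y' - y)" by simp
      then have "norm (x - y) \<le> norm (x - x') + norm (x' - y') + norm (y' - y)"
        by (metis norm_triangle_ineq norm_triangle_le add_mono order_refl)
      then show ?thesis using x' y' by (simp add: r_def norm_minus_commute)
    qed
    show ?thesis
    proof (cases "x' = y'")
      case True
      then have "m \<le> 4" using tri \<epsilon> by (auto simp: r_def m_def)
      then have "ln m \<le> ln 4" using m by simp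
      moreover have "kernel_value (x', y') = 0" using True by (simp add: kernel_value_def)
      moreover have "max M 0 \<ge> 0" "ln 4 \<ge> (0::real)" by simp_all
      ultimately show ?thesis
        using lnR log_excess_nonneg[of \<epsilon> "x' - y'"] unfolding A_def m_def[symmetric] by linarith
    next
      case False
      then have r: "r > 0" by (simp add: r_def)
      have kv: "kernel_value (x', y') = L (x', y') - ln r"
      proof -
        have "(x', y') \<in> D \<times> D" using C C' by auto
        then show ?thesis using False by (simp add: kernel_value_def ln_div r_def)
      qed
      define b where "b = max (ln r) (ln \<epsilon>)"
      have b: "b \<ge> ln r" "b \<ge> ln \<epsilon>" by (simp_all add: b_def)
      have le: "log_excess \<epsilon> (x' - y') = b - ln r"
        using \<epsilon> r by (simp add: log_excess_def r_def ln_div b_def)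
      have "m \<le> 4 * max r \<epsilon>" using tri \<epsilon> r by (auto simp: m_def max_def)
      then have "ln m \<le> ln (4 * max r \<epsilon>)" using m r by simp
      also have "\<dots> = ln 4 + max (ln r) (ln \<epsilon>)" using r \<epsilon> by (auto simp: ln_mult max_def)
      finally have 1: "ln m \<le> ln 4 + b" by (simp add: b_def)
      have "r \<le> norm x' + norm y'" unfolding r_def by (rule norm_triangle_ineq4)
      also have "\<dots> \<le> 2 * max R 1" using R[OF C'(1)] R[OF C'(2)] by linarith
      finally have 2: "ln r \<le> ln (2 * max R 1)" using r by simp
      have "ln 4 \<ge> (0::real)" "M \<le> max M 0" by simp_all
      then show ?thesis
        using 1 2 b lnR M[OF C'] unfolding kv le m_def[symmetric] A_def by linarith
    qed
  qed
  then show ?thesis by blast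
qed

lemma AE_bump_measure_pair:
  assumes x: "x \<in> inner_domain D \<epsilon>" and y: "y \<in> inner_domain D \<epsilon>" and \<epsilon>: "\<epsilon> > 0"
  shows "AE p in bump_measure \<epsilon> x \<Otimes>\<^sub>M bump_measure \<epsilon> y. norm (x - fst p) \<le> \<epsilon> \<and> norm (y - snd p) \<le> \<epsilon>"
proof -
  interpret X: prob_space "bump_measure \<epsilon> x" by (rule prob_space_bump_measure[OF x \<epsilon>])
  interpret Y: prob_space "bump_measure \<epsilon> y" by (rule prob_space_bump_measure[OF y \<epsilon>])
  interpret XY: pair_sigma_finite "bump_measure \<epsilon> x" "bump_measure \<epsilon> y" by standard
  have id: "(\<lambda>z. z) \<in> bump_measure \<epsilon> w \<rightarrow>\<^sub>M borel" for w
    unfolding measurable_cong_sets[OF sets_bump_measure refl] by (rule measurable_restrict_space1) simp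
  have [measurable]: "fst \<in> bump_measure \<epsilon> x \<Otimes>\<^sub>M bump_measure \<epsilon> y \<rightarrow>\<^sub>M borel"
    "snd \<in> bump_measure \<epsilon> x \<Otimes>\<^sub>M bump_measure \<epsilon> y \<rightarrow>\<^sub>M borel"
    by (rule measurable_compose[OF measurable_fst id], rule measurable_compose[OF measurable_snd id])
  show ?thesis
  proof (rule XY.AE_pair_measure)
    show "AE x' in bump_measure \<epsilon> x. AE y' in bump_measure \<epsilon> y. norm (x - fst (x', y')) \<le> \<epsilon> \<and> norm (y - snd (x', y')) \<le> \<epsilon>"
      using AE_bump_measure[OF \<epsilon>, of x] by eventually_elim (use AE_bump_measure[OF \<epsilon>, of y] in auto)
  qed measurable
qed

lemma pair_lift_measurable:
  assumes [measurable]: "h \<in> borel_measurable (borel \<Otimes>\<^sub>M borel)"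
    and \<mu>: "sets \<mu> = sets (restrict_space borel D)" and \<nu>: "sets \<nu> = sets (restrict_space borel D)"
  shows "h \<in> borel_measurable (\<mu> \<Otimes>\<^sub>M \<nu>)"
proof -
  have id: "(\<lambda>z. z) \<in> restrict_space borel D \<rightarrow>\<^sub>M borel"
    by (rule measurable_restrict_space1) simp
  have "fst \<in> restrict_space borel D \<Otimes>\<^sub>M restrict_space borel D \<rightarrow>\<^sub>M borel"
    "snd \<in> restrict_space borel D \<Otimes>\<^sub>M restrict_space borel D \<rightarrow>\<^sub>M borel"
    by (rule measurable_compose[OF measurable_fst id], rule measurable_compose[OF measurable_snd id])
  then have "(\<lambda>p. h (fst p, snd p)) \<in> borel_measurable (restrict_space borel D \<Otimes>\<^sub>M restrict_space borel D)"
    by measurable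
  then show ?thesis
    by (simp add: measurable_cong_sets[OF sets_pair_measure_cong[OF \<mu> \<nu>] refl])
qed

lemma kernel_integral_eq_kernel_value:
  assumes \<mu>: "sets \<mu> = sets (restrict_space borel D)" and \<nu>: "sets \<nu> = sets (restrict_space borel D)"
  shows "kernel_integrable K \<mu> \<nu> \<longleftrightarrow> integrable (\<mu> \<Otimes>\<^sub>M \<nu>) kernel_value"
    "kernel_integral K \<mu> \<nu> = (LINT p|(\<mu> \<Otimes>\<^sub>M \<nu>). kernel_value p)"
proof -
  have sp: "space (\<mu> \<Otimes>\<^sub>M \<nu>) = D \<times> D"
    using sets_eq_imp_space_eq[OF \<mu>] sets_eq_imp_space_eq[OF \<nu>] by (simp add: space_pair_measure space_restrict_space)
  have eq: "(case p of (x, y) \<Rightarrow> real_of_ereal (K x y)) = kernel_value p" if "p \<in> space (\<mu> \<Otimes>\<^sub>M \<nu>)" for p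
    using that real_kernel unfolding sp by auto
  show "kernel_integrable K \<mu> \<nu> \<longleftrightarrow> integrable (\<mu> \<Otimes>\<^sub>M \<nu>) kernel_value"
    unfolding kernel_integrable_def using eq by (intro Bochner_Integration.integrable_cong) auto
  show "kernel_integral K \<mu> \<nu> = (LINT p|(\<mu> \<Otimes>\<^sub>M \<nu>). kernel_value p)"
    unfolding kernel_integral_def using eq by (intro Bochner_Integration.integral_cong) auto
qed

text \<open>A mollifier measure is the difference of a bump measure and the null measure, so the mixed terms in
  the covariance of two such differences have to vanish.\<close>

lemma kernel_null:
  assumes \<mu>: "sets \<mu> = sets (restrict_space borel D)" "finite_measure \<mu>"
  shows "kernel_integrable K \<mu> null_D" "kernel_integrable K null_D \<mu>" "kernel_integrable K null_D null_D"
    "kernel_integral K \<mu> null_D = 0" "kernel_integral K null_D \<mu> = 0" "kernel_integral K null_D null_D = 0"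
proof -
  have *: "kernel_integrable K \<mu>' \<nu>' \<and> kernel_integral K \<mu>' \<nu>' = 0"
    if s: "sets \<mu>' = sets (restrict_space borel D)" "sets \<nu>' = sets (restrict_space borel D)" "sigma_finite_measure \<nu>'"
      and z: "emeasure \<mu>' (space \<mu>') * emeasure \<nu>' (space \<nu>') = 0" for \<mu>' \<nu>'
  proof -
    interpret sigma_finite_measure \<nu>' by fact
    have "emeasure (\<mu>' \<Otimes>\<^sub>M \<nu>') (space (\<mu>' \<Otimes>\<^sub>M \<nu>')) = 0"
      unfolding space_pair_measure by (subst emeasure_pair_measure_Times) (auto simp: z)
    then have "AE p in \<mu>' \<Otimes>\<^sub>M \<nu>'. kernel_value p = 0"
      by (intro AE_I[where N="space (\<mu>' \<Otimes>\<^sub>M \<nu>')"]) auto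
    moreover have m: "kernel_value \<in> borel_measurable (\<mu>' \<Otimes>\<^sub>M \<nu>')"
      by (rule pair_lift_measurable[OF measurable_kernel_value s(1,2)])
    ultimately show ?thesis
      unfolding kernel_integral_eq_kernel_value[OF s(1,2)]
      by (auto simp: integrable_cong_AE[where g="\<lambda>_. 0"] intro: integral_eq_zero_AE)
  qed
  interpret M: finite_measure \<mu> by fact
  interpret N: finite_measure null_D by (rule finite_measureI) simp
  have sf: "sigma_finite_measure \<mu>" "sigma_finite_measure null_D" by unfold_locales
  show "kernel_integrable K \<mu> null_D" "kernel_integral K \<mu> null_D = 0"
    using *[OF \<mu>(1) _ sf(2)] by simp_all
  show "kernel_integrable K null_D \<mu>" "kernel_integral K null_D \<mu> = 0"
    using *[OF _ \<mu>(1) sf(1)] by simp_all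
  show "kernel_integrable K null_D null_D" "kernel_integral K null_D null_D = 0"
    using *[OF _ _ sf(2), of null_D] by simp_all
qed

lemma null_D_in_M_plus: "null_D \<in> M_plus D K"
proof -
  have "(\<integral>\<^sup>+x. (\<integral>\<^sup>+y. e2ennreal \<bar>K x y\<bar> \<partial>null_D) \<partial>null_D) = 0"
    by (simp add: nn_integral_null_measure)
  then show ?thesis by (simp add: M_plus_def)
qed

text \<open>The kernel is infinite on the diagonal, which the bump measure does not charge as it has a density.\<close>

lemma bump_measure_in_M_plus:
  assumes x: "x \<in> inner_domain D \<epsilon>" and \<epsilon>: "\<epsilon> \<in> {0<..<1}"
  shows "bump_measure \<epsilon> x \<in> M_plus D K"
proof -
  have e0: "\<epsilon> > 0" using \<epsilon> by simp
  interpret X: prob_space "bump_measure \<epsilon> x" by (rule prob_space_bump_measure[OF x e0])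
  have "compact {x}" "{x} \<subseteq> D" using x by (auto simp: inner_domain_def)
  from kernel_bounds[OF this] obtain A where A: "\<And>x' y'. norm (x - x') \<le> \<epsilon> \<Longrightarrow> norm (x - y') \<le> \<epsilon> \<Longrightarrow>
    \<bar>kernel_value (x', y')\<bar> \<le> A + 2 * \<bar>ln \<epsilon>\<bar> + log_excess \<epsilon> (x' - y')"
    using x \<epsilon> by blast
  obtain C where C: "C \<ge> 0" "\<And>z. (\<integral>\<^sup>+y. ennreal (log_excess \<epsilon> (z - y)) \<partial>(bump_measure \<epsilon> x)) \<le> ennreal C"
    using log_excess_potential_bound x e0 by blast
  let ?c = "ennreal (max 0 (A + 2 * \<bar>ln \<epsilon>\<bar>))"
  have id: "(\<lambda>z. z) \<in> bump_measure \<epsilon> x \<rightarrow>\<^sub>M borel"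
    unfolding measurable_cong_sets[OF sets_bump_measure refl] by (rule measurable_restrict_space1) simp
  have "(\<integral>\<^sup>+y. e2ennreal \<bar>K x' y\<bar> \<partial>(bump_measure \<epsilon> x)) \<le> ?c + ennreal C"
    if x': "norm (x - x') \<le> \<epsilon>" "x' \<in> D" for x'
  proof -
    have "(\<integral>\<^sup>+y. e2ennreal \<bar>K x' y\<bar> \<partial>(bump_measure \<epsilon> x)) \<le> (\<integral>\<^sup>+y. ?c + ennreal (log_excess \<epsilon> (x' - y)) \<partial>(bump_measure \<epsilon> x))"
    proof (rule nn_integral_mono_AE)
      show "AE y in bump_measure \<epsilon> x. e2ennreal \<bar>K x' y\<bar> \<le> ?c + ennreal (log_excess \<epsilon> (x' - y))"
        using AE_bump_measure[OF e0, of x] AE_bump_measure_neq[OF x e0, of x'] AE_space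
      proof eventually_elim
        case (elim y)
        then have y: "y \<in> D" "y \<noteq> x'" by (auto simp: space_bump_measure)
        have "\<bar>K x' y\<bar> = ereal \<bar>kernel_value (x', y)\<bar>"
          using y x' by (simp add: K kernel_value_def log_kernel_def)
        then have "e2ennreal \<bar>K x' y\<bar> = ennreal \<bar>kernel_value (x', y)\<bar>" by (simp add: ennreal.rep_eq e2ennreal_ereal)
        also have "\<dots> \<le> ennreal (max 0 (A + 2 * \<bar>ln \<epsilon>\<bar>) + log_excess \<epsilon> (x' - y))"
          using A[OF x'(1) elim(1)] by (intro ennreal_leI) linarith
        also have "\<dots> = ?c + ennreal (log_excess \<epsilon> (x' - y))"
          by (simp add: log_excess_nonneg)
        finally show ?case .
      qed
    qed
    also have "\<dots> = ?c + (\<integral>\<^sup>+y. ennreal (log_excess \<epsilon> (x' - y)) \<partial>(bump_measure \<epsilon> x))"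
      using id by (subst nn_integral_add) (auto simp: X.emeasure_space_1 intro!: measurable_compose[OF id])
    also have "\<dots> \<le> ?c + ennreal C" by (intro add_left_mono C)
    finally show ?thesis .
  qed
  then have "(\<integral>\<^sup>+x'. (\<integral>\<^sup>+y. e2ennreal \<bar>K x' y\<bar> \<partial>(bump_measure \<epsilon> x)) \<partial>(bump_measure \<epsilon> x))
    \<le> (\<integral>\<^sup>+x'. ?c + ennreal C \<partial>(bump_measure \<epsilon> x))"
  proof (intro nn_integral_mono_AE)
    assume *: "\<And>x'. norm (x - x') \<le> \<epsilon> \<Longrightarrow> x' \<in> D \<Longrightarrow> (\<integral>\<^sup>+y. e2ennreal \<bar>K x' y\<bar> \<partial>(bump_measure \<epsilon> x)) \<le> ?c + ennreal C"
    show "AE x' in bump_measure \<epsilon> x. (\<integral>\<^sup>+y. e2ennreal \<bar>K x' y\<bar> \<partial>(bump_measure \<epsilon> x)) \<le> ?c + ennreal C"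
      using AE_bump_measure[OF e0, of x] AE_space[of "bump_measure \<epsilon> x"]
      by eventually_elim (rule *, simp_all add: space_bump_measure)
  qed
  also have "\<dots> < \<infinity>" by (simp add: X.emeasure_space_1)
  finally show ?thesis using sets_bump_measure by (simp add: M_plus_def)
qed

lemma kernel_integral_bump_measure:
  assumes S: "compact S" "S \<subseteq> D"
  shows "\<exists>C. \<forall>\<epsilon>\<in>{0<..<1}. \<forall>x\<in>S \<inter> inner_domain D \<epsilon>. \<forall>y\<in>S \<inter> inner_domain D \<epsilon>.
    kernel_integrable K (bump_measure \<epsilon> x) (bump_measure \<epsilon> y) \<and>
    kernel_integral K (bump_measure \<epsilon> x) (bump_measure \<epsilon> y) \<le> C - ln (max (norm (x - y)) \<epsilon>)"
proof -
  from kernel_bounds[OF S] obtain A where A: "\<forall>\<epsilon>\<in>{0<..<1}. \<forall>x\<in>S \<inter> inner_domain D \<epsilon>. \<forall>y\<in>S \<inter> inner_domain D \<epsilon>. \<forall>x' y'.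
    norm (x - x') \<le> \<epsilon> \<longrightarrow> norm (y - y') \<le> \<epsilon> \<longrightarrow>
    kernel_value (x', y') \<le> A - ln (max (norm (x - y)) \<epsilon>) + log_excess \<epsilon> (x' - y') \<and>
    \<bar>kernel_value (x', y')\<bar> \<le> A + 2 * \<bar>ln \<epsilon>\<bar> + log_excess \<epsilon> (x' - y')" by blast
  obtain C where C: "C \<ge> 0" "\<And>\<epsilon> x z. \<epsilon> > 0 \<Longrightarrow> x \<in> inner_domain D \<epsilon> \<Longrightarrow>
      (\<integral>\<^sup>+y. ennreal (log_excess \<epsilon> (z - y)) \<partial>(bump_measure \<epsilon> x)) \<le> ennreal C"
    using log_excess_potential_bound by blast
  have "kernel_integrable K (bump_measure \<epsilon> x) (bump_measure \<epsilon> y) \<and>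
    kernel_integral K (bump_measure \<epsilon> x) (bump_measure \<epsilon> y) \<le> A + C - ln (max (norm (x - y)) \<epsilon>)"
    if \<epsilon>: "\<epsilon> \<in> {0<..<1}" and x: "x \<in> S \<inter> inner_domain D \<epsilon>" and y: "y \<in> S \<inter> inner_domain D \<epsilon>" for \<epsilon> x y
  proof -
    have e0: "\<epsilon> > 0" using \<epsilon> by simp
    have xy: "x \<in> inner_domain D \<epsilon>" "y \<in> inner_domain D \<epsilon>" using x y by auto
    interpret X: prob_space "bump_measure \<epsilon> x" by (rule prob_space_bump_measure[OF xy(1) e0])
    interpret Y: prob_space "bump_measure \<epsilon> y" by (rule prob_space_bump_measure[OF xy(2) e0])
    interpret XY: pair_prob_space "bump_measure \<epsilon> x" "bump_measure \<epsilon> y" by standard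
    let ?P = "bump_measure \<epsilon> x \<Otimes>\<^sub>M bump_measure \<epsilon> y"
    let ?l = "\<lambda>p. log_excess \<epsilon> (fst p - snd p)"
    have AE: "AE p in ?P. kernel_value p \<le> A - ln (max (norm (x - y)) \<epsilon>) + ?l p \<and> \<bar>kernel_value p\<bar> \<le> A + 2 * \<bar>ln \<epsilon>\<bar> + ?l p"
      using AE_bump_measure_pair[OF xy e0]
    proof eventually_elim
      case (elim p)
      then show ?case using A[rule_format, OF \<epsilon> x y, of "fst p" "snd p"] by simp
    qed
    have [measurable]: "kernel_value \<in> borel_measurable ?P"
      by (rule pair_lift_measurable[OF measurable_kernel_value sets_bump_measure sets_bump_measure])
    have lm[measurable]: "?l \<in> borel_measurable ?P"
      by (rule pair_lift_measurable[OF _ sets_bump_measure sets_bump_measure]) measurable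
    have "(\<integral>\<^sup>+p. ennreal (?l p) \<partial>?P) = (\<integral>\<^sup>+x'. \<integral>\<^sup>+y'. ennreal (log_excess \<epsilon> (x' - y')) \<partial>(bump_measure \<epsilon> y) \<partial>(bump_measure \<epsilon> x))"
      by (subst Y.nn_integral_fst[symmetric]) auto
    also have "\<dots> \<le> (\<integral>\<^sup>+x'. ennreal C \<partial>(bump_measure \<epsilon> x))"
      by (intro nn_integral_mono C xy e0)
    also have "\<dots> = ennreal C" by (simp add: X.emeasure_space_1)
    finally have l: "(\<integral>\<^sup>+p. ennreal (?l p) \<partial>?P) \<le> ennreal C" .
    have li: "integrable ?P ?l"
      using l by (intro integrableI_bounded) (auto simp: log_excess_nonneg le_less_trans)
    have "(LINT p|?P. ?l p) \<le> C"
      using l nn_integral_eq_integral[OF li] C(1) by (simp add: log_excess_nonneg)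
    have ki: "integrable ?P kernel_value"
    proof (rule Bochner_Integration.integrable_bound)
      show "integrable ?P (\<lambda>p. A + 2 * \<bar>ln \<epsilon>\<bar> + ?l p)" using li by simp
      show "AE p in ?P. norm (kernel_value p) \<le> norm (A + 2 * \<bar>ln \<epsilon>\<bar> + ?l p)"
        using AE by eventually_elim (simp add: abs_le_iff)
    qed simp
    have "(LINT p|?P. kernel_value p) \<le> (LINT p|?P. A - ln (max (norm (x - y)) \<epsilon>) + ?l p)"
      using AE ki li by (intro integral_mono_AE) auto
    also have "\<dots> = A - ln (max (norm (x - y)) \<epsilon>) + (LINT p|?P. ?l p)"
      using li by (simp add: XY.prob_space)
    also have "\<dots> \<le> A + C - ln (max (norm (x - y)) \<epsilon>)" using \<open>(LINT p|?P. ?l p) \<le> C\<close> by simp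
    finally show ?thesis
      using ki by (simp add: kernel_integral_eq_kernel_value[OF sets_bump_measure sets_bump_measure])
  qed
  then show ?thesis by blast
qed

lemma mollifier_measure_eq: "mollifier_measure D \<theta> \<epsilon> x = measure_diff D (bump_measure \<epsilon> x) null_D"
  by (simp add: mollifier_measure_def bump_measure_def)

lemma mollifier_measure_in_M_signed:
  "x \<in> inner_domain D \<epsilon> \<Longrightarrow> \<epsilon> \<in> {0<..<1} \<Longrightarrow> mollifier_measure D \<theta> \<epsilon> x \<in> M_signed D K"
  unfolding mollifier_measure_eq M_signed_def using bump_measure_in_M_plus null_D_in_M_plus by blast

lemma mollified_covariance_le:
  assumes S: "compact S" "S \<subseteq> D" and X: "gaussian_field P D K X"
  shows "\<exists>C. \<forall>\<epsilon>\<in>{0<..<1}. \<forall>x\<in>S \<inter> inner_domain D \<epsilon>. \<forall>y\<in>S \<inter> inner_domain D \<epsilon>.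
    (LINT \<omega>|P. X (mollifier_measure D \<theta> \<epsilon> x) \<omega> * X (mollifier_measure D \<theta> \<epsilon> y) \<omega>)
      \<le> C - ln (max (norm (x - y)) \<epsilon>)"
proof -
  obtain C where C: "\<forall>\<epsilon>\<in>{0<..<1}. \<forall>x\<in>S \<inter> inner_domain D \<epsilon>. \<forall>y\<in>S \<inter> inner_domain D \<epsilon>.
    kernel_integrable K (bump_measure \<epsilon> x) (bump_measure \<epsilon> y) \<and>
    kernel_integral K (bump_measure \<epsilon> x) (bump_measure \<epsilon> y) \<le> C - ln (max (norm (x - y)) \<epsilon>)"
    using kernel_integral_bump_measure[OF S] by blast
  have "(LINT \<omega>|P. X (mollifier_measure D \<theta> \<epsilon> x) \<omega> * X (mollifier_measure D \<theta> \<epsilon> y) \<omega>)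
      \<le> C - ln (max (norm (x - y)) \<epsilon>)"
    if \<epsilon>: "\<epsilon> \<in> {0<..<1}" and x: "x \<in> S \<inter> inner_domain D \<epsilon>" and y: "y \<in> S \<inter> inner_domain D \<epsilon>" for \<epsilon> x y
  proof -
    have fin: "finite_measure (bump_measure \<epsilon> z)" if "z \<in> inner_domain D \<epsilon>" for z
      using prob_space_bump_measure[OF that] \<epsilon> by (auto simp: prob_space_def)
    have M: "bump_measure \<epsilon> x \<in> M_plus D K" "bump_measure \<epsilon> y \<in> M_plus D K"
      using x y \<epsilon> bump_measure_in_M_plus by auto
    note nx = kernel_null[OF sets_bump_measure fin, of x] and ny = kernel_null[OF sets_bump_measure fin, of y]
    have "\<forall>\<mu>\<^sub>1\<in>M_plus D K. \<forall>\<mu>\<^sub>2\<in>M_plus D K. \<forall>\<nu>\<^sub>1\<in>M_plus D K. \<forall>\<nu>\<^sub>2\<in>M_plus D K.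
        kernel_integrable K \<mu>\<^sub>1 \<nu>\<^sub>1 \<and> kernel_integrable K \<mu>\<^sub>1 \<nu>\<^sub>2 \<and>
        kernel_integrable K \<mu>\<^sub>2 \<nu>\<^sub>1 \<and> kernel_integrable K \<mu>\<^sub>2 \<nu>\<^sub>2 \<longrightarrow>
        (LINT \<omega>|P. X (measure_diff D \<mu>\<^sub>1 \<mu>\<^sub>2) \<omega> * X (measure_diff D \<nu>\<^sub>1 \<nu>\<^sub>2) \<omega>) =
          kernel_integral K \<mu>\<^sub>1 \<nu>\<^sub>1 - kernel_integral K \<mu>\<^sub>1 \<nu>\<^sub>2
          - kernel_integral K \<mu>\<^sub>2 \<nu>\<^sub>1 + kernel_integral K \<mu>\<^sub>2 \<nu>\<^sub>2"
      using X unfolding gaussian_field_def by (rule conjunct2)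
    from this[rule_format, OF M(1) null_D_in_M_plus M(2) null_D_in_M_plus]
    have "(LINT \<omega>|P. X (mollifier_measure D \<theta> \<epsilon> x) \<omega> * X (mollifier_measure D \<theta> \<epsilon> y) \<omega>)
      = kernel_integral K (bump_measure \<epsilon> x) (bump_measure \<epsilon> y)"
      unfolding mollifier_measure_eq using C \<epsilon> x y nx ny by simp
    then show ?thesis using C \<epsilon> x y by simp
  qed
  then show ?thesis by blast
qed

end

section \<open>Second moments of integrals of random functions\<close>

text \<open>A function that is continuous in one variable and measurable in the other is a pointwise limit of
  its values at nearby points of a countable dense set.\<close>

lemma measurable_caratheodory:
  fixes Y :: "'a::euclidean_space \<Rightarrow> 'w \<Rightarrow> real"
  assumes A: "A \<in> sets borel" and m: "\<And>x. x \<in> A \<Longrightarrow> Y x \<in> borel_measurable P"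
    and c: "\<And>\<omega>. \<omega> \<in> space P \<Longrightarrow> continuous_on A (\<lambda>x. Y x \<omega>)"
  shows "(\<lambda>(x, \<omega>). indicator A x * Y x \<omega>) \<in> borel_measurable (borel \<Otimes>\<^sub>M P)"
proof (cases "A = {}")
  case False
  obtain T where T: "countable T" "T \<subseteq> A" "A \<subseteq> closure T" by (rule separable)
  with False have T0: "T \<noteq> {}" by auto
  define q where "q = from_nat_into T"
  have q: "q k \<in> A" for k using from_nat_into[OF T0, of k] T(2) by (auto simp: q_def)
  have qr: "range q = T" unfolding q_def by (rule range_from_nat_into[OF T0 T(1)])
  define \<kappa> where "\<kappa> n x = (LEAST k. dist (q k) x < 1 / real (Suc n))" for n x
  have [measurable]: "\<kappa> n \<in> measurable borel (count_space UNIV)" for n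
    unfolding \<kappa>_def by measurable
  have [measurable]: "Y (q k) \<in> borel_measurable P" for k by (rule m[OF q])
  have \<kappa>: "dist (q (\<kappa> n x)) x < 1 / real (Suc n)" if "x \<in> A" for n x
  proof -
    have "x \<in> closure T" using T that by blast
    then have "\<forall>e>0. \<exists>y\<in>T. dist y x < e" by (simp only: closure_approachable)
    from this[rule_format, of "1 / real (Suc n)"] obtain y where y: "y \<in> T" "dist y x < 1 / real (Suc n)" by auto
    then obtain k where "q k = y" using qr by blast
    with y have "dist (q k) x < 1 / real (Suc n)" by simp
    then show ?thesis unfolding \<kappa>_def by (rule LeastI)
  qed
  show ?thesis
  proof (rule borel_measurable_LIMSEQ_real)
    show "(\<lambda>p. indicator A (fst p) * Y (q (\<kappa> n (fst p))) (snd p)) \<in> borel_measurable (borel \<Otimes>\<^sub>M P)" for n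
    proof -
      have [measurable]: "A \<in> sets borel" by (rule A)
      have "(\<lambda>p. Y (q (\<kappa> n (fst p))) (snd p)) \<in> borel_measurable (borel \<Otimes>\<^sub>M P)"
        by (rule measurable_compose_countable[of "\<lambda>k p. Y (q k) (snd p)"]) measurable
      then show ?thesis by measurable
    qed
    fix p :: "'a \<times> 'w" assume "p \<in> space (borel \<Otimes>\<^sub>M P)"
    then obtain x \<omega> where p: "p = (x, \<omega>)" "\<omega> \<in> space P" by (auto simp: space_pair_measure)
    show "(\<lambda>n. indicator A (fst p) * Y (q (\<kappa> n (fst p))) (snd p)) \<longlonglongrightarrow> (case p of (x, \<omega>) \<Rightarrow> indicator A x * Y x \<omega>)"
    proof (cases "x \<in> A")
      case True
      have "(\<lambda>n. dist (q (\<kappa> n x)) x) \<longlonglongrightarrow> 0"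
      proof (rule real_tendsto_sandwich[of "\<lambda>_. 0" _ _ "\<lambda>n. 1 / real (Suc n)"])
        show "(\<lambda>n. 1 / real (Suc n)) \<longlonglongrightarrow> 0" using LIMSEQ_inverse_real_of_nat by (simp add: field_simps)
      qed (use \<kappa>[OF True] in \<open>auto intro!: always_eventually less_imp_le\<close>)
      then have "(\<lambda>n. q (\<kappa> n x)) \<longlonglongrightarrow> x" by (rule tendsto_dist_iff[THEN iffD2])
      then have "(\<lambda>n. Y (q (\<kappa> n x)) \<omega>) \<longlonglongrightarrow> Y x \<omega>"
        using continuous_on_tendsto_compose[OF c[OF p(2)], of "\<lambda>n. q (\<kappa> n x)" x sequentially] q True by simp
      then show ?thesis using p True by simp
    qed (simp add: p)
  qed
qed simp

text \<open>The squared modulus of an integral is a double integral, and Fubini's theorem moves the expectation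
  inside.\<close>

lemma second_moment_integral:
  fixes G :: "'a \<Rightarrow> 'w \<Rightarrow> complex"
  assumes N: "sigma_finite_measure N" and P: "prob_space P"
    and m[measurable]: "(\<lambda>(x, \<omega>). G x \<omega>) \<in> borel_measurable (N \<Otimes>\<^sub>M P)"
    and path: "\<And>\<omega>. \<omega> \<in> space P \<Longrightarrow> integrable N (\<lambda>x. G x \<omega>)"
    and fin: "(\<integral>\<^sup>+x. \<integral>\<^sup>+y. \<integral>\<^sup>+\<omega>. ennreal (norm (G x \<omega>) * norm (G y \<omega>)) \<partial>P \<partial>N \<partial>N) < \<infinity>"
    and cov: "\<And>x y. x \<in> space N \<Longrightarrow> y \<in> space N \<Longrightarrow> norm (LINT \<omega>|P. G x \<omega> * cnj (G y \<omega>)) \<le> \<kappa> x y"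
  shows "(\<integral>\<^sup>+\<omega>. ennreal ((norm (LINT x|N. G x \<omega>))\<^sup>2) \<partial>P) \<le> (\<integral>\<^sup>+x. \<integral>\<^sup>+y. ennreal (\<kappa> x y) \<partial>N \<partial>N)"
proof -
  interpret N: sigma_finite_measure N by fact
  interpret P: prob_space P by fact
  interpret NN: pair_sigma_finite N N by standard
  interpret NNs: sigma_finite_measure "N \<Otimes>\<^sub>M N" by (rule NN.P.sigma_finite_measure_axioms)
  interpret T: pair_sigma_finite "N \<Otimes>\<^sub>M N" P by standard
  let ?\<Phi> = "\<lambda>(p, \<omega>). G (fst p) \<omega> * cnj (G (snd p) \<omega>)"
  have [measurable]: "cnj \<in> borel_measurable borel"
    by (intro borel_measurable_continuous_onI continuous_intros)
  have m1[measurable]: "(\<lambda>z. G (f z) (h z)) \<in> borel_measurable M" if "f \<in> M \<rightarrow>\<^sub>M N" "h \<in> M \<rightarrow>\<^sub>M P" for f h M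
    using measurable_compose[OF measurable_Pair[OF that] m] by simp
  have \<Phi>m[measurable]: "?\<Phi> \<in> borel_measurable ((N \<Otimes>\<^sub>M N) \<Otimes>\<^sub>M P)" by measurable
  have int: "integrable ((N \<Otimes>\<^sub>M N) \<Otimes>\<^sub>M P) ?\<Phi>"
  proof (rule integrableI_bounded[OF \<Phi>m])
    have "(\<integral>\<^sup>+z. ennreal (norm (?\<Phi> z)) \<partial>((N \<Otimes>\<^sub>M N) \<Otimes>\<^sub>M P)) = (\<integral>\<^sup>+p. \<integral>\<^sup>+\<omega>. ennreal (norm (?\<Phi> (p, \<omega>))) \<partial>P \<partial>(N \<Otimes>\<^sub>M N))"
      by (rule P.nn_integral_fst[symmetric]) measurable
    also have "\<dots> = (\<integral>\<^sup>+x. \<integral>\<^sup>+y. \<integral>\<^sup>+\<omega>. ennreal (norm (?\<Phi> ((x, y), \<omega>))) \<partial>P \<partial>N \<partial>N)"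
      by (rule N.nn_integral_fst[symmetric]) measurable
    also have "\<dots> < \<infinity>" using fin by (simp add: norm_mult)
    finally show "(\<integral>\<^sup>+z. ennreal (norm (?\<Phi> z)) \<partial>((N \<Otimes>\<^sub>M N) \<Otimes>\<^sub>M P)) < \<infinity>" .
  qed
  have sq: "complex_of_real ((norm (LINT x|N. G x \<omega>))\<^sup>2) = (LINT p|(N \<Otimes>\<^sub>M N). ?\<Phi> (p, \<omega>))" if \<omega>: "\<omega> \<in> space P" for \<omega>
  proof -
    have [measurable]: "(\<lambda>x. G x \<omega>) \<in> borel_measurable N" using \<omega> by measurable
    have i: "integrable (N \<Otimes>\<^sub>M N) (\<lambda>(x, y). G x \<omega> * cnj (G y \<omega>))"
    proof (rule NN.Fubini_integrable)
      show "integrable N (\<lambda>x. LINT y|N. norm (case (x, y) of (x, y) \<Rightarrow> G x \<omega> * cnj (G y \<omega>)))"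
        using path[OF \<omega>] by (simp add: norm_mult)
      show "AE x in N. integrable N (\<lambda>y. case (x, y) of (x, y) \<Rightarrow> G x \<omega> * cnj (G y \<omega>))"
        using path[OF \<omega>] by simp
    qed measurable
    have "(LINT p|(N \<Otimes>\<^sub>M N). ?\<Phi> (p, \<omega>)) = (LINT p|(N \<Otimes>\<^sub>M N). (case p of (x, y) \<Rightarrow> G x \<omega> * cnj (G y \<omega>)))"
      by (intro Bochner_Integration.integral_cong) auto
    also have "\<dots> = (LINT x|N. LINT y|N. G x \<omega> * cnj (G y \<omega>))"
      using NN.integral_fst'[OF i] by simp
    also have "\<dots> = (LINT x|N. G x \<omega>) * cnj (LINT y|N. G y \<omega>)"
      using path[OF \<omega>] by simp
    also have "\<dots> = complex_of_real ((norm (LINT x|N. G x \<omega>))\<^sup>2)" by (simp only: complex_norm_square)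
    finally show ?thesis ..
  qed
  have i2: "integrable P (\<lambda>\<omega>. LINT p|(N \<Otimes>\<^sub>M N). ?\<Phi> (p, \<omega>))"
    using T.integrable_snd[OF int] by (simp add: case_prod_beta')
  then have ic: "integrable P (\<lambda>\<omega>. complex_of_real ((norm (LINT x|N. G x \<omega>))\<^sup>2))"
    by (simp only: Bochner_Integration.integrable_cong[OF refl sq])
  then have ir: "integrable P (\<lambda>\<omega>. (norm (LINT x|N. G x \<omega>))\<^sup>2)"
    by (rule complex_of_real_integrable_eq[THEN iffD1])
  let ?E = "LINT \<omega>|P. (norm (LINT x|N. G x \<omega>))\<^sup>2"
  have E0: "?E \<ge> 0" by simp
  have "complex_of_real ?E = (LINT \<omega>|P. LINT p|(N \<Otimes>\<^sub>M N). ?\<Phi> (p, \<omega>))"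
    unfolding integral_complex_of_real[symmetric] by (intro Bochner_Integration.integral_cong sq) auto
  also have "\<dots> = (LINT p|(N \<Otimes>\<^sub>M N). LINT \<omega>|P. ?\<Phi> (p, \<omega>))"
    using T.Fubini_integral[OF int] by simp
  finally have eqE: "complex_of_real ?E = (LINT p|(N \<Otimes>\<^sub>M N). LINT \<omega>|P. ?\<Phi> (p, \<omega>))" .
  have "?E = norm (complex_of_real ?E)" using E0 by (simp only: norm_of_real abs_of_nonneg)
  also have "\<dots> = norm (LINT p|(N \<Otimes>\<^sub>M N). LINT \<omega>|P. ?\<Phi> (p, \<omega>))" by (simp only: eqE)
  finally have "?E = norm (LINT p|(N \<Otimes>\<^sub>M N). LINT \<omega>|P. ?\<Phi> (p, \<omega>))" .
  then have "ennreal ?E \<le> (\<integral>\<^sup>+p. ennreal (norm (LINT \<omega>|P. ?\<Phi> (p, \<omega>))) \<partial>(N \<Otimes>\<^sub>M N))"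
    using T.integrable_fst'[OF int] by (simp add: integral_norm_bound_ennreal)
  also have "\<dots> = (\<integral>\<^sup>+x. \<integral>\<^sup>+y. ennreal (norm (LINT \<omega>|P. ?\<Phi> ((x, y), \<omega>))) \<partial>N \<partial>N)"
    by (rule N.nn_integral_fst[symmetric]) measurable
  also have "\<dots> \<le> (\<integral>\<^sup>+x. \<integral>\<^sup>+y. ennreal (\<kappa> x y) \<partial>N \<partial>N)"
    using cov by (intro nn_integral_mono ennreal_leI) simp
  finally show ?thesis using nn_integral_eq_integral[OF ir] by simp
qed

section \<open>The normalized energy integral\<close>

text \<open>Above the critical modulus the powers of \<open>\<epsilon>\<close> in the squared normalization and in the integral cancel.
  At the critical modulus the integral is at most an affine function of \<open>log (1 / \<epsilon>)\<close>; dividing it by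
  \<open>log (1 / \<epsilon>)\<close> leaves a bounded quantity only if \<open>\<epsilon>\<close> stays away from \<open>1\<close>.\<close>

lemma normalized_energy_bound:
  assumes crit: "cmod \<gamma> \<ge> sqrt DIM('a::euclidean_space)"
    and I: "I \<subseteq> {0<..<1}" "cmod \<gamma> = sqrt DIM('a) \<Longrightarrow> \<exists>\<epsilon>\<^sub>0<1. \<forall>\<epsilon>\<in>I. \<epsilon> \<le> \<epsilon>\<^sub>0"
  shows "\<exists>C\<ge>0. \<forall>\<epsilon>\<in>I. ennreal ((normalization_const \<epsilon> (\<theta> :: 'a \<Rightarrow> real) \<gamma>)\<^sup>2) *
    (\<integral>\<^sup>+w. ennreal (max (norm w) \<epsilon> powr (- (cmod \<gamma>)\<^sup>2)) * indicator (ball (0::'a) R) w \<partial>lborel) \<le> ennreal C"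
proof (cases "cmod \<gamma> > sqrt DIM('a)")
  case True
  define g where "g = (cmod \<gamma>)\<^sup>2"
  have g: "g > DIM('a)"
    using power_strict_mono[OF True, of 2] by (simp add: g_def)
  define c where "c = ((1 / 2) * (LINT z|lborel. exp ((cmod \<gamma>)\<^sup>2 * ell \<theta> z))) powr (- 1 / 2)"
  have q: "2 powr (DIM('a) - g) < (1::real)"
    using g powr_less_mono[of "DIM('a) - g" 0 2] by simp
  define C where "C = c\<^sup>2 * (unit_ball_vol DIM('a) * 2 ^ DIM('a) / (1 - 2 powr (DIM('a) - g)))"
  have C0: "C \<ge> 0" using q by (simp add: C_def)
  have "ennreal ((normalization_const \<epsilon> \<theta> \<gamma>)\<^sup>2) *
    (\<integral>\<^sup>+w. ennreal (max (norm w) \<epsilon> powr (- g)) * indicator (ball (0::'a) R) w \<partial>lborel) \<le> ennreal C" if "\<epsilon> \<in> I" for \<epsilon>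
  proof -
    have \<epsilon>: "\<epsilon> > 0" using that I by auto
    have v: "(normalization_const \<epsilon> \<theta> \<gamma>)\<^sup>2 = c\<^sup>2 * \<epsilon> powr (g - DIM('a))"
    proof -
      have "normalization_const \<epsilon> \<theta> \<gamma> = \<epsilon> powr ((g - DIM('a)) / 2) * c"
        using True by (simp add: normalization_const_def g_def c_def)
      moreover have "(\<epsilon> powr ((g - DIM('a)) / 2))\<^sup>2 = \<epsilon> powr (g - DIM('a))"
        by (simp add: power2_eq_square flip: powr_add)
      ultimately show ?thesis by (simp add: power_mult_distrib)
    qed
    have "(\<integral>\<^sup>+w. ennreal (max (norm w) \<epsilon> powr (- g)) * indicator (ball (0::'a) R) w \<partial>lborel)
      \<le> (\<integral>\<^sup>+w. ennreal (max (norm (w::'a)) \<epsilon> powr (- g)) \<partial>lborel)"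
      by (intro nn_integral_mono) (simp add: indicator_def)
    also have "\<dots> \<le> ennreal (unit_ball_vol DIM('a) * 2 ^ DIM('a) * \<epsilon> powr (DIM('a) - g) / (1 - 2 powr (DIM('a) - g)))"
      by (rule nn_integral_truncated_power[OF \<epsilon> g])
    finally have "ennreal ((normalization_const \<epsilon> \<theta> \<gamma>)\<^sup>2) *
      (\<integral>\<^sup>+w. ennreal (max (norm w) \<epsilon> powr (- g)) * indicator (ball (0::'a) R) w \<partial>lborel)
      \<le> ennreal (c\<^sup>2 * \<epsilon> powr (g - DIM('a))) * ennreal (unit_ball_vol DIM('a) * 2 ^ DIM('a) * \<epsilon> powr (DIM('a) - g) / (1 - 2 powr (DIM('a) - g)))"
      unfolding v by (intro mult_left_mono) auto
    also have "\<dots> = ennreal (c\<^sup>2 * \<epsilon> powr (g - DIM('a)) * (unit_ball_vol DIM('a) * 2 ^ DIM('a) * \<epsilon> powr (DIM('a) - g) / (1 - 2 powr (DIM('a) - g))))"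
      using q by (intro ennreal_mult[symmetric]) auto
    also have "c\<^sup>2 * \<epsilon> powr (g - DIM('a)) * (unit_ball_vol DIM('a) * 2 ^ DIM('a) * \<epsilon> powr (DIM('a) - g) / (1 - 2 powr (DIM('a) - g)))
      = C * (\<epsilon> powr (g - DIM('a)) * \<epsilon> powr (DIM('a) - g))" by (simp add: C_def)
    also have "\<epsilon> powr (g - DIM('a)) * \<epsilon> powr (DIM('a) - g) = 1" using \<epsilon> by (simp flip: powr_add)
    finally show ?thesis by simp
  qed
  then show ?thesis using C0 unfolding g_def by blast
next
  case False
  with crit have eq: "cmod \<gamma> = sqrt DIM('a)" by simp
  then have g: "(cmod \<gamma>)\<^sup>2 = DIM('a)" by simp
  obtain \<epsilon>\<^sub>0 where e0: "\<epsilon>\<^sub>0 < 1" "\<And>\<epsilon>. \<epsilon> \<in> I \<Longrightarrow> \<epsilon> \<le> \<epsilon>\<^sub>0" using I(2)[OF eq] by blast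
  define c where "c = pi powr (real DIM('a) / 2) / Gamma (real DIM('a) / 2)"
  have c: "c > 0" unfolding c_def by (intro divide_pos_pos Gamma_real_pos) auto
  define V where "V = unit_ball_vol DIM('a) * 2 ^ DIM('a)"
  have V: "V \<ge> 0" by (simp add: V_def)
  define R' where "R' = max R 1"
  define C where "C = V * ((log 2 R' + 3) / (c * ln (1 / max \<epsilon>\<^sub>0 (1/2))) + 1 / (c * ln 2))"
  have l0: "ln (1 / max \<epsilon>\<^sub>0 (1/2)) > 0" using e0 by (intro ln_gt_zero) (auto simp: field_simps max_def)
  have lR: "log 2 R' \<ge> 0" by (simp add: R'_def)
  have C0: "C \<ge> 0" unfolding C_def using V c l0 lR by (intro mult_nonneg_nonneg add_nonneg_nonneg divide_nonneg_nonneg) auto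
  have "ennreal ((normalization_const \<epsilon> \<theta> \<gamma>)\<^sup>2) *
    (\<integral>\<^sup>+w. ennreal (max (norm w) \<epsilon> powr (- (cmod \<gamma>)\<^sup>2)) * indicator (ball (0::'a) R) w \<partial>lborel) \<le> ennreal C" if "\<epsilon> \<in> I" for \<epsilon>
  proof -
    have \<epsilon>: "\<epsilon> > 0" "\<epsilon> < 1" "\<epsilon> \<le> \<epsilon>\<^sub>0" using that I e0 by auto
    define l where "l = ln (1 / \<epsilon>)"
    have "ln (1 / max \<epsilon>\<^sub>0 (1/2)) \<le> l"
      unfolding l_def using \<epsilon> by (subst ln_le_cancel_iff) (auto simp: field_simps max_def)
    with l0 have l: "l > 0" "ln (1 / max \<epsilon>\<^sub>0 (1/2)) \<le> l" by linarith+
    have v: "(normalization_const \<epsilon> \<theta> \<gamma>)\<^sup>2 = 1 / (c * l)"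
    proof -
      have "normalization_const \<epsilon> \<theta> \<gamma> = (c * l) powr (- 1 / 2)"
        using False by (simp add: normalization_const_def c_def l_def)
      then have "(normalization_const \<epsilon> \<theta> \<gamma>)\<^sup>2 = (c * l) powr (- 1)"
        by (simp add: power2_eq_square flip: powr_add)
      then show ?thesis using c l by (simp add: powr_minus_divide)
    qed
    define n where "n = nat \<lceil>log 2 (R' / \<epsilon>)\<rceil> + 1"
    have lg: "log 2 (R' / \<epsilon>) = log 2 R' + l / ln 2"
      using \<epsilon> by (simp add: l_def log_def ln_div R'_def field_simps)
    have lg0: "log 2 (R' / \<epsilon>) \<ge> 0" unfolding lg using lR l by simp
    have n1: "real n \<le> log 2 R' + l / ln 2 + 2"
      using lg0 unfolding n_def lg[symmetric] by simp linarith
    have "R' / \<epsilon> < 2 ^ n"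
    proof -
      have "log 2 (R' / \<epsilon>) < real n" using lg0 unfolding n_def by simp linarith
      then show ?thesis using \<epsilon> by (simp add: log_less_iff powr_realpow R'_def)
    qed
    then have "R \<le> 2 ^ n * \<epsilon>" using \<epsilon> by (simp add: field_simps R'_def)
    then have "(\<integral>\<^sup>+w. ennreal (max (norm w) \<epsilon> powr (- (cmod \<gamma>)\<^sup>2)) * indicator (ball (0::'a) R) w \<partial>lborel)
      \<le> (\<integral>\<^sup>+w. ennreal (max (norm w) \<epsilon> powr (- real DIM('a))) * indicator (ball (0::'a) (2 ^ n * \<epsilon>)) w \<partial>lborel)"
      unfolding g by (intro nn_integral_mono mult_left_mono) (auto simp: indicator_def)
    also have "\<dots> \<le> ennreal (V * \<epsilon> powr (real DIM('a) - real DIM('a)) * (\<Sum>k<Suc n. (2 powr (real DIM('a) - real DIM('a))) ^ k))"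
      unfolding V_def by (rule nn_integral_truncated_power_ball[OF \<epsilon>(1)]) simp
    also have "\<dots> = ennreal (V * (real n + 1))" using \<epsilon> by (simp add: add.commute)
    finally have "ennreal ((normalization_const \<epsilon> \<theta> \<gamma>)\<^sup>2) *
      (\<integral>\<^sup>+w. ennreal (max (norm w) \<epsilon> powr (- (cmod \<gamma>)\<^sup>2)) * indicator (ball (0::'a) R) w \<partial>lborel) \<le> ennreal (1 / (c * l)) * ennreal (V * (real n + 1))"
      unfolding v by (intro mult_left_mono) auto
    also have "\<dots> = ennreal (1 / (c * l) * (V * (real n + 1)))"
      using c l V by (intro ennreal_mult[symmetric]) auto
    also have "\<dots> \<le> ennreal C"
    proof (rule ennreal_leI)
      have "1 / (c * l) * (V * (real n + 1)) \<le> 1 / (c * l) * (V * ((log 2 R' + 3) + l / ln 2))"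
        using n1 c l V by (intro mult_left_mono) auto
      also have "\<dots> = V * ((log 2 R' + 3) / (c * l) + 1 / (c * ln 2))"
        using c l by (simp add: field_simps)
      also have "\<dots> \<le> C"
        unfolding C_def
      proof (intro mult_left_mono[OF _ V] add_right_mono divide_left_mono)
        show "c * ln (1 / max \<epsilon>\<^sub>0 (1/2)) \<le> c * l" by (rule mult_left_mono[OF l(2)]) (use c in simp)
        show "0 \<le> log 2 R' + 3" using lR by linarith
        show "0 < c * l * (c * ln (1 / max \<epsilon>\<^sub>0 (1/2)))" by (intro mult_pos_pos c l(1) l0)
      qed
      finally show "1 / (c * l) * (V * (real n + 1)) \<le> C" .
    qed
    finally show ?thesis .
  qed
  then show ?thesis using C0 by blast
qed

section \<open>The chaos\<close>

definition chaos_density ::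
    "'w measure \<Rightarrow> 'a::euclidean_space set \<Rightarrow> ('a \<Rightarrow> 'w \<Rightarrow> real) \<Rightarrow> complex \<Rightarrow> 'a \<Rightarrow> 'w \<Rightarrow> complex" where
  "chaos_density P A Y \<gamma> x \<omega> = indicator A x *
     exp (\<gamma> * of_real (Y x \<omega>) - \<gamma>\<^sup>2 / 2 * of_real (LINT \<omega>'|P. Y x \<omega>' * Y x \<omega>'))"

lemma measurable_chaos_density:
  fixes Y :: "'a::euclidean_space \<Rightarrow> 'w \<Rightarrow> real"
  assumes P: "prob_space P" and A: "A \<in> sets borel" and m: "\<And>x. x \<in> A \<Longrightarrow> Y x \<in> borel_measurable P"
    and c: "\<And>\<omega>. \<omega> \<in> space P \<Longrightarrow> continuous_on A (\<lambda>x. Y x \<omega>)"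
  shows "(\<lambda>(x, \<omega>). chaos_density P A Y \<gamma> x \<omega>) \<in> borel_measurable (borel \<Otimes>\<^sub>M P)"
proof -
  interpret prob_space P by fact
  define y where "y x \<omega> = indicator A x * Y x \<omega>" for x \<omega>
  have [measurable]: "(\<lambda>(x, \<omega>). y x \<omega>) \<in> borel_measurable (borel \<Otimes>\<^sub>M P)"
    unfolding y_def by (rule measurable_caratheodory[OF A m c])
  have [measurable]: "A \<in> sets borel" by (rule A)
  have "(\<lambda>(x, \<omega>). indicator A x * exp (\<gamma> * of_real (y x \<omega>) - \<gamma>\<^sup>2 / 2 * of_real (LINT \<omega>'|P. y x \<omega>' * y x \<omega>')))
    \<in> borel_measurable (borel \<Otimes>\<^sub>M P)"
    by measurable
  also have "(\<lambda>(x, \<omega>). indicator A x * exp (\<gamma> * of_real (y x \<omega>) - \<gamma>\<^sup>2 / 2 * of_real (LINT \<omega>'|P. y x \<omega>' * y x \<omega>')))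
    = (\<lambda>(x, \<omega>). chaos_density P A Y \<gamma> x \<omega>)"
    by (intro ext) (auto simp: chaos_density_def y_def indicator_def)
  finally show ?thesis .
qed

text \<open>Membership in \<open>D\<close> is implied by the inequalities: for \<open>x \<notin> D\<close> the one with \<open>y = x\<close> fails.\<close>

lemma closed_inner_domain:
  assumes "\<epsilon> > 0"
  shows "closed (inner_domain D \<epsilon>)"
proof -
  have "inner_domain D \<epsilon> = (\<Inter>y\<in>- D. {x. 2 * \<epsilon> \<le> norm (x - y)})"
  proof (intro set_eqI iffI)
    fix x assume x: "x \<in> (\<Inter>y\<in>- D. {x. 2 * \<epsilon> \<le> norm (x - y)})"
    have "x \<in> D"
    proof (rule ccontr)
      assume "x \<notin> D"
      with x have "2 * \<epsilon> \<le> norm (x - x)" by blast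
      with assms show False by simp
    qed
    with x show "x \<in> inner_domain D \<epsilon>" by (auto simp: inner_domain_def)
  qed (auto simp: inner_domain_def)
  moreover have "closed {x::'a. 2 * \<epsilon> \<le> norm (x - y)}" for y
    by (intro closed_Collect_le continuous_intros)
  ultimately show ?thesis by (simp add: closed_INT)
qed

context log_correlated
begin

lemma mollification_gaussian_pair:
  assumes P: "prob_space P" and X: "gaussian_field P D K X" and \<epsilon>: "\<epsilon> \<in> {0<..<1}"
    and Y: "continuous_mollification P D \<theta> X \<epsilon> Y"
    and xy: "x \<in> inner_domain D \<epsilon>" "y \<in> inner_domain D \<epsilon>"
  shows "gaussian_pair P (Y x) (Y y)"
    "(LINT \<omega>|P. Y x \<omega> * Y y \<omega>) = (LINT \<omega>|P. X (mollifier_measure D \<theta> \<epsilon> x) \<omega> * X (mollifier_measure D \<theta> \<epsilon> y) \<omega>)"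
proof -
  have GP: "centered_gaussian_process P (M_signed D K) X"
    using X unfolding gaussian_field_def by (rule conjunct1)
  have M: "mollifier_measure D \<theta> \<epsilon> x \<in> M_signed D K" "mollifier_measure D \<theta> \<epsilon> y \<in> M_signed D K"
    using mollifier_measure_in_M_signed xy \<epsilon> by blast+
  have Yx: "Y x \<in> borel_measurable P" "AE \<omega> in P. Y x \<omega> = X (mollifier_measure D \<theta> \<epsilon> x) \<omega>"
    and Yy: "Y y \<in> borel_measurable P" "AE \<omega> in P. Y y \<omega> = X (mollifier_measure D \<theta> \<epsilon> y) \<omega>"
    using Y xy by (auto simp: continuous_mollification_def)
  show "gaussian_pair P (Y x) (Y y)"
    by (rule gaussian_pair_of_process[OF GP, OF M Yx Yy])
  have [measurable]: "X (mollifier_measure D \<theta> \<epsilon> x) \<in> borel_measurable P" "X (mollifier_measure D \<theta> \<epsilon> y) \<in> borel_measurable P"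
    using GP M by (auto simp: centered_gaussian_process_def)
  note [measurable] = Yx(1) Yy(1)
  show "(LINT \<omega>|P. Y x \<omega> * Y y \<omega>) = (LINT \<omega>|P. X (mollifier_measure D \<theta> \<epsilon> x) \<omega> * X (mollifier_measure D \<theta> \<epsilon> y) \<omega>)"
  proof (rule integral_cong_AE)
    show "AE \<omega> in P. Y x \<omega> * Y y \<omega> = X (mollifier_measure D \<theta> \<epsilon> x) \<omega> * X (mollifier_measure D \<theta> \<epsilon> y) \<omega>"
      using Yx(2) Yy(2) by eventually_elim simp
  qed measurable
qed

text \<open>The real part of \<open>\<gamma>\<^sup>2\<close> may be negative, and then the deterministic term is large; it is controlled
  by the bound \<open>\<kappa>\<close> on the variance.\<close>

lemma norm_exp_chaos_le:
  fixes \<gamma> :: complex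
  assumes "0 \<le> k" "k \<le> \<kappa>"
  shows "norm (exp (\<gamma> * of_real t - \<gamma>\<^sup>2 / 2 * of_real k)) \<le> exp (Re \<gamma> * t) * exp ((cmod \<gamma>)\<^sup>2 / 2 * \<kappa>)"
proof -
  have "\<bar>Re (\<gamma>\<^sup>2)\<bar> \<le> (cmod \<gamma>)\<^sup>2" using abs_Re_le_cmod[of "\<gamma>\<^sup>2"] by (simp add: norm_power)
  then have "- Re (\<gamma>\<^sup>2) * k \<le> (cmod \<gamma>)\<^sup>2 * \<kappa>" using assms by (intro mult_mono) auto
  then have "Re (\<gamma> * of_real t - \<gamma>\<^sup>2 / 2 * of_real k) \<le> Re \<gamma> * t + (cmod \<gamma>)\<^sup>2 / 2 * \<kappa>" by simp
  then show ?thesis by (simp flip: exp_add)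
qed

text \<open>The constant \<open>C\<close> and the radius \<open>R\<close> do not depend on \<open>\<epsilon>\<close>: the exponential of
  \<open>|\<gamma>|\<^sup>2\<close> times the logarithmic bound on the covariance is a constant times the truncated power.\<close>

lemma chaos_second_moment:
  assumes P: "prob_space P" and X: "gaussian_field P D K X"
    and Y: "\<And>\<epsilon>. \<epsilon> \<in> {0<..<1} \<Longrightarrow> continuous_mollification P D \<theta> X \<epsilon> (Y \<epsilon>)"
    and S: "compact S" "S \<subseteq> D"
  shows "\<exists>C\<ge>0. \<exists>R. \<forall>\<epsilon>\<in>{0<..<1}. \<forall>\<psi>\<in>borel_measurable borel. \<forall>M\<ge>0. (\<forall>x. norm (\<psi> x :: complex) \<le> M * indicator S x) \<longrightarrow>
    (\<forall>\<omega>\<in>space P. integrable lborel (\<lambda>x. \<psi> x * chaos_density P (inner_domain D \<epsilon>) (Y \<epsilon>) \<gamma> x \<omega>)) \<and>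
    (\<integral>\<^sup>+\<omega>. ennreal ((norm (LINT x|lborel. \<psi> x * chaos_density P (inner_domain D \<epsilon>) (Y \<epsilon>) \<gamma> x \<omega>))\<^sup>2) \<partial>P)
    \<le> ennreal (M\<^sup>2 * C) * (\<integral>\<^sup>+w. ennreal (max (norm w) \<epsilon> powr (- (cmod \<gamma>)\<^sup>2)) * indicator (ball (0::'a) R) w \<partial>lborel)"
proof -
  interpret prob_space P by fact
  define g where "g = (cmod \<gamma>)\<^sup>2"
  have g0: "g \<ge> 0" by (simp add: g_def)
  obtain C where C: "\<And>\<epsilon> x y. \<epsilon> \<in> {0<..<1} \<Longrightarrow> x \<in> S \<inter> inner_domain D \<epsilon> \<Longrightarrow> y \<in> S \<inter> inner_domain D \<epsilon> \<Longrightarrow>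
    (LINT \<omega>|P. X (mollifier_measure D \<theta> \<epsilon> x) \<omega> * X (mollifier_measure D \<theta> \<epsilon> y) \<omega>) \<le> C - ln (max (norm (x - y)) \<epsilon>)"
    using mollified_covariance_le[OF S X] by blast
  obtain R where R: "\<And>x. x \<in> S \<Longrightarrow> norm x \<le> R" using S compact_imp_bounded bounded_iff by metis
  have [measurable]: "S \<in> sets borel" using S by (simp add: borel_compact)
  have Sfin: "emeasure lborel S < \<infinity>" by (rule emeasure_compact_finite[OF S(1)])
  define C' where "C' = exp (g * C) * measure lborel S"
  have C'0: "C' \<ge> 0" by (simp add: C'_def)
  have "(\<forall>\<omega>\<in>space P. integrable lborel (\<lambda>x. \<psi> x * chaos_density P (inner_domain D \<epsilon>) (Y \<epsilon>) \<gamma> x \<omega>)) \<and>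
    (\<integral>\<^sup>+\<omega>. ennreal ((norm (LINT x|lborel. \<psi> x * chaos_density P (inner_domain D \<epsilon>) (Y \<epsilon>) \<gamma> x \<omega>))\<^sup>2) \<partial>P)
    \<le> ennreal (M\<^sup>2 * C') * (\<integral>\<^sup>+w. ennreal (max (norm w) \<epsilon> powr (- g)) * indicator (ball (0::'a) (2 * R + 1)) w \<partial>lborel)"
    if \<epsilon>: "\<epsilon> \<in> {0<..<1}" and \<psi>[measurable]: "\<psi> \<in> borel_measurable borel" and M: "M \<ge> 0"
      and \<psi>M: "\<And>x. norm (\<psi> x :: complex) \<le> M * indicator S x" for \<epsilon> \<psi> M
  proof -
    let ?A = "inner_domain D \<epsilon>" and ?Y = "Y \<epsilon>"
    define H where "H = chaos_density P ?A ?Y \<gamma>"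
    have A: "closed ?A" using \<epsilon> by (intro closed_inner_domain) auto
    have Ym: "?Y x \<in> borel_measurable P" if "x \<in> ?A" for x
      using Y[OF \<epsilon>] that by (auto simp: continuous_mollification_def)
    have Yc: "continuous_on ?A (\<lambda>x. ?Y x \<omega>)" if "\<omega> \<in> space P" for \<omega>
      using Y[OF \<epsilon>] that by (auto simp: continuous_mollification_def)
    have Hm[measurable]: "(\<lambda>(x, \<omega>). H x \<omega>) \<in> borel_measurable (borel \<Otimes>\<^sub>M P)"
      unfolding H_def by (rule measurable_chaos_density[OF P _ Ym Yc]) (use A in auto)
    define k where "k x y = (LINT \<omega>|P. ?Y x \<omega> * ?Y y \<omega>)" for x y
    define \<kappa> where "\<kappa> = C - ln \<epsilon>"
    have pair: "gaussian_pair P (?Y x) (?Y y)" if "x \<in> ?A" "y \<in> ?A" for x y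
      by (rule mollification_gaussian_pair(1)[OF P X \<epsilon> Y[OF \<epsilon>] that])
    have kle: "k x y \<le> C - ln (max (norm (x - y)) \<epsilon>)" if "x \<in> S \<inter> ?A" "y \<in> S \<inter> ?A" for x y
      unfolding k_def using mollification_gaussian_pair(2)[OF P X \<epsilon> Y[OF \<epsilon>], of x y] C[OF \<epsilon> that] that by simp
    have k0: "0 \<le> k x x" for x unfolding k_def by simp
    have kd: "k x x \<le> \<kappa>" if "x \<in> S \<inter> ?A" for x
      using kle[OF that that] \<epsilon> by (simp add: \<kappa>_def)
    have H_in: "H x \<omega> = exp (\<gamma> * of_real (?Y x \<omega>) - \<gamma>\<^sup>2 / 2 * of_real (k x x))" if "x \<in> ?A" for x \<omega>
      using that by (simp add: H_def chaos_density_def k_def)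
    have H_out: "H x \<omega> = 0" if "x \<notin> ?A" for x \<omega>
      using that by (simp add: H_def chaos_density_def)
    have \<psi>0: "\<psi> x = 0" if "x \<notin> S" for x using \<psi>M[of x] that by simp
    have \<psi>M': "norm (\<psi> x) \<le> M" for x using \<psi>M[of x] M by (cases "x \<in> S") auto
    have Hle: "norm (H x \<omega>) \<le> exp (Re \<gamma> * ?Y x \<omega>) * exp (g / 2 * \<kappa>)" if "x \<in> S \<inter> ?A" for x \<omega>
      using that norm_exp_chaos_le[OF k0 kd[OF that], of \<gamma> "?Y x \<omega>"] by (simp add: H_in g_def)
    have path: "integrable lborel (\<lambda>x. \<psi> x * H x \<omega>)" if \<omega>: "\<omega> \<in> space P" for \<omega>
    proof -
      have cpt: "compact ((\<lambda>x. ?Y x \<omega>) ` (S \<inter> ?A))"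
        by (intro compact_continuous_image continuous_on_subset[OF Yc[OF \<omega>]] compact_Int_closed S A) auto
      then obtain B where B: "\<And>x. x \<in> S \<inter> ?A \<Longrightarrow> \<bar>?Y x \<omega>\<bar> \<le> B"
      proof -
        from compact_imp_bounded[OF cpt] obtain B where "\<forall>v\<in>(\<lambda>x. ?Y x \<omega>) ` (S \<inter> ?A). norm v \<le> B"
          unfolding bounded_iff by blast
        then show ?thesis by (intro that[of B]) auto
      qed
      have [measurable]: "(\<lambda>x. H x \<omega>) \<in> borel_measurable borel"
        using measurable_Pair1[OF Hm \<omega>] by simp
      show ?thesis
      proof (rule Bochner_Integration.integrable_bound)
        show "integrable lborel (\<lambda>x. M * (exp (\<bar>Re \<gamma>\<bar> * B) * exp (g / 2 * \<kappa>)) * indicator S x :: real)"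
          using Sfin by (intro integrable_mult_right integrable_real_indicator) auto
        show "AE x in lborel. norm (\<psi> x * H x \<omega>) \<le> norm (M * (exp (\<bar>Re \<gamma>\<bar> * B) * exp (g / 2 * \<kappa>)) * indicator S x :: real)"
        proof (intro AE_I2)
          fix x
          show "norm (\<psi> x * H x \<omega>) \<le> norm (M * (exp (\<bar>Re \<gamma>\<bar> * B) * exp (g / 2 * \<kappa>)) * indicator S x :: real)"
          proof (cases "x \<in> S \<inter> ?A")
            case True
            have "Re \<gamma> * ?Y x \<omega> \<le> \<bar>Re \<gamma>\<bar> * \<bar>?Y x \<omega>\<bar>" by (metis abs_ge_self abs_mult)
            also have "\<dots> \<le> \<bar>Re \<gamma>\<bar> * B" using B[OF True] by (intro mult_left_mono) auto
            finally have "exp (Re \<gamma> * ?Y x \<omega>) * exp (g / 2 * \<kappa>) \<le> exp (\<bar>Re \<gamma>\<bar> * B) * exp (g / 2 * \<kappa>)" by simp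
            with Hle[OF True, of \<omega>] have "norm (H x \<omega>) \<le> exp (\<bar>Re \<gamma>\<bar> * B) * exp (g / 2 * \<kappa>)" by linarith
            then have "norm (\<psi> x) * norm (H x \<omega>) \<le> M * (exp (\<bar>Re \<gamma>\<bar> * B) * exp (g / 2 * \<kappa>))"
              using \<psi>M' M by (intro mult_mono) auto
            then show ?thesis using True M by (simp add: norm_mult)
          next
            case False
            then have "norm (\<psi> x * H x \<omega>) = 0" using \<psi>0 H_out by auto
            then show ?thesis by (simp only: norm_ge_zero)
          qed
        qed
      qed simp
    qed
    let ?G = "\<lambda>x \<omega>. \<psi> x * H x \<omega>"
    let ?\<kappa> = "\<lambda>x y. M\<^sup>2 * exp (g * C) * (max (norm (x - y)) \<epsilon> powr (- g) * (indicator S x * indicator S y))"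
    have "(\<integral>\<^sup>+\<omega>. ennreal ((norm (LINT x|lborel. ?G x \<omega>))\<^sup>2) \<partial>P) \<le> (\<integral>\<^sup>+x. \<integral>\<^sup>+y. ennreal (?\<kappa> x y) \<partial>lborel \<partial>lborel)"
    proof (rule second_moment_integral[OF lborel.sigma_finite_measure_axioms P])
      show "(\<lambda>(x, \<omega>). ?G x \<omega>) \<in> borel_measurable (lborel \<Otimes>\<^sub>M P)"
      proof -
        have [measurable]: "(\<lambda>(x, \<omega>). H x \<omega>) \<in> borel_measurable (lborel \<Otimes>\<^sub>M P)" using Hm by simp
        show ?thesis by measurable
      qed
      show "integrable lborel (\<lambda>x. ?G x \<omega>)" if "\<omega> \<in> space P" for \<omega> by (rule path[OF that])
      let ?b = "M\<^sup>2 * (exp (2 * (Re \<gamma>)\<^sup>2 * \<kappa>) * exp (g * \<kappa>))"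
      have b0: "?b \<ge> 0" by simp
      have "(\<integral>\<^sup>+\<omega>. ennreal (norm (?G x \<omega>) * norm (?G y \<omega>)) \<partial>P) \<le> ennreal ?b * (indicator S x * indicator S y)" for x y
      proof (cases "x \<in> S \<inter> ?A \<and> y \<in> S \<inter> ?A")
        case True
        then have x: "x \<in> S \<inter> ?A" and y: "y \<in> S \<inter> ?A" by auto
        have xy: "x \<in> ?A" "y \<in> ?A" using x y by auto
        note gb = gaussian_pair_exp_bound[OF P pair[OF xy] kd[OF x, unfolded k_def] kd[OF y, unfolded k_def], of "Re \<gamma>"]
        have "(\<integral>\<^sup>+\<omega>. ennreal (norm (?G x \<omega>) * norm (?G y \<omega>)) \<partial>P)
          \<le> (\<integral>\<^sup>+\<omega>. ennreal (M\<^sup>2 * exp (g * \<kappa>) * exp (Re \<gamma> * (?Y x \<omega> + ?Y y \<omega>))) \<partial>P)"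
        proof (intro nn_integral_mono ennreal_leI)
          fix \<omega>
          have "norm (?G x \<omega>) * norm (?G y \<omega>) \<le> (M * (exp (Re \<gamma> * ?Y x \<omega>) * exp (g / 2 * \<kappa>))) * (M * (exp (Re \<gamma> * ?Y y \<omega>) * exp (g / 2 * \<kappa>)))"
            unfolding norm_mult using \<psi>M' M Hle[OF x] Hle[OF y] by (intro mult_mono) auto
          also have "\<dots> = M\<^sup>2 * (exp (g / 2 * \<kappa>) * exp (g / 2 * \<kappa>)) * (exp (Re \<gamma> * ?Y x \<omega>) * exp (Re \<gamma> * ?Y y \<omega>))"
            by (simp add: power2_eq_square mult_ac)
          also have "\<dots> = M\<^sup>2 * exp (g * \<kappa>) * exp (Re \<gamma> * (?Y x \<omega> + ?Y y \<omega>))"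
            by (simp add: distrib_left flip: exp_add)
          finally show "norm (?G x \<omega>) * norm (?G y \<omega>) \<le> M\<^sup>2 * exp (g * \<kappa>) * exp (Re \<gamma> * (?Y x \<omega> + ?Y y \<omega>))" .
        qed
        also have "\<dots> = ennreal (LINT \<omega>|P. M\<^sup>2 * exp (g * \<kappa>) * exp (Re \<gamma> * (?Y x \<omega> + ?Y y \<omega>)))"
          using gb(1) by (intro nn_integral_eq_integral integrable_mult_right) auto
        also have "\<dots> = ennreal (M\<^sup>2 * exp (g * \<kappa>) * (LINT \<omega>|P. exp (Re \<gamma> * (?Y x \<omega> + ?Y y \<omega>))))" by simp
        also have "\<dots> \<le> ennreal (M\<^sup>2 * exp (g * \<kappa>) * exp (2 * (Re \<gamma>)\<^sup>2 * \<kappa>))"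
          using gb(2) by (intro ennreal_leI mult_left_mono) auto
        finally show ?thesis using True by (simp add: mult_ac)
      next
        case False
        then have z: "norm (?G x \<omega>) * norm (?G y \<omega>) = 0" for \<omega> using \<psi>0 H_out by auto
        have "(\<integral>\<^sup>+\<omega>. ennreal (norm (?G x \<omega>) * norm (?G y \<omega>)) \<partial>P) = 0" unfolding z by simp
        then show ?thesis by (simp only: zero_le)
      qed
      then have "(\<integral>\<^sup>+x. \<integral>\<^sup>+y. \<integral>\<^sup>+\<omega>. ennreal (norm (?G x \<omega>) * norm (?G y \<omega>)) \<partial>P \<partial>lborel \<partial>lborel)
        \<le> (\<integral>\<^sup>+x. \<integral>\<^sup>+y. ennreal ?b * (indicator S x * indicator S y) \<partial>lborel \<partial>lborel)"
        by (intro nn_integral_mono)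
      also have "\<dots> = ennreal ?b * (emeasure lborel S * emeasure lborel S)"
        by (simp add: nn_integral_cmult nn_integral_multc)
      also have "\<dots> < \<infinity>" using Sfin by (simp add: ennreal_mult_less_top)
      finally show "(\<integral>\<^sup>+x. \<integral>\<^sup>+y. \<integral>\<^sup>+\<omega>. ennreal (norm (?G x \<omega>) * norm (?G y \<omega>)) \<partial>P \<partial>lborel \<partial>lborel) < \<infinity>" .
      fix x y
      show "norm (LINT \<omega>|P. ?G x \<omega> * cnj (?G y \<omega>)) \<le> ?\<kappa> x y"
      proof (cases "x \<in> S \<inter> ?A \<and> y \<in> S \<inter> ?A")
        case True
        then have x: "x \<in> S \<inter> ?A" and y: "y \<in> S \<inter> ?A" by auto
        have xy: "x \<in> ?A" "y \<in> ?A" using x y by auto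
        have m0: "max (norm (x - y)) \<epsilon> > 0" using \<epsilon> by auto
        have "(LINT \<omega>|P. ?G x \<omega> * cnj (?G y \<omega>)) = (LINT \<omega>|P. (\<psi> x * cnj (\<psi> y)) * (H x \<omega> * cnj (H y \<omega>)))"
          by (simp add: mult_ac)
        also have "\<dots> = (\<psi> x * cnj (\<psi> y)) * (LINT \<omega>|P. H x \<omega> * cnj (H y \<omega>))" by (rule integral_mult_right_zero)
        also have "(LINT \<omega>|P. H x \<omega> * cnj (H y \<omega>)) = of_real (exp (g * k x y))"
          unfolding H_in[OF xy(1)] H_in[OF xy(2)] k_def g_def by (rule gaussian_pair_chaos_covariance[OF P pair[OF xy]])
        finally have "norm (LINT \<omega>|P. ?G x \<omega> * cnj (?G y \<omega>)) = norm (\<psi> x) * norm (\<psi> y) * exp (g * k x y)"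
          by (simp add: norm_mult)
        also have "\<dots> \<le> M * M * exp (g * (C - ln (max (norm (x - y)) \<epsilon>)))"
        proof (intro mult_mono)
          show "exp (g * k x y) \<le> exp (g * (C - ln (max (norm (x - y)) \<epsilon>)))"
            using kle[OF x y] g0 by (simp add: mult_left_mono)
        qed (use \<psi>M' M in auto)
        also have "exp (g * (C - ln (max (norm (x - y)) \<epsilon>))) = exp (g * C) * max (norm (x - y)) \<epsilon> powr (- g)"
          using m0 by (simp add: powr_def right_diff_distrib exp_diff exp_minus divide_inverse)
        finally show ?thesis using True by (simp add: power2_eq_square mult_ac)
      next
        case False
        then have z: "?G x \<omega> * cnj (?G y \<omega>) = 0" for \<omega> using \<psi>0 H_out by auto
        have "(LINT \<omega>|P. ?G x \<omega> * cnj (?G y \<omega>)) = 0" unfolding z by simp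
        then show ?thesis by (simp only: norm_zero) simp
      qed
    qed
    also have "(\<integral>\<^sup>+x. \<integral>\<^sup>+y. ennreal (?\<kappa> x y) \<partial>lborel \<partial>lborel)
      \<le> (\<integral>\<^sup>+x. ennreal (M\<^sup>2 * exp (g * C)) * (\<integral>\<^sup>+w. ennreal (max (norm w) \<epsilon> powr (- g)) * indicator (ball (0::'a) (2 * R + 1)) w \<partial>lborel) * indicator S x \<partial>lborel)"
    proof (rule nn_integral_mono)
      fix x
      let ?h = "\<lambda>w. ennreal (max (norm w) \<epsilon> powr (- g)) * indicator (ball (0::'a) (2 * R + 1)) w"
      have [measurable]: "ball (0::'a) (2 * R + 1) \<in> sets borel" by simp
      have "(\<integral>\<^sup>+y. ennreal (?\<kappa> x y) \<partial>lborel) \<le> (\<integral>\<^sup>+y. ennreal (M\<^sup>2 * exp (g * C)) * (indicator S x * ?h (y - x)) \<partial>lborel)"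
      proof (rule nn_integral_mono)
        fix y
        show "ennreal (?\<kappa> x y) \<le> ennreal (M\<^sup>2 * exp (g * C)) * (indicator S x * ?h (y - x))"
        proof (cases "x \<in> S \<and> y \<in> S")
          case True
          then have "norm (y - x) < 2 * R + 1" using R[of x] R[of y] norm_triangle_ineq4[of y x] by linarith
          then show ?thesis using True by (simp add: ennreal_mult norm_minus_commute[of x y])
        next
          case False
          then have "indicat_real S x * indicat_real S y = 0" by auto
          then show ?thesis by (simp only: mult_zero_right ennreal_0 zero_le)
        qed
      qed
      also have "\<dots> = ennreal (M\<^sup>2 * exp (g * C)) * (indicator S x * (\<integral>\<^sup>+y. ?h (y - x) \<partial>lborel))"
        by (simp add: nn_integral_cmult)
      also have "(\<integral>\<^sup>+y. ?h (y - x) \<partial>lborel) = (\<integral>\<^sup>+w. ?h w \<partial>lborel)"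
        by (rule lborel_nn_integral_translate) measurable
      finally show "(\<integral>\<^sup>+y. ennreal (?\<kappa> x y) \<partial>lborel) \<le> ennreal (M\<^sup>2 * exp (g * C)) * (\<integral>\<^sup>+w. ?h w \<partial>lborel) * indicator S x"
        by (simp add: mult_ac)
    qed
    also have "\<dots> = ennreal (M\<^sup>2 * exp (g * C)) * (\<integral>\<^sup>+w. ennreal (max (norm w) \<epsilon> powr (- g)) * indicator (ball (0::'a) (2 * R + 1)) w \<partial>lborel) * emeasure lborel S"
      by (rule nn_integral_cmult_indicator) simp
    also have "\<dots> = ennreal (M\<^sup>2 * C') * (\<integral>\<^sup>+w. ennreal (max (norm w) \<epsilon> powr (- g)) * indicator (ball (0::'a) (2 * R + 1)) w \<partial>lborel)"
    proof -
      have "emeasure lborel S = ennreal (measure lborel S)"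
        using Sfin by (intro emeasure_eq_ennreal_measure) auto
      then show ?thesis by (simp add: C'_def ennreal_mult mult_ac)
    qed
    finally show ?thesis using path unfolding H_def by blast
  qed
  then show ?thesis using C'0 unfolding g_def by (intro exI[of _ C'] conjI exI[of _ "2 * R + 1"]) auto
qed

end

lemma norm_exp_i_diff_le: "norm (exp (\<i> * of_real a) - exp (\<i> * of_real b)) \<le> \<bar>a - b\<bar>"
proof -
  have "exp (\<i> * of_real a) - exp (\<i> * of_real b) = exp (\<i> * of_real b) * (exp (\<i> * of_real (a - b)) - 1)"
    by (simp add: right_diff_distrib flip: exp_add)
  then have "norm (exp (\<i> * of_real a) - exp (\<i> * of_real b)) = norm (exp (\<i> * of_real (a - b)) - 1)"
    by (simp add: norm_mult)
  then show ?thesis using iexp_approx1[of "a - b" 0] by simp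
qed

lemma tight_family_cong:
  assumes "\<And>i \<omega>. i \<in> I \<Longrightarrow> \<omega> \<in> space P \<Longrightarrow> Z i \<omega> = Z' i \<omega>" "tight_family P T I Z'"
  shows "tight_family P T I Z"
proof -
  have "{\<omega> \<in> space P. Z i \<omega> \<in> C} = {\<omega> \<in> space P. Z' i \<omega> \<in> C}" if "i \<in> I" for i C
    using assms(1)[OF that] by auto
  moreover have "Z i \<in> measurable P B \<longleftrightarrow> Z' i \<in> measurable P B" if "i \<in> I" for i B
    using assms(1)[OF that] by (intro measurable_cong)
  ultimately show ?thesis using assms(2) by (simp add: tight_family_def)
qed

text \<open>Multiplied by \<open>\<rho>\<close>, the chaos density is bounded with compact support for each \<open>\<omega>\<close>, so its Fourier
  transform is that of an integrable function and Parseval's identity identifies the distribution. Values and increments of the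
  transform are integrals of the chaos against \<open>v \<rho>(x) e\<^sup>i\<^sup>\<xi>\<^sup>x\<close> and its increments in \<open>\<xi>\<close>.\<close>

lemma (in log_correlated) tight_normalized_chaos:
  assumes P: "prob_space P" and X: "gaussian_field P D K X"
    and Y: "\<And>\<epsilon>. \<epsilon> \<in> {0<..<1} \<Longrightarrow> continuous_mollification P D \<theta> X \<epsilon> (Y \<epsilon>)"
    and \<rho>: "\<rho> \<in> test_functions D" and u: "u > real DIM('a) / 2"
    and \<gamma>: "cmod \<gamma> \<ge> sqrt DIM('a)"
    and I: "I \<subseteq> {0<..<1}" "cmod \<gamma> = sqrt DIM('a) \<Longrightarrow> \<exists>\<epsilon>\<^sub>0<1. \<forall>\<epsilon>\<in>I. \<epsilon> \<le> \<epsilon>\<^sub>0"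
  shows "tight_family P (sobolev_topology (- u)) I (\<lambda>\<epsilon>. normalized_chaos P D \<theta> (Y \<epsilon>) \<gamma> \<rho> \<epsilon>)"
proof -
  define S where "S = tsupport \<rho>"
  have S: "compact S" "S \<subseteq> D" using \<rho> by (auto simp: S_def test_functions_def)
  have [measurable]: "S \<in> sets borel" using S by (simp add: borel_compact)
  have [measurable]: "\<rho> \<in> borel_measurable borel" using \<rho> by (rule test_functionD)
  obtain B where B: "\<And>x. \<bar>\<rho> x\<bar> \<le> B" using test_functionD(5)[OF \<rho>] by (auto simp: bounded_iff)
  have B0: "B \<ge> 0" using B[of 0] by linarith
  obtain R0 where R0: "\<And>x. x \<in> S \<Longrightarrow> norm x \<le> R0" using S compact_imp_bounded bounded_iff by metis
  define R1 where "R1 = max R0 1"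
  have R1: "R1 \<ge> 1" "\<And>x. x \<in> S \<Longrightarrow> norm x \<le> R1" using R0 by (auto simp: R1_def intro: order_trans max.coboundedI1)
  define v where "v \<epsilon> = normalization_const \<epsilon> \<theta> \<gamma>" for \<epsilon>
  define H where "H \<epsilon> = chaos_density P (inner_domain D \<epsilon>) (Y \<epsilon>) \<gamma>" for \<epsilon>
  let ?J = "\<lambda>R \<epsilon>. \<integral>\<^sup>+w. ennreal (max (norm w) \<epsilon> powr (- (cmod \<gamma>)\<^sup>2)) * indicator (ball (0::'a) R) w \<partial>lborel"
  have "\<exists>C\<ge>0. \<exists>R. \<forall>\<epsilon>\<in>{0<..<1}. \<forall>\<psi>\<in>borel_measurable borel. \<forall>M\<ge>0.
    (\<forall>x. norm (\<psi> x :: complex) \<le> M * indicator S x) \<longrightarrow>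
    (\<forall>\<omega>\<in>space P. integrable lborel (\<lambda>x. \<psi> x * H \<epsilon> x \<omega>)) \<and>
    (\<integral>\<^sup>+\<omega>. ennreal ((norm (LINT x|lborel. \<psi> x * H \<epsilon> x \<omega>))\<^sup>2) \<partial>P) \<le> ennreal (M\<^sup>2 * C) * ?J R \<epsilon>"
    unfolding H_def by (rule chaos_second_moment[OF P X Y S])
  then obtain C R where C: "C \<ge> 0" and CR0: "\<forall>\<epsilon>\<in>{0<..<1}. \<forall>\<psi>\<in>borel_measurable borel. \<forall>M\<ge>0.
    (\<forall>x. norm (\<psi> x :: complex) \<le> M * indicator S x) \<longrightarrow>
    (\<forall>\<omega>\<in>space P. integrable lborel (\<lambda>x. \<psi> x * H \<epsilon> x \<omega>)) \<and>
    (\<integral>\<^sup>+\<omega>. ennreal ((norm (LINT x|lborel. \<psi> x * H \<epsilon> x \<omega>))\<^sup>2) \<partial>P) \<le> ennreal (M\<^sup>2 * C) * ?J R \<epsilon>"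
    by (elim exE conjE)
  have CR: "(\<forall>\<omega>\<in>space P. integrable lborel (\<lambda>x. \<psi> x * H \<epsilon> x \<omega>)) \<and>
    (\<integral>\<^sup>+\<omega>. ennreal ((norm (LINT x|lborel. \<psi> x * H \<epsilon> x \<omega>))\<^sup>2) \<partial>P) \<le> ennreal (M\<^sup>2 * C) * ?J R \<epsilon>"
    if "\<epsilon> \<in> {0<..<1}" "\<psi> \<in> borel_measurable borel" "M \<ge> 0" "\<And>x. norm (\<psi> x) \<le> M * indicator S x"
    for \<epsilon> M and \<psi> :: "'a \<Rightarrow> complex"
    using CR0[rule_format, OF that(1,2,3)] that(4) by blast
  obtain E where E: "E \<ge> 0" "\<And>\<epsilon>. \<epsilon> \<in> I \<Longrightarrow> ennreal ((v \<epsilon>)\<^sup>2) *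
    (\<integral>\<^sup>+w. ennreal (max (norm w) \<epsilon> powr (- (cmod \<gamma>)\<^sup>2)) * indicator (ball (0::'a) R) w \<partial>lborel) \<le> ennreal E"
    unfolding v_def using normalized_energy_bound[OF \<gamma> I, of \<theta> R] by blast
  have bound: "(\<integral>\<^sup>+\<omega>. ennreal ((norm (LINT x|lborel. \<psi> x * H \<epsilon> x \<omega>))\<^sup>2) \<partial>P) \<le> ennreal (M\<^sup>2 * C * E)"
    if \<epsilon>: "\<epsilon> \<in> I" and \<psi>: "\<psi> \<in> borel_measurable borel" and M: "M \<ge> 0"
      and le: "\<And>x. norm (\<psi> x) \<le> \<bar>v \<epsilon>\<bar> * M * indicator S x" for \<epsilon> M and \<psi> :: "'a \<Rightarrow> complex"
  proof -
    let ?J = "\<integral>\<^sup>+w. ennreal (max (norm w) \<epsilon> powr (- (cmod \<gamma>)\<^sup>2)) * indicator (ball (0::'a) R) w \<partial>lborel"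
    have "(\<integral>\<^sup>+\<omega>. ennreal ((norm (LINT x|lborel. \<psi> x * H \<epsilon> x \<omega>))\<^sup>2) \<partial>P) \<le> ennreal ((\<bar>v \<epsilon>\<bar> * M)\<^sup>2 * C) * ?J"
      using CR[of \<epsilon> \<psi> "\<bar>v \<epsilon>\<bar> * M"] \<epsilon> I(1) \<psi> M le by auto
    also have "ennreal ((\<bar>v \<epsilon>\<bar> * M)\<^sup>2 * C) = ennreal (M\<^sup>2 * C) * ennreal ((v \<epsilon>)\<^sup>2)"
      using C by (simp add: power_mult_distrib mult_ac flip: ennreal_mult)
    also have "ennreal (M\<^sup>2 * C) * ennreal ((v \<epsilon>)\<^sup>2) * ?J \<le> ennreal (M\<^sup>2 * C) * ennreal E"
      unfolding mult.assoc by (intro mult_left_mono E(2) \<epsilon>) simp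
    also have "\<dots> = ennreal (M\<^sup>2 * C * E)" using C E by (intro ennreal_mult[symmetric]) auto
    finally show ?thesis .
  qed
  define \<phi> where "\<phi> \<epsilon> \<omega> x = of_real (v \<epsilon> * \<rho> x) * H \<epsilon> x \<omega>" for \<epsilon> \<omega> x
  define g where "g \<epsilon> \<omega> = fourier (\<phi> \<epsilon> \<omega>)" for \<epsilon> \<omega>
  have \<rho>S: "norm (complex_of_real (v \<epsilon> * \<rho> x)) \<le> \<bar>v \<epsilon>\<bar> * B * indicator S x" for \<epsilon> x
  proof (cases "x \<in> S")
    case True
    then show ?thesis using B[of x] by (simp add: abs_mult mult_left_mono norm_mult)
  next
    case False
    then show ?thesis using zero_off_tsupport[of x \<rho>] by (simp add: S_def)
  qed
  have \<phi>i: "integrable lborel (\<phi> \<epsilon> \<omega>)" if "\<epsilon> \<in> I" "\<omega> \<in> space P" for \<epsilon> \<omega>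
  proof -
    have "integrable lborel (\<lambda>x. complex_of_real (v \<epsilon> * \<rho> x) * H \<epsilon> x \<omega>)"
      using CR[of \<epsilon> "\<lambda>x. of_real (v \<epsilon> * \<rho> x)" "\<bar>v \<epsilon>\<bar> * B"] that I(1) B0 \<rho>S by auto
    then show ?thesis by (simp add: \<phi>_def[abs_def])
  qed
  have \<phi>m: "\<phi> \<epsilon> \<omega> \<in> borel_measurable borel" if "\<epsilon> \<in> I" "\<omega> \<in> space P" for \<epsilon> \<omega>
    using borel_measurable_integrable[OF \<phi>i[OF that]] by simp
  have Hm: "(\<lambda>(x, \<omega>). H \<epsilon> x \<omega>) \<in> borel_measurable (borel \<Otimes>\<^sub>M P)" if "\<epsilon> \<in> I" for \<epsilon>
  proof -
    have e: "\<epsilon> \<in> {0<..<1}" using that I by auto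
    then have "closed (inner_domain D \<epsilon>)" by (intro closed_inner_domain) auto
    then show ?thesis
      unfolding H_def using Y[OF e] by (intro measurable_chaos_density[OF P]) (auto simp: continuous_mollification_def)
  qed
  have "tight_family P (sobolev_topology (- u)) I (\<lambda>\<epsilon> \<omega>. inverse_fourier (g \<epsilon> \<omega>))"
  proof (rule tight_family_sobolev[OF P \<theta> u])
    let ?C = "(B * R1)\<^sup>2 * C * E"
    show "0 \<le> ?C" using C E by simp
    fix \<epsilon> assume \<epsilon>: "\<epsilon> \<in> I"
    have m1: "(\<lambda>z. H \<epsilon> (f z) (h z)) \<in> borel_measurable M" if "f \<in> M \<rightarrow>\<^sub>M borel" "h \<in> M \<rightarrow>\<^sub>M P" for f h M
      using measurable_compose[OF measurable_Pair[OF that] Hm[OF \<epsilon>]] by simp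
    show "(\<lambda>(\<omega>, \<xi>). g \<epsilon> \<omega> \<xi>) \<in> borel_measurable (P \<Otimes>\<^sub>M borel)"
    proof -
      have [measurable]: "(\<lambda>(p, x). H \<epsilon> x (fst p)) \<in> borel_measurable ((P \<Otimes>\<^sub>M (borel :: 'a measure)) \<Otimes>\<^sub>M lborel)"
        unfolding case_prod_beta' by (intro m1) measurable
      have "(\<lambda>(p, x). exp (\<i> * of_real (snd p \<bullet> x)) * (of_real (v \<epsilon> * \<rho> x) * H \<epsilon> x (fst p)))
        \<in> borel_measurable ((P \<Otimes>\<^sub>M borel) \<Otimes>\<^sub>M lborel)"
        by measurable
      then have "(\<lambda>p. LINT x|lborel. exp (\<i> * of_real (snd p \<bullet> x)) * (of_real (v \<epsilon> * \<rho> x) * H \<epsilon> x (fst p)))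
        \<in> borel_measurable (P \<Otimes>\<^sub>M borel)"
        by (rule lborel.borel_measurable_lebesgue_integral)
      then show ?thesis by (simp add: g_def fourier_def \<phi>_def case_prod_beta')
    qed
    have g_eq: "g \<epsilon> \<omega> \<xi> = (LINT x|lborel. exp (\<i> * of_real (\<xi> \<bullet> x)) * of_real (v \<epsilon> * \<rho> x) * H \<epsilon> x \<omega>)" for \<omega> \<xi>
      by (simp add: g_def fourier_def \<phi>_def mult.assoc)
    have diff: "norm ((exp (\<i> * of_real (\<xi> \<bullet> x)) - exp (\<i> * of_real (\<xi>' \<bullet> x))) * complex_of_real (v \<epsilon> * \<rho> x))
        \<le> R1 * norm (\<xi> - \<xi>') * norm (complex_of_real (v \<epsilon> * \<rho> x))" for \<xi> \<xi>' x
    proof (cases "x \<in> S")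
      case True
      have "norm (exp (\<i> * of_real (\<xi> \<bullet> x)) - exp (\<i> * complex_of_real (\<xi>' \<bullet> x))) \<le> \<bar>\<xi> \<bullet> x - \<xi>' \<bullet> x\<bar>"
        by (rule norm_exp_i_diff_le)
      also have "\<dots> = \<bar>(\<xi> - \<xi>') \<bullet> x\<bar>" by (simp add: inner_diff_left)
      also have "\<dots> \<le> norm (\<xi> - \<xi>') * norm x" by (rule Cauchy_Schwarz_ineq2)
      also have "\<dots> \<le> norm (\<xi> - \<xi>') * R1" using R1(2)[OF True] by (intro mult_left_mono) auto
      finally show ?thesis unfolding norm_mult by (intro mult_right_mono) (auto simp: mult.commute)
    next
      case False
      then have "\<rho> x = 0" by (simp add: S_def zero_off_tsupport)
      then show ?thesis by simp
    qed
    show "(\<integral>\<^sup>+\<omega>. ennreal ((norm (g \<epsilon> \<omega> \<xi>))\<^sup>2) \<partial>P) \<le> ennreal ?C" for \<xi>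
    proof -
      have "(\<integral>\<^sup>+\<omega>. ennreal ((norm (g \<epsilon> \<omega> \<xi>))\<^sup>2) \<partial>P) \<le> ennreal (B\<^sup>2 * C * E)"
        unfolding g_eq
      proof (rule bound[OF \<epsilon> _ B0])
        show "norm (exp (\<i> * of_real (\<xi> \<bullet> x)) * complex_of_real (v \<epsilon> * \<rho> x)) \<le> \<bar>v \<epsilon>\<bar> * B * indicator S x" for x
          using \<rho>S[of \<epsilon> x] by (simp only: norm_mult norm_exp_i_times)
      qed measurable
      also have "\<dots> \<le> ennreal ?C"
      proof (intro ennreal_leI mult_right_mono E C power_mono B0)
        show "B \<le> B * R1" using B0 R1(1) by (simp add: mult_le_cancel_left1)
      qed
      finally show ?thesis .
    qed
    show "(\<integral>\<^sup>+\<omega>. ennreal ((norm (g \<epsilon> \<omega> \<xi> - g \<epsilon> \<omega> \<xi>'))\<^sup>2) \<partial>P) \<le> ennreal (?C * (norm (\<xi> - \<xi>'))\<^sup>2)" for \<xi> \<xi>'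
    proof -
      have eq: "g \<epsilon> \<omega> \<xi> - g \<epsilon> \<omega> \<xi>' = (LINT x|lborel. (exp (\<i> * of_real (\<xi> \<bullet> x)) - exp (\<i> * of_real (\<xi>' \<bullet> x))) * of_real (v \<epsilon> * \<rho> x) * H \<epsilon> x \<omega>)"
        if \<omega>: "\<omega> \<in> space P" for \<omega>
      proof -
        have "g \<epsilon> \<omega> \<xi> - g \<epsilon> \<omega> \<xi>' = (LINT x|lborel. exp (\<i> * of_real (\<xi> \<bullet> x)) * \<phi> \<epsilon> \<omega> x - exp (\<i> * of_real (\<xi>' \<bullet> x)) * \<phi> \<epsilon> \<omega> x)"
          unfolding g_def fourier_def
          by (rule Bochner_Integration.integral_diff[symmetric]; rule integrable_fourier_integrand[OF \<phi>i[OF \<epsilon> \<omega>]])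
        then show ?thesis by (simp add: \<phi>_def algebra_simps)
      qed
      have "(\<integral>\<^sup>+\<omega>. ennreal ((norm (g \<epsilon> \<omega> \<xi> - g \<epsilon> \<omega> \<xi>'))\<^sup>2) \<partial>P)
        = (\<integral>\<^sup>+\<omega>. ennreal ((norm (LINT x|lborel. (exp (\<i> * of_real (\<xi> \<bullet> x)) - exp (\<i> * of_real (\<xi>' \<bullet> x))) * of_real (v \<epsilon> * \<rho> x) * H \<epsilon> x \<omega>))\<^sup>2) \<partial>P)"
        by (intro nn_integral_cong) (simp only: eq)
      also have "\<dots> \<le> ennreal ((R1 * norm (\<xi> - \<xi>') * B)\<^sup>2 * C * E)"
      proof (rule bound[OF \<epsilon>])
        show "0 \<le> R1 * norm (\<xi> - \<xi>') * B" using R1(1) B0 by simp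
        show "norm ((exp (\<i> * of_real (\<xi> \<bullet> x)) - exp (\<i> * of_real (\<xi>' \<bullet> x))) * complex_of_real (v \<epsilon> * \<rho> x))
          \<le> \<bar>v \<epsilon>\<bar> * (R1 * norm (\<xi> - \<xi>') * B) * indicator S x" for x
        proof (rule order_trans[OF diff])
          have "R1 * norm (\<xi> - \<xi>') * norm (complex_of_real (v \<epsilon> * \<rho> x)) \<le> R1 * norm (\<xi> - \<xi>') * (\<bar>v \<epsilon>\<bar> * B * indicator S x)"
            using R1(1) by (intro mult_left_mono \<rho>S) simp
          then show "R1 * norm (\<xi> - \<xi>') * norm (complex_of_real (v \<epsilon> * \<rho> x)) \<le> \<bar>v \<epsilon>\<bar> * (R1 * norm (\<xi> - \<xi>') * B) * indicator S x"
            by (simp only: mult_ac)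
        qed
      qed measurable
      also have "(R1 * norm (\<xi> - \<xi>') * B)\<^sup>2 * C * E = ?C * (norm (\<xi> - \<xi>'))\<^sup>2"
        by (simp add: power_mult_distrib mult_ac)
      finally show ?thesis .
    qed
    fix \<omega> assume \<omega>: "\<omega> \<in> space P"
    show "\<exists>B. \<forall>\<xi>. norm (g \<epsilon> \<omega> \<xi>) \<le> B" unfolding g_def using norm_fourier_le by blast
    show "\<exists>B. \<forall>\<xi> \<xi>'. norm (g \<epsilon> \<omega> \<xi> - g \<epsilon> \<omega> \<xi>') \<le> B * norm (\<xi> - \<xi>')"
    proof (intro exI allI)
      fix \<xi> \<xi>' :: 'a
      have i: "integrable lborel (\<lambda>x. exp (\<i> * of_real (\<xi> \<bullet> x)) * \<phi> \<epsilon> \<omega> x)" for \<xi>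
        by (rule integrable_fourier_integrand[OF \<phi>i[OF \<epsilon> \<omega>]])
      have "norm (g \<epsilon> \<omega> \<xi> - g \<epsilon> \<omega> \<xi>') = norm (LINT x|lborel. exp (\<i> * of_real (\<xi> \<bullet> x)) * \<phi> \<epsilon> \<omega> x - exp (\<i> * of_real (\<xi>' \<bullet> x)) * \<phi> \<epsilon> \<omega> x)"
        unfolding g_def fourier_def using i by simp
      also have "\<dots> \<le> (LINT x|lborel. R1 * norm (\<xi> - \<xi>') * norm (\<phi> \<epsilon> \<omega> x))"
      proof (rule Bochner_Integration.integral_norm_bound_integral)
        show "integrable lborel (\<lambda>x. exp (\<i> * of_real (\<xi> \<bullet> x)) * \<phi> \<epsilon> \<omega> x - exp (\<i> * of_real (\<xi>' \<bullet> x)) * \<phi> \<epsilon> \<omega> x)"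
          using i by simp
        show "integrable lborel (\<lambda>x. R1 * norm (\<xi> - \<xi>') * norm (\<phi> \<epsilon> \<omega> x))" using \<phi>i[OF \<epsilon> \<omega>] by simp
        fix x
        have "exp (\<i> * of_real (\<xi> \<bullet> x)) * \<phi> \<epsilon> \<omega> x - exp (\<i> * of_real (\<xi>' \<bullet> x)) * \<phi> \<epsilon> \<omega> x
          = ((exp (\<i> * of_real (\<xi> \<bullet> x)) - exp (\<i> * of_real (\<xi>' \<bullet> x))) * complex_of_real (v \<epsilon> * \<rho> x)) * H \<epsilon> x \<omega>"
          by (simp add: \<phi>_def algebra_simps)
        then have "norm (exp (\<i> * of_real (\<xi> \<bullet> x)) * \<phi> \<epsilon> \<omega> x - exp (\<i> * of_real (\<xi>' \<bullet> x)) * \<phi> \<epsilon> \<omega> x)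
          \<le> R1 * norm (\<xi> - \<xi>') * norm (complex_of_real (v \<epsilon> * \<rho> x)) * norm (H \<epsilon> x \<omega>)"
          using diff by (simp only: norm_mult[of "_ * complex_of_real (v \<epsilon> * \<rho> x)" "H \<epsilon> x \<omega>"]) (intro mult_right_mono, auto)
        then show "norm (exp (\<i> * of_real (\<xi> \<bullet> x)) * \<phi> \<epsilon> \<omega> x - exp (\<i> * of_real (\<xi>' \<bullet> x)) * \<phi> \<epsilon> \<omega> x)
          \<le> R1 * norm (\<xi> - \<xi>') * norm (\<phi> \<epsilon> \<omega> x)"
          by (simp add: \<phi>_def norm_mult mult.assoc)
      qed
      also have "\<dots> = R1 * (LINT x|lborel. norm (\<phi> \<epsilon> \<omega> x)) * norm (\<xi> - \<xi>')" by simp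
      finally show "norm (g \<epsilon> \<omega> \<xi> - g \<epsilon> \<omega> \<xi>') \<le> R1 * (LINT x|lborel. norm (\<phi> \<epsilon> \<omega> x)) * norm (\<xi> - \<xi>')" .
    qed
  qed
  then show ?thesis
  proof (rule tight_family_cong[rotated])
    fix \<epsilon> \<omega> assume \<epsilon>: "\<epsilon> \<in> I" and \<omega>: "\<omega> \<in> space P"
    have gL: "g \<epsilon> \<omega> \<in> weighted_L2 (- u)"
      unfolding g_def using \<phi>m[OF \<epsilon> \<omega>] norm_fourier_le by (intro bounded_in_weighted_L2[OF _ _ u]) auto
    show "normalized_chaos P D \<theta> (Y \<epsilon>) \<gamma> \<rho> \<epsilon> \<omega> = inverse_fourier (g \<epsilon> \<omega>)"
      unfolding normalized_chaos_def inverse_fourier_def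
    proof (rule restrict_ext)
      fix f :: "'a \<Rightarrow> real" assume f: "f \<in> test_functions UNIV"
      have "of_real (normalization_const \<epsilon> \<theta> \<gamma>) * chaos P D (Y \<epsilon>) \<gamma> \<epsilon> \<omega> (\<lambda>x. \<rho> x * f x) = (LINT x|lborel. \<phi> \<epsilon> \<omega> x * of_real (f x))"
        unfolding chaos_def integral_mult_right_zero[symmetric]
        by (intro Bochner_Integration.integral_cong) (auto simp: \<phi>_def H_def v_def chaos_density_def indicator_def)
      moreover have "(LINT \<xi>|lborel. g \<epsilon> \<omega> \<xi> * test_fourier f (- \<xi>)) = of_real ((2 * pi) ^ DIM('a)) * (LINT x|lborel. \<phi> \<epsilon> \<omega> x * of_real (f x))"
        unfolding g_def
        using weighted_L2_pairing_integrable[OF gL f, unfolded g_def]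
        by (intro parseval_pairing \<phi>i[OF \<epsilon> \<omega>] test_functionD[OF f])
      ultimately show "of_real (normalization_const \<epsilon> \<theta> \<gamma>) * chaos P D (Y \<epsilon>) \<gamma> \<epsilon> \<omega> (\<lambda>x. \<rho> x * f x)
        = (LINT \<xi>|lborel. g \<epsilon> \<omega> \<xi> * test_fourier f (- \<xi>)) / of_real ((2 * pi) ^ DIM('a))"
        by simp
    qed
  qed
qed

theorem proposition1p2:
  fixes P :: "'w measure"
    and D :: "'a::euclidean_space set"
    and K :: "'a \<Rightarrow> 'a \<Rightarrow> ereal"
    and L :: "'a \<times> 'a \<Rightarrow> real"
    and X :: "('a set \<Rightarrow> real) \<Rightarrow> 'w \<Rightarrow> real"
    and X\<^sub>\<epsilon> :: "real \<Rightarrow> 'a \<Rightarrow> 'w \<Rightarrow> real"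
    and \<theta> \<rho> :: "'a \<Rightarrow> real"
    and \<alpha> \<beta> s u :: real
    and \<gamma> :: complex
  assumes "prob_space P"
    and "open D"
    and "positive_definite_kernel D K"
    and "\<And>x y. x \<in> D \<Longrightarrow> y \<in> D \<Longrightarrow> K x y = ereal (L (x, y)) + log_kernel x y"
    and "continuous_on (D \<times> D) L"
    and "s > real DIM('a)"
    and "sobolev_local s (D \<times> D) (\<lambda>p. of_real (L p))"
    and "gaussian_field P D K X"
    and "mollifier \<theta>"
    and "\<And>\<epsilon>. \<epsilon> \<in> {0<..<1} \<Longrightarrow> continuous_mollification P D \<theta> X \<epsilon> (X\<^sub>\<epsilon> \<epsilon>)"
    and "\<gamma> = of_real \<alpha> + \<i> * of_real \<beta>"
    and "\<bar>\<alpha>\<bar> < sqrt (real DIM('a) / 2)"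
    and "\<alpha>\<^sup>2 + \<beta>\<^sup>2 \<ge> real DIM('a)"
    and "\<rho> \<in> test_functions D"
    and "u > real DIM('a) / 2"
  shows "(cmod \<gamma> > sqrt DIM('a) \<longrightarrow>
            tight_family P (sobolev_topology (- u)) {0<..<1}
              (\<lambda>\<epsilon>. normalized_chaos P D \<theta> (X\<^sub>\<epsilon> \<epsilon>) \<gamma> \<rho> \<epsilon>)) \<and>
         (\<forall>\<epsilon>\<^sub>0\<in>{0<..<1}.
            tight_family P (sobolev_topology (- u)) {0<..\<epsilon>\<^sub>0}
              (\<lambda>\<epsilon>. normalized_chaos P D \<theta> (X\<^sub>\<epsilon> \<epsilon>) \<gamma> \<rho> \<epsilon>))"
proof -
  interpret log_correlated D K L \<theta>
    by (rule log_correlated.intro) (fact assms)+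
  have "(cmod \<gamma>)\<^sup>2 = \<alpha>\<^sup>2 + \<beta>\<^sup>2" unfolding assms(11) cmod_power2 by simp
  then have \<gamma>: "cmod \<gamma> \<ge> sqrt DIM('a)" using assms(13) by (simp add: real_le_lsqrt real_sqrt_le_iff real_le_rsqrt sqrt_le_D)
  note tight = tight_normalized_chaos[OF assms(1,8,10,14,15) \<gamma>]
  show ?thesis
    by (intro conjI impI ballI tight) auto
qed

end
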